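(* Let $T\in\mathbf{Mix}_\infty$ be a mixing transformation of $(X,\mathcal B,\mu)$, and let $S$ be a Sidon mixing transformation of rank one. For every $\varepsilon>0$ there exists an invertible measure-preserving map $R$ (from the space of $T$ onto the space of $S$, mod null sets) such that $r(R^{-1}SR,\,T)<\varepsilon$. (Thus the conjugacy class of $S$ is dense in $(\mathbf{Mix}_\infty,r)$.)
   Context: **Space and metrics.** Let $(X,\mathcal B,\mu)$ be a measure space isomorphic to the real line $\mathbf R$ with Lebesgue measure. $\mathbf{Aut}_\infty=\mathbf{Aut}(\mu)$ is the group of all invertible measure-preserving transformations (automorphisms) of $(X,\mathcal B,\mu)$, with transformations equal almost everywhere identified. Fix a sequence $\{A_i\}_{i\ge 1}$ of sets of finite measure, dense in the family of all measurable sets of finite measure (with respect to the pseudometric $\mu(A\Delta B)$), and such that $\sum_i 2^{-i}\mu(A_i)<\infty$, so that the sums below converge. Define $$\rho(S,T)=\sum_i 2^{-i}\left(\mu(SA_i\Delta TA_i)+\mu(S^{-1}A_i\Delta T^{-1}A_i)\right),$$ $$d_w(S,T)=\sum_{i,j=1}^\infty 2^{-i-j}\left|\mu(SA_i\cap A_j)-\mu(TA_i\cap A_j)\right|,$$ $$r(S,T)=\rho(S,T)+\sup_{n>0}d_w(S^n,T^n).$$ An automorphism $T$ is called mixing if $T^n\to_w 0$, that is, $\mu(T^nA\cap B)\to 0$ as $n\to\infty$ for all measurable $A,B$ of finite measure. Set $\mathbf{Mix}_\infty=\{T\in\mathbf{Aut}(\mu): T^n\to_w 0\}$, equipped with the metric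 $r$. **Rank-one construction.** It is given by a natural number $h_1$, a sequence of natural numbers $r_j\to\infty$, and integer vectors $\bar s_j=(s_j(1),\dots,s_j(r_j))$ with $s_j(i)\ge 0$. At step $j=1$ one has disjoint half-intervals $E_1,SE_1,\dots,S^{h_1-1}E_1$ of equal measure. At step $j$ one has disjoint half-intervals $E_j,SE_j,\dots,S^{h_j-1}E_j$ (the tower of stage $j$, with union $X_j$), where $S$ acts on $E_j,\dots,S^{h_j-2}E_j$ by parallel translation onto the next half-interval. Represent $E_j$ as a disjoint union of $r_j$ half-intervals $E_j^1,\dots,E_j^{r_j}$ of equal length; the $i$-th column is $E_j^i,SE_j^i,\dots,S^{h_j-1}E_j^i$, with union denoted $X_{i,j}$. Above the $i$-th column add $s_j(i)$ new disjoint half-intervals of the same measure as $E_j^i$, obtaining the disjoint sets $E_j^i,SE_j^i,\dots,S^{h_j+s_j(i)-1}E_j^i$. Put $E_{j+1}=E_j^1$ and $S^{h_j+s_j(i)}E_j^i=E_j^{i+1}$ for $i<r_j$. This gives the tower of stage $j+1$: $E_{j+1},SE_{j+1},\dots,S^{h_{j+1}-1}E_{j+1}$, with $h_{j+1}=h_jr_j+\sum_{i=1}^{r_j}s_j(i)$. The partial definition of $S$ at stage $j$ is preserved at later stages, so one obtains an invertible (mod null sets) Lebesgue-measure-preserving transformation $S$ of the space $\bigcup_jX_j$. **Sidon construction.** A rank-one construction $S$ is called Sidon if for every $j$ and every $m$ with $h_j<m\le h_{j+1}$ the intersection $X_j\cap S^mX_j$ is contained in only one of the columns $X_{i,j}$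 of the tower $X_j$. The space $\bigcup_j X_j$ of a Sidon construction has infinite measure (so it is isomorphic to $\mathbf R$ with Lebesgue measure), and, since $r_j\to\infty$, a Sidon construction is mixing. *)

theory Defs
  imports "HOL-Analysis.Analysis"
begin

(* Transformations are represented by functions, not by classes modulo null sets. An
   isomorphism mod null sets is a measurable, measure-preserving f together with a measurable g
   that is inverse to it almost everywhere on both sides. *)
definition iso_mod0 :: "'a measure \<Rightarrow> 'b measure \<Rightarrow> ('a \<Rightarrow> 'b) \<Rightarrow> ('b \<Rightarrow> 'a) \<Rightarrow> bool" where
  "iso_mod0 M N f g \<longleftrightarrow>
     f \<in> measurable M N \<and> g \<in> measurable N M \<and> distr M N f = N \<and>
     (AE x in M. g (f x) = x) \<and> (AE y in N. f (g y) = y)"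

definition automorphism :: "'a measure \<Rightarrow> ('a \<Rightarrow> 'a) \<Rightarrow> bool" where
  "automorphism M T \<longleftrightarrow> (\<exists>T'. iso_mod0 M M T T')"

(* Any two choices agree almost everywhere. *)
definition inverse_mod0 :: "'a measure \<Rightarrow> ('a \<Rightarrow> 'a) \<Rightarrow> 'a \<Rightarrow> 'a" where
  "inverse_mod0 M T = (SOME T'. iso_mod0 M M T T')"

(* The set TA. The pointwise image is not well defined modulo null sets, and need not even be
   measurable, so TA is taken to be the preimage of A under the inverse of T. *)
definition image_mod0 :: "'a measure \<Rightarrow> ('a \<Rightarrow> 'a) \<Rightarrow> 'a set \<Rightarrow> 'a set" where
  "image_mod0 M T A = inverse_mod0 M T -` A \<inter> space M"

definition mixing :: "'a measure \<Rightarrow> ('a \<Rightarrow> 'a) \<Rightarrow> bool" where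
  "mixing M T \<longleftrightarrow>
     (\<forall>A\<in>sets M. \<forall>B\<in>sets M. emeasure M A < \<infinity> \<longrightarrow> emeasure M B < \<infinity> \<longrightarrow>
        (\<lambda>n. measure M (image_mod0 M (T ^^ n) A \<inter> B)) \<longlonglongrightarrow> 0)"

definition Mix :: "'a measure \<Rightarrow> ('a \<Rightarrow> 'a) set" where
  "Mix M = {T. automorphism M T \<and> mixing M T}"

definition dense_sequence :: "'a measure \<Rightarrow> (nat \<Rightarrow> 'a set) \<Rightarrow> bool" where
  "dense_sequence M A \<longleftrightarrow>
     (\<forall>i\<ge>1. A i \<in> sets M \<and> emeasure M (A i) < \<infinity>) \<and>
     (\<forall>B\<in>sets M. emeasure M B < \<infinity> \<longrightarrow>
        (\<forall>\<delta>>0. \<exists>i\<ge>1. measure M (sym_diff (A i) B) < \<delta>)) \<and>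
     (\<lambda>i. (1/2) ^ i * measure M (A i)) summable_on {1..}"

definition metric_rho ::
  "'a measure \<Rightarrow> (nat \<Rightarrow> 'a set) \<Rightarrow> ('a \<Rightarrow> 'a) \<Rightarrow> ('a \<Rightarrow> 'a) \<Rightarrow> real" where
  "metric_rho M A S T = (\<Sum>\<^sub>\<infinity>i\<in>{1..}. (1/2) ^ i *
     (measure M (sym_diff (image_mod0 M S (A i)) (image_mod0 M T (A i))) +
      measure M (sym_diff (S -` A i \<inter> space M) (T -` A i \<inter> space M))))"

definition metric_dw ::
  "'a measure \<Rightarrow> (nat \<Rightarrow> 'a set) \<Rightarrow> ('a \<Rightarrow> 'a) \<Rightarrow> ('a \<Rightarrow> 'a) \<Rightarrow> real" where
  "metric_dw M A S T = (\<Sum>\<^sub>\<infinity>(i, j)\<in>{1..} \<times> {1..}. (1/2) ^ (i + j) *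
     \<bar>measure M (image_mod0 M S (A i) \<inter> A j) - measure M (image_mod0 M T (A i) \<inter> A j)\<bar>)"

definition metric_r ::
  "'a measure \<Rightarrow> (nat \<Rightarrow> 'a set) \<Rightarrow> ('a \<Rightarrow> 'a) \<Rightarrow> ('a \<Rightarrow> 'a) \<Rightarrow> real" where
  "metric_r M A S T =
     metric_rho M A S T + (SUP n\<in>{0<..}. metric_dw M A (S ^^ n) (T ^^ n))"

definition half_interval :: "real set \<Rightarrow> bool" where
  "half_interval I \<longleftrightarrow> (\<exists>a b. a < b \<and> I = {a..<b})"

(* h j: height of the tower of stage j; E j: its base; D j i: the i-th piece of E j.
   All stages are indexed from 1. The spacers are the levels (S ^^ k) ` D j i with
   h j \<le> k < h j + s j i; that they are half-intervals, mutually disjoint and disjoint from the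
   tower of stage j is part of level_disjoint and level_translation at stage j + 1. *)
locale rank_one_construction =
  fixes h r :: "nat \<Rightarrow> nat" and s :: "nat \<Rightarrow> nat \<Rightarrow> nat"
    and E :: "nat \<Rightarrow> real set" and D :: "nat \<Rightarrow> nat \<Rightarrow> real set" and S :: "real \<Rightarrow> real"
  assumes h_first: "h 1 > 0"
    and h_step: "j \<ge> 1 \<Longrightarrow> h (j + 1) = h j * r j + (\<Sum>i=1..r j. s j i)"
    and r_pos: "j \<ge> 1 \<Longrightarrow> r j > 0"
    and r_at_top: "filterlim r at_top sequentially"
    and base: "j \<ge> 1 \<Longrightarrow> half_interval (E j)"
    and level_disjoint: "j \<ge> 1 \<Longrightarrow> disjoint_family_on (\<lambda>k. (S ^^ k) ` E j) {..<h j}"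
    and level_translation:
      "j \<ge> 1 \<Longrightarrow> k + 1 < h j \<Longrightarrow> \<exists>c. \<forall>x\<in>(S ^^ k) ` E j. S x = x + c"
    and piece: "j \<ge> 1 \<Longrightarrow> i \<in> {1..r j} \<Longrightarrow> half_interval (D j i)"
    and piece_length:
      "j \<ge> 1 \<Longrightarrow> i \<in> {1..r j} \<Longrightarrow> i' \<in> {1..r j} \<Longrightarrow>
         measure lebesgue (D j i) = measure lebesgue (D j i')"
    and piece_disjoint: "j \<ge> 1 \<Longrightarrow> disjoint_family_on (D j) {1..r j}"
    and piece_union: "j \<ge> 1 \<Longrightarrow> (\<Union>i\<in>{1..r j}. D j i) = E j"
    and next_base: "j \<ge> 1 \<Longrightarrow> E (j + 1) = D j 1"
    and next_column:
      "j \<ge> 1 \<Longrightarrow> 1 \<le> i \<Longrightarrow> i < r j \<Longrightarrow> (S ^^ (h j + s j i)) ` D j i = D j (i + 1)"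

definition tower :: "(nat \<Rightarrow> nat) \<Rightarrow> (nat \<Rightarrow> real set) \<Rightarrow> (real \<Rightarrow> real) \<Rightarrow> nat \<Rightarrow> real set" where
  "tower h E S j = (\<Union>k<h j. (S ^^ k) ` E j)"

definition column ::
  "(nat \<Rightarrow> nat) \<Rightarrow> (nat \<Rightarrow> nat \<Rightarrow> real set) \<Rightarrow> (real \<Rightarrow> real) \<Rightarrow> nat \<Rightarrow> nat \<Rightarrow> real set" where
  "column h D S j i = (\<Union>k<h j. (S ^^ k) ` D j i)"

definition construction_space ::
  "(nat \<Rightarrow> nat) \<Rightarrow> (nat \<Rightarrow> real set) \<Rightarrow> (real \<Rightarrow> real) \<Rightarrow> real measure" where
  "construction_space h E S = restrict_space lebesgue (\<Union>j\<in>{1..}. tower h E S j)"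

(* The construction determines S on the union of the towers only up to a countable set of points
   (those lying in the top level of every late stage), where its values are arbitrary; hence the
   containment in a column is modulo null sets. *)
definition sidon_construction ::
  "(nat \<Rightarrow> nat) \<Rightarrow> (nat \<Rightarrow> nat) \<Rightarrow> (nat \<Rightarrow> nat \<Rightarrow> nat) \<Rightarrow> (nat \<Rightarrow> real set) \<Rightarrow>
     (nat \<Rightarrow> nat \<Rightarrow> real set) \<Rightarrow> (real \<Rightarrow> real) \<Rightarrow> bool" where
  "sidon_construction h r s E D S \<longleftrightarrow>
     rank_one_construction h r s E D S \<and>
     (\<forall>j\<ge>1. \<forall>m. h j < m \<and> m \<le> h (j + 1) \<longrightarrow>
        (\<exists>i\<in>{1..r j}. AE x in lebesgue.
           x \<in> tower h E S j \<inter> (S ^^ m) ` tower h E S j \<longrightarrow> x \<in> column h D S j i))"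

end

theory Submission
  imports Defs
begin

text \<open>
  The idea is to transplant finite pieces of orbits of \<open>T\<close> into the space of \<open>S\<close>.
  Let \<open>B\<close> be a finite union of the sets \<open>A i\<close> and \<open>W\<close> the union of sufficiently many translates of
  \<open>B\<close> under \<open>T\<close>. Since \<open>T\<close> is mixing, the backward orbits of most points of \<open>W\<close> leave \<open>W\<close>
  within \<open>n\<close> steps, so \<open>W\<close> is essentially a disjoint union of excursions of length at most \<open>n\<close>, starting in the
  set \<open>F\<close> of points entering \<open>W\<close>. If \<open>G\<close> has the measure of \<open>F\<close> and \<open>G, S G, \<dots>, S\<^sup>n G\<close> are disjoint,
  any isomorphism \<open>\<phi>\<close> from \<open>F\<close> to \<open>G\<close> extends to \<open>R = S\<^sup>k \<circ> \<phi> \<circ> T\<^sup>-\<^sup>k\<close> on the \<open>k\<close>-th steps of the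
  excursions, where \<open>R\<close> intertwines \<open>T\<close> and \<open>S\<close>. This makes \<open>R\<^sup>-\<^sup>1 S\<^sup>m R\<close> close to \<open>T\<^sup>m\<close> for all
  small \<open>m\<close>.

  For large \<open>m\<close> it suffices that \<open>\<mu>(B \<inter> R\<^sup>-\<^sup>1 S\<^sup>m R B)\<close> be small, and this holds as soon as
  \<open>\<mu>(G \<inter> S\<^sup>m G)\<close> is uniformly small for all \<open>m \<ge> 1\<close>. Such a \<open>G\<close> of prescribed measure is obtained from many
  sparse translates of one base \<open>E j\<close>: by the Sidon property \<open>\<mu>(E j \<inter> S\<^sup>m E j) \<le> \<mu>(E j) / r l\<close> for some
  \<open>l \<ge> j\<close>, and mixing of \<open>S\<close> makes distinct translates nearly independent.
\<close>


subsection \<open>Isomorphisms modulo null sets between measurable sets\<close>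

text \<open>The obstacle is the supremum over all powers: \<open>R\<close> copies only finitely many
  steps of the dynamics, yet infinitely many \<open>m\<close> must be controlled. If a point on step
  \<open>k\<close> is moved by the \<open>m\<close>-th power of the conjugate to a point on step
  \<open>l\<close>, then \<open>l = m + k\<close> forces the image to be the true image under
  \<open>T\<close>, while every other pair \<open>(k, l)\<close> is a return of \<open>G\<close> at
  a nonzero time. There are at most \<open>n\<^sup>2\<close> such pairs whatever \<open>m\<close>
  is, and the bound on the returns of \<open>G\<close> is chosen after \<open>n\<close>. The returns
  of a base must be small relative to its measure e, not merely small: filling measure c takes of
  order c / e translates, each costs a multiple of \<open>\<eta> * e\<close>, and the total is of
  order \<open>\<eta> * c\<close> whatever e is. Off the excursions \<open>R\<close> is arbitrary:
  the complements on both sides have infinite measure, so any isomorphism between them serves. Each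
  excursion is continued one step beyond \<open>W\<close>, so that \<open>R\<close> also intertwines
  at the last point inside \<open>W\<close>.\<close>

definition iso_on ::
  "'a measure \<Rightarrow> 'a set \<Rightarrow> 'b measure \<Rightarrow> 'b set \<Rightarrow> ('a \<Rightarrow> 'b) \<Rightarrow> ('b \<Rightarrow> 'a) \<Rightarrow> bool" where
  "iso_on M X N Y f g \<longleftrightarrow>
     X \<in> sets M \<and> Y \<in> sets N \<and> f \<in> measurable M N \<and> g \<in> measurable N M \<and>
     (\<forall>B\<in>sets N. emeasure M (X \<inter> f -` B) = emeasure N (Y \<inter> B)) \<and>
     (AE x in M. x \<in> X \<longrightarrow> f x \<in> Y \<and> g (f x) = x) \<and>
     (AE y in N. y \<in> Y \<longrightarrow> g y \<in> X \<and> f (g y) = y)"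

lemma Int_vimage_sets:
  assumes "f \<in> measurable M N" "X \<in> sets M" "B \<in> sets N"
  shows "X \<inter> f -` B \<in> sets M"
proof -
  have "X \<inter> f -` B = X \<inter> (f -` B \<inter> space M)"
    using sets.sets_into_space[OF assms(2)] by auto
  then show ?thesis
    using assms by (metis measurable_sets sets.Int)
qed

lemma iso_onD:
  assumes "iso_on M X N Y f g"
  shows "X \<in> sets M" "Y \<in> sets N" "f \<in> measurable M N" "g \<in> measurable N M"
    "\<And>B. B \<in> sets N \<Longrightarrow> emeasure M (X \<inter> f -` B) = emeasure N (Y \<inter> B)"
    "AE x in M. x \<in> X \<longrightarrow> f x \<in> Y \<and> g (f x) = x"
    "AE y in N. y \<in> Y \<longrightarrow> g y \<in> X \<and> f (g y) = y"
  using assms unfolding iso_on_def by auto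

lemma AE_iso_on:
  assumes "iso_on M X N Y f g" "AE y in N. y \<in> Y \<longrightarrow> P y"
  shows "AE x in M. x \<in> X \<longrightarrow> P (f x)"
proof -
  note i = iso_onD[OF assms(1)]
  obtain Z where Z: "Z \<in> null_sets N" "{y \<in> space N. \<not> (y \<in> Y \<longrightarrow> P y)} \<subseteq> Z"
    using assms(2) unfolding eventually_ae_filter by blast
  have "emeasure M (X \<inter> f -` Z) = emeasure N (Y \<inter> Z)"
    using Z by (intro i(5)) auto
  also have "\<dots> = 0"
    using null_setsD1[OF null_set_Int1[OF Z(1) i(2)]] .
  finally have "X \<inter> f -` Z \<in> null_sets M"
    using Int_vimage_sets[OF i(3,1)] Z(1) by (auto simp: null_sets_def)
  then have "AE x in M. x \<notin> X \<inter> f -` Z"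
    by (rule AE_not_in)
  with i(6) show ?thesis
    using AE_space
  proof eventually_elim
    case (elim x)
    then show ?case
      using Z(2) measurable_space[OF i(3)] by blast
  qed
qed

text \<open>That \<open>f\<close> sends \<open>X\<close> into \<open>Y\<close> follows from the
  measure identity: applied to the complement of \<open>Y\<close>, it makes the set of points of
  \<open>X\<close> sent outside \<open>Y\<close> null.\<close>

lemma iso_onI:
  assumes X: "X \<in> sets M" and Y: "Y \<in> sets N"
    and f: "f \<in> measurable M N" and g: "g \<in> measurable N M"
    and eq: "\<And>B. B \<in> sets N \<Longrightarrow> emeasure M (X \<inter> f -` B) = emeasure N (Y \<inter> B)"
    and gf: "AE x in M. x \<in> X \<longrightarrow> g (f x) = x"
    and fg: "AE y in N. y \<in> Y \<longrightarrow> g y \<in> X \<and> f (g y) = y"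
  shows "iso_on M X N Y f g"
proof -
  have "X \<inter> f -` (space N - Y) \<in> null_sets M"
  proof (rule null_setsI)
    show "emeasure M (X \<inter> f -` (space N - Y)) = 0"
      using eq[of "space N - Y"] Y by simp
  qed (intro Int_vimage_sets[OF f X] sets.compl_sets Y)
  from AE_not_in[OF this] gf have "AE x in M. x \<in> X \<longrightarrow> f x \<in> Y \<and> g (f x) = x"
    using AE_space
  proof eventually_elim
    case (elim x)
    then show ?case
      using measurable_space[OF f] by auto
  qed
  then show ?thesis
    using assms unfolding iso_on_def by simp
qed

text \<open>Measure preservation passes to \<open>g\<close> because pulling the
  \<open>Y\<close>-part of a \<open>g\<close>-preimage of \<open>A\<close> back along
  \<open>f\<close> gives \<open>X \<inter> A\<close> up to a null set.\<close>

lemma iso_on_sym: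
  assumes "iso_on M X N Y f g"
  shows "iso_on N Y M X g f"
proof -
  note i = iso_onD[OF assms]
  have "emeasure N (Y \<inter> g -` A) = emeasure M (X \<inter> A)" if A: "A \<in> sets M" for A
  proof -
    have m: "Y \<inter> g -` A \<in> sets N"
      using Int_vimage_sets[OF i(4,2) A] .
    have "emeasure N (Y \<inter> g -` A) = emeasure N (Y \<inter> (Y \<inter> g -` A))"
      by simp
    also have "\<dots> = emeasure M (X \<inter> f -` (Y \<inter> g -` A))"
      using i(5)[OF m] by simp
    also have "\<dots> = emeasure M (X \<inter> A)"
    proof (rule emeasure_eq_AE)
      show "AE x in M. (x \<in> X \<inter> f -` (Y \<inter> g -` A)) = (x \<in> X \<inter> A)"
        using i(6) by eventually_elim auto
    qed (use Int_vimage_sets[OF i(3,1) m] i(1) A in auto)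
    finally show ?thesis .
  qed
  then show ?thesis
    using i unfolding iso_on_def by simp
qed

lemma iso_on_trans:
  assumes "iso_on M X N Y f g" "iso_on N Y L Z f' g'"
  shows "iso_on M X L Z (\<lambda>x. f' (f x)) (\<lambda>z. g (g' z))"
proof (rule iso_onI)
  note i = iso_onD[OF assms(1)] and j = iso_onD[OF assms(2)]
  show "X \<in> sets M" "Z \<in> sets L" by fact+
  show "(\<lambda>x. f' (f x)) \<in> measurable M L" "(\<lambda>z. g (g' z)) \<in> measurable L M"
    using measurable_compose[OF i(3) j(3)] measurable_compose[OF j(4) i(4)] by auto
  show "AE x in M. x \<in> X \<longrightarrow> g (g' (f' (f x))) = x"
    using AE_iso_on[OF assms(1) j(6)] i(6) by eventually_elim auto
  show "AE y in L. y \<in> Z \<longrightarrow> g (g' y) \<in> X \<and> f' (f (g (g' y))) = y"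
    using AE_iso_on[OF iso_on_sym[OF assms(2)] i(7)] j(7) by eventually_elim auto
  fix B assume B: "B \<in> sets L"
  have m: "Y \<inter> f' -` B \<in> sets N"
    using Int_vimage_sets[OF j(3,1) B] .
  have "emeasure M (X \<inter> (\<lambda>x. f' (f x)) -` B) = emeasure M (X \<inter> f -` (Y \<inter> f' -` B))"
  proof (rule emeasure_eq_AE)
    show "AE x in M. (x \<in> X \<inter> (\<lambda>x. f' (f x)) -` B) = (x \<in> X \<inter> f -` (Y \<inter> f' -` B))"
      using i(6) by eventually_elim auto
    show "X \<inter> (\<lambda>x. f' (f x)) -` B \<in> sets M"
      using Int_vimage_sets[OF measurable_compose[OF i(3) j(3)] i(1) B] .
    show "X \<inter> f -` (Y \<inter> f' -` B) \<in> sets M"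
      using Int_vimage_sets[OF i(3,1) m] .
  qed
  also have "\<dots> = emeasure N (Y \<inter> f' -` B)"
    using i(5)[OF m] by simp
  also have "\<dots> = emeasure L (Z \<inter> B)"
    using j(5)[OF B] .
  finally show "emeasure M (X \<inter> (\<lambda>x. f' (f x)) -` B) = emeasure L (Z \<inter> B)" .
qed

lemma iso_on_restrict:
  assumes "iso_on M X N Y f g" "X' \<in> sets M" "X' \<subseteq> X"
  shows "iso_on M X' N (Y \<inter> g -` X') f g"
proof (rule iso_onI)
  note i = iso_onD[OF assms(1)]
  show "X' \<in> sets M" "f \<in> measurable M N" "g \<in> measurable N M" by fact+
  show Y': "Y \<inter> g -` X' \<in> sets N"
    using Int_vimage_sets[OF i(4,2) assms(2)] .
  show "AE x in M. x \<in> X' \<longrightarrow> g (f x) = x"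
    using i(6) assms(3) by auto
  show "AE y in N. y \<in> Y \<inter> g -` X' \<longrightarrow> g y \<in> X' \<and> f (g y) = y"
    using i(7) by auto
  fix B assume B: "B \<in> sets N"
  have m: "Y \<inter> g -` X' \<inter> B \<in> sets N"
    using Y' B by auto
  have "emeasure M (X' \<inter> f -` B) = emeasure M (X \<inter> f -` (Y \<inter> g -` X' \<inter> B))"
  proof (rule emeasure_eq_AE)
    show "AE x in M. (x \<in> X' \<inter> f -` B) = (x \<in> X \<inter> f -` (Y \<inter> g -` X' \<inter> B))"
      using i(6) by eventually_elim (use assms(3) in auto)
    show "X' \<inter> f -` B \<in> sets M" "X \<inter> f -` (Y \<inter> g -` X' \<inter> B) \<in> sets M"
      using Int_vimage_sets[OF i(3) assms(2) B] Int_vimage_sets[OF i(3,1) m] .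
  qed
  also have "\<dots> = emeasure N (Y \<inter> g -` X' \<inter> B)"
    using i(5)[OF m] by (metis inf_assoc inf_left_idem)
  finally show "emeasure M (X' \<inter> f -` B) = emeasure N (Y \<inter> g -` X' \<inter> B)" .
qed

lemma measurable_index:
  fixes X :: "nat \<Rightarrow> 'a set"
  assumes "\<And>i. X i \<in> sets M"
  shows "(\<lambda>x. LEAST i. x \<in> X i) \<in> measurable M (count_space UNIV)"
proof (rule measurable_Least)
  show "Measurable.pred M (\<lambda>x. x \<in> X i)" for i
    using pred_sets2[OF assms measurable_ident] by simp
qed

lemma Least_disjoint_family:
  fixes X :: "nat \<Rightarrow> 'a set"
  assumes "disjoint_family X" "x \<in> X i"
  shows "(LEAST i. x \<in> X i) = i"
proof (rule Least_equality)
  show "x \<in> X i" by fact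
  show "i \<le> j" if "x \<in> X j" for j
    using assms that by (cases "i = j") (auto simp: disjoint_family_on_def)
qed

text \<open>The maps in \<open>iso_on\<close> are total and measurable, constrained only on
  \<open>X\<close> and \<open>Y\<close>, so the pieces are combined by taking the map with the least
  index of a piece containing the point. Off the union this index is some fixed number, which keeps
  the result measurable.\<close>

lemma iso_on_glue:
  fixes X :: "nat \<Rightarrow> 'a set" and Y :: "nat \<Rightarrow> 'b set"
  assumes iso: "\<And>i. iso_on M (X i) N (Y i) (f i) (g i)"
    and dX: "disjoint_family X" and dY: "disjoint_family Y"
  shows "\<exists>F G. iso_on M (\<Union>i. X i) N (\<Union>i. Y i) F G \<and> (\<forall>i. \<forall>x\<in>X i. F x = f i x)"
proof -
  note i = iso_onD[OF iso]
  define F where "F = (\<lambda>x. f (LEAST i. x \<in> X i) x)"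
  define G where "G = (\<lambda>y. g (LEAST i. y \<in> Y i) y)"
  have F: "F x = f i x" if "x \<in> X i" for i x
    using Least_disjoint_family[OF dX that] by (simp add: F_def)
  have G: "G x = g i x" if "x \<in> Y i" for i x
    using Least_disjoint_family[OF dY that] by (simp add: G_def)
  have "iso_on M (\<Union>i. X i) N (\<Union>i. Y i) F G"
  proof (rule iso_onI)
    show "(\<Union>i. X i) \<in> sets M" "(\<Union>i. Y i) \<in> sets N"
      using i by auto
    show Fm: "F \<in> measurable M N"
      unfolding F_def by (rule measurable_compose_countable[OF i(3) measurable_index[OF i(1)]])
    show "G \<in> measurable N M"
      unfolding G_def by (rule measurable_compose_countable[OF i(4) measurable_index[OF i(2)]])
    have "AE x in M. \<forall>i. x \<in> X i \<longrightarrow> f i x \<in> Y i \<and> g i (f i x) = x"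
      using i(6) by (simp add: AE_all_countable)
    then show "AE x in M. x \<in> (\<Union>i. X i) \<longrightarrow> G (F x) = x"
      by eventually_elim (metis UN_iff F G)
    have "AE y in N. \<forall>i. y \<in> Y i \<longrightarrow> g i y \<in> X i \<and> f i (g i y) = y"
      using i(7) by (simp add: AE_all_countable)
    then show "AE y in N. y \<in> (\<Union>i. Y i) \<longrightarrow> G y \<in> (\<Union>i. X i) \<and> F (G y) = y"
      by eventually_elim (metis UN_iff UNIV_I F G)
    fix B assume B: "B \<in> sets N"
    have "emeasure M ((\<Union>i. X i) \<inter> F -` B) = emeasure M (\<Union>i. X i \<inter> f i -` B)"
      by (rule arg_cong[where f = "emeasure M"]) (auto simp: F)
    also have "\<dots> = (\<Sum>i. emeasure M (X i \<inter> f i -` B))"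
    proof (rule suminf_emeasure[symmetric])
      show "disjoint_family (\<lambda>i. X i \<inter> f i -` B)"
        using dX unfolding disjoint_family_on_def by blast
    qed (use Int_vimage_sets[OF i(3,1) B] in auto)
    also have "\<dots> = (\<Sum>i. emeasure N (Y i \<inter> B))"
      using i(5)[OF B] by simp
    also have "\<dots> = emeasure N (\<Union>i. Y i \<inter> B)"
    proof (rule suminf_emeasure)
      show "disjoint_family (\<lambda>i. Y i \<inter> B)"
        using dY unfolding disjoint_family_on_def by blast
    qed (use i(2) B in auto)
    finally show "emeasure M ((\<Union>i. X i) \<inter> F -` B) = emeasure N ((\<Union>i. Y i) \<inter> B)"
      by simp
  qed
  with F show ?thesis by blast
qed

lemma iso_mod0_iff_iso_on: "iso_mod0 M N f g \<longleftrightarrow> iso_on M (space M) N (space N) f g"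
proof
  assume i: "iso_mod0 M N f g"
  then have f: "f \<in> measurable M N" and g: "g \<in> measurable N M" and d: "distr M N f = N"
    by (auto simp: iso_mod0_def)
  show "iso_on M (space M) N (space N) f g"
  proof (rule iso_onI)
    show "AE y in N. y \<in> space N \<longrightarrow> g y \<in> space M \<and> f (g y) = y"
      using i measurable_space[OF g] by (auto simp: iso_mod0_def)
    fix B assume B: "B \<in> sets N"
    then show "emeasure M (space M \<inter> f -` B) = emeasure N (space N \<inter> B)"
      using emeasure_distr[OF f B] d by (simp add: Int_commute sets.Int_space_eq1)
  qed (use f g i in \<open>auto simp: iso_mod0_def\<close>)
next
  assume "iso_on M (space M) N (space N) f g"
  note i = iso_onD[OF this]
  have "distr M N f = N"
  proof (rule measure_eqI)
    fix B assume "B \<in> sets (distr M N f)"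
    then show "emeasure (distr M N f) B = emeasure N B"
      using i(3,5) by (simp add: emeasure_distr Int_commute sets.Int_space_eq1)
  qed simp
  then show "iso_mod0 M N f g"
    using i AE_space[of M] AE_space[of N] by (auto simp: iso_mod0_def)
qed

lemma iso_mod0_sym: "iso_mod0 M N f g \<Longrightarrow> iso_mod0 N M g f"
  unfolding iso_mod0_iff_iso_on by (rule iso_on_sym)

lemma iso_mod0_trans:
  assumes "iso_mod0 M N f g" "iso_mod0 N L f' g'"
  shows "iso_mod0 M L (\<lambda>x. f' (f x)) (\<lambda>z. g (g' z))"
  using assms unfolding iso_mod0_iff_iso_on by (rule iso_on_trans)

lemma iso_on_emeasure:
  assumes "iso_on M X N Y f g"
  shows "emeasure M X = emeasure N Y"
proof -
  have "X \<inter> f -` space N = X"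
    using sets.sets_into_space[OF iso_onD(1)[OF assms]] measurable_space[OF iso_onD(3)[OF assms]]
    by auto
  then show ?thesis
    using iso_onD(5)[OF assms, of "space N"] iso_onD(2)[OF assms]
    by (simp add: sets.Int_space_eq2)
qed


subsection \<open>Isomorphisms of Lebesgue measurable subsets of the line\<close>

lemma fmeasurable_Int_interval:
  assumes "X \<in> sets lebesgue"
  shows "X \<inter> {a..b::real} \<in> fmeasurable lebesgue"
  using fmeasurable_Int_fmeasurable[OF lmeasurable_interval(1) assms, of a b]
  by (simp add: Int_commute cbox_interval)

lemma sets_lebesgue_Compl: "X \<in> sets lebesgue \<Longrightarrow> - X \<in> sets (lebesgue :: real measure)"
  using sets.compl_sets[of X lebesgue] by (simp add: Compl_eq_Diff_UNIV)

text \<open>A Borel map need not be measurable between the completions, since preimages of subsets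
  of null sets are uncontrolled. The identity on Borel sets makes the preimage of a Borel null set
  null inside \<open>X\<close>, and completeness absorbs the subsets.\<close>

lemma emeasure_Int_vimage_lebesgue:
  fixes f :: "real \<Rightarrow> real"
  assumes X: "X \<in> sets lebesgue" and Y: "Y \<in> sets lebesgue" and f: "f \<in> borel_measurable borel"
    and eq: "\<And>B. B \<in> sets borel \<Longrightarrow> emeasure lebesgue (X \<inter> f -` B) = emeasure lebesgue (Y \<inter> B)"
    and B: "B \<in> sets lebesgue"
  shows "X \<inter> f -` B \<in> sets lebesgue" and "emeasure lebesgue (X \<inter> f -` B) = emeasure lebesgue (Y \<inter> B)"
proof -
  obtain C N N' where C: "B = C \<union> N" "N \<subseteq> N'" "N' \<in> null_sets lborel" "C \<in> sets lborel"
    using sets_completionE[OF B] by metis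
  have Xf: "X \<inter> f -` A \<in> sets lebesgue" if "A \<in> sets borel" for A
  proof -
    have "f -` A \<in> sets borel"
      using measurable_sets[OF f that] by simp
    then have "f -` A \<in> sets lebesgue"
      by (intro sets_completionI_sets) simp
    then show ?thesis
      using X by (rule sets.Int[rotated])
  qed
  have N': "N' \<in> sets borel" "N' \<in> null_sets lebesgue"
    using C(3) null_sets_completionI by auto
  have "emeasure lebesgue (X \<inter> f -` N') = 0"
    using eq[OF N'(1)] null_setsD1[OF null_set_Int1[OF N'(2) Y]] by simp
  then have "X \<inter> f -` N' \<in> null_sets lebesgue"
    using Xf[OF N'(1)] by auto
  then have n1: "X \<inter> f -` N \<in> null_sets lebesgue"
    by (rule null_sets_completion_subset[rotated]) (use C(2) in auto)
  have n2: "Y \<inter> N \<in> null_sets lebesgue"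
    by (rule null_sets_completion_subset[OF _ N'(2)]) (use C(2) in auto)
  have s: "X \<inter> f -` B = (X \<inter> f -` C) \<union> (X \<inter> f -` N)" "Y \<inter> B = (Y \<inter> C) \<union> (Y \<inter> N)"
    using C(1) by auto
  show "X \<inter> f -` B \<in> sets lebesgue"
    unfolding s using Xf[of C] C(4) n1 by auto
  show "emeasure lebesgue (X \<inter> f -` B) = emeasure lebesgue (Y \<inter> B)"
  proof -
    have "C \<in> sets borel" "C \<in> sets lebesgue"
      using C(4) sets_completionI_sets by auto
    then show ?thesis
      unfolding s using emeasure_Un_null_set[OF Xf n1] emeasure_Un_null_set[OF sets.Int[OF Y] n2] eq
      by metis
  qed
qed

lemma measurable_lebesgue_if:
  fixes f :: "real \<Rightarrow> real"
  assumes X: "X \<in> sets lebesgue" and Y: "Y \<in> sets lebesgue" and f: "f \<in> borel_measurable borel"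
    and eq: "\<And>B. B \<in> sets borel \<Longrightarrow> emeasure lebesgue (X \<inter> f -` B) = emeasure lebesgue (Y \<inter> B)"
  shows "(\<lambda>x. if x \<in> X then f x else 0) \<in> measurable lebesgue lebesgue"
proof (rule measurableI)
  fix B :: "real set" assume B: "B \<in> sets lebesgue"
  have "(\<lambda>x. if x \<in> X then f x else 0) -` B \<inter> space lebesgue =
    (X \<inter> f -` B) \<union> (if 0 \<in> B then - X else {})"
    by (auto split: if_splits)
  also have "\<dots> \<in> sets lebesgue"
    using emeasure_Int_vimage_lebesgue(1)[OF X Y f eq B] sets_lebesgue_Compl[OF X] by auto
  finally show "(\<lambda>x. if x \<in> X then f x else 0) -` B \<inter> space lebesgue \<in> sets lebesgue" .
qed simp

text \<open>\<open>u\<close> is the distribution function of Lebesgue measure on \<open>X\<close>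
  and \<open>g\<close> its quantile function: \<open>g\<close> carries the interval to
  \<open>X\<close>, and \<open>u\<close> inverts it almost everywhere. Continuity of
  \<open>u\<close>, that is, the absence of atoms, gives \<open>u (g t) = t\<close>.\<close>

lemma iso_on_lebesgue_interval:
  fixes X :: "real set"
  assumes X: "X \<in> sets lebesgue" and c: "emeasure lebesgue X = ennreal c" and c0: "c \<ge> 0"
  shows "\<exists>f g. iso_on lebesgue {0<..<c} lebesgue X f g"
proof -
  define u where "u = (\<lambda>x. measure lebesgue (X \<inter> {..x}))"
  define g where "g = (\<lambda>t. if 0 < t \<and> t < c then Inf {x. t \<le> u x} else 0)"
  have Xf: "X \<in> fmeasurable lebesgue"
    using X c by (intro fmeasurableI) auto
  have fm: "X \<inter> B \<in> fmeasurable lebesgue" if "B \<in> sets borel" for B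
    using Xf that by (intro fmeasurable_Int_fmeasurable) (auto intro: sets_completionI_sets)
  have mX: "measure lebesgue X = c"
    using c c0 by (simp add: measure_def)
  have uc: "u x \<le> c" "0 \<le> u x" for x
    unfolding u_def mX[symmetric] using fmeasurableD[OF fm, of "{..x}"] Xf
    by (auto intro!: measure_mono_fmeasurable)
  have split: "measure lebesgue (A \<union> B) = measure lebesgue A + measure lebesgue B"
    if "A \<in> fmeasurable lebesgue" "B \<in> fmeasurable lebesgue" "A \<inter> B = {}" for A B :: "real set"
    using measure_Un3[OF that(1,2)] that(3) by simp
  have diff: "u y - u x = measure lebesgue (X \<inter> {x<..y})" if "x \<le> y" for x y
  proof -
    have "X \<inter> {..y} = (X \<inter> {..x}) \<union> (X \<inter> {x<..y})"
      using that by auto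
    then have "u y = u x + measure lebesgue (X \<inter> {x<..y})"
      unfolding u_def using split[OF fm fm, of "{..x}" "{x<..y}"]
      by (simp add: disjoint_iff)
    then show ?thesis by simp
  qed
  have mono: "u x \<le> u y" if "x \<le> y" for x y
    using diff[OF that] measure_nonneg[of lebesgue "X \<inter> {x<..y}"] by linarith
  have lip: "u y - u x \<le> y - x" if "x \<le> y" for x y
  proof -
    have "measure lebesgue (X \<inter> {x<..y}) \<le> measure lebesgue {x..y}"
    proof (rule measure_mono_fmeasurable)
      show "X \<inter> {x<..y} \<in> sets lebesgue"
        by (rule fmeasurableD[OF fm]) simp
      show "{x..y} \<in> fmeasurable lebesgue"
        using lmeasurable_interval(1)[of x y] by (simp add: cbox_interval)
    qed auto
    also have "\<dots> = y - x"
      using that by simp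
    finally show ?thesis
      using diff[OF that] by linarith
  qed
  have "1-lipschitz_on UNIV u"
  proof (rule lipschitz_onI)
    fix x y :: real
    show "dist (u x) (u y) \<le> 1 * dist x y"
      using mono[of x y] mono[of y x] lip[of x y] lip[of y x]
      by (cases "x \<le> y") (auto simp: dist_real_def)
  qed simp
  then have cont: "continuous_on UNIV u"
    by (rule lipschitz_on_continuous_on)
  have ub: "u \<in> borel_measurable borel"
    using cont by (rule borel_measurable_continuous_onI)
  have UN_X: "(\<Union>n. X \<inter> {..real n}) = X"
    using real_arch_simple by auto
  have top: "(\<lambda>n. u (real n)) \<longlonglongrightarrow> c"
  proof -
    have "(\<lambda>n. measure lebesgue (X \<inter> {..real n})) \<longlonglongrightarrow> measure lebesgue (\<Union>n. X \<inter> {..real n})"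
    proof (rule Lim_measure_incseq)
      show "range (\<lambda>n. X \<inter> {..real n}) \<subseteq> sets lebesgue"
        using fmeasurableD[OF fm] by auto
      show "incseq (\<lambda>n. X \<inter> {..real n})"
        by (auto simp: incseq_def)
      show "emeasure lebesgue (\<Union>n. X \<inter> {..real n}) \<noteq> \<infinity>"
        unfolding UN_X using c by simp
    qed
    moreover note UN_X
    ultimately show ?thesis
      by (simp add: u_def mX)
  qed
  have bot: "(\<lambda>n. u (- real n)) \<longlonglongrightarrow> 0"
  proof -
    have "(\<lambda>n. measure lebesgue (X \<inter> {..- real n})) \<longlonglongrightarrow> measure lebesgue (\<Inter>n. X \<inter> {..- real n})"
    proof (rule Lim_measure_decseq)
      show "range (\<lambda>n. X \<inter> {..- real n}) \<subseteq> sets lebesgue"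
        using fmeasurableD[OF fm] by auto
      show "decseq (\<lambda>n. X \<inter> {..- real n})"
        by (auto simp: decseq_def)
      show "emeasure lebesgue (X \<inter> {..- real n}) \<noteq> \<infinity>" for n
        using fmeasurableD2[OF fm, of "{..- real n}"] by auto
    qed
    moreover have "(\<Inter>n. X \<inter> {..- real n}) = {}"
    proof (rule equals0I)
      fix x assume x: "x \<in> (\<Inter>n. X \<inter> {..- real n})"
      obtain n where n: "- x < real n"
        using reals_Archimedean2[of "- x"] ..
      have "x \<in> X \<inter> {..- real n}"
        using x by (rule INT_E) simp_all
      then show False
        using n by simp
    qed
    ultimately show ?thesis
      by (simp add: u_def)
  qed
  \<comment> \<open>\<open>g t\<close> is the least point where \<open>u\<close> reaches
    \<open>t\<close>: the superlevel set is closed, nonempty and bounded below. The equivalence says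
    that \<open>g\<close> is the lower adjoint of the monotone function \<open>u\<close>; it
    describes all preimages of half-lines under \<open>g\<close>.\<close>
  have ug: "u (g t) = t" and g_le: "g t \<le> x \<longleftrightarrow> t \<le> u x" if t: "0 < t" "t < c" for t x
  proof -
    obtain b where b: "t < u (real b)"
      using order_tendstoD(1)[OF top t(2)] eventually_happens[of _ sequentially] by auto
    obtain a where a: "u (- real a) < t"
      using order_tendstoD(2)[OF bot t(1)] eventually_happens[of _ sequentially] by auto
    have "\<exists>x\<ge>- real a. x \<le> real b \<and> u x = t"
      using a b cont by (intro IVT') (auto intro: continuous_on_subset)
    then obtain x0 where x0: "u x0 = t" by auto
    have bdd: "bdd_below {x. t \<le> u x}"
    proof (rule bdd_belowI[of _ "- real a"])
      fix x assume "x \<in> {x. t \<le> u x}"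
      then show "- real a \<le> x"
        using a mono[of x "- real a"] by (cases "x \<le> - real a") simp_all
    qed
    have cl: "closed {x. t \<le> u x}"
      by (rule closed_Collect_le[OF continuous_on_const cont])
    have "Inf {x. t \<le> u x} \<in> {x. t \<le> u x}"
      using x0 by (intro closed_contains_Inf bdd cl) auto
    then have "g t \<in> {x. t \<le> u x}"
      using t by (simp add: g_def)
    then have 1: "t \<le> u (g t)" by simp
    have 2: "g t \<le> x" if "t \<le> u x" for x
      unfolding g_def using t bdd that by (auto intro: cInf_lower)
    show "u (g t) = t"
      using 1 mono[OF 2[of x0]] x0 by simp
    show "g t \<le> x \<longleftrightarrow> t \<le> u x"
      using 1 2 mono[of "g t" x] by auto
  qed
  have gb: "g \<in> borel_measurable borel"
  proof (rule borel_measurable_iff_le[THEN iffD2], rule allI)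
    fix x
    have "{t \<in> space borel. g t \<le> x} =
      ({0<..<c} \<inter> {..u x}) \<union> (if 0 \<le> x then - {0<..<c} else {})"
      using g_le by (auto simp: g_def)
    also have "\<dots> \<in> sets borel"
      by auto
    finally show "{t \<in> space borel. g t \<le> x} \<in> sets borel" .
  qed
  \<comment> \<open>Measures that are finite and equal on all right half-lines coincide, and the
    preimage of such a half-line under \<open>g\<close> is just the interval from \<open>u x\<close>
    to \<open>c\<close>.\<close>
  define P where "P = distr (restrict_space lebesgue {0<..<c}) borel g"
  define Q where "Q = distr (restrict_space lebesgue X) borel (\<lambda>x. x)"
  have rs: "f \<in> measurable (restrict_space lebesgue Z) borel"
    if "f \<in> borel_measurable borel" for f :: "real \<Rightarrow> real" and Z
    using that by (intro measurable_restrict_space1 measurable_completion) simp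
  have eP: "emeasure P B = emeasure lebesgue ({0<..<c} \<inter> g -` B)" if B: "B \<in> sets borel" for B
    unfolding P_def using rs[OF gb] B
    by (subst emeasure_distr) (auto simp: space_restrict_space emeasure_restrict_space Int_commute)
  have eQ: "emeasure Q B = emeasure lebesgue (X \<inter> B)" if B: "B \<in> sets borel" for B
    unfolding Q_def using rs[of "\<lambda>x. x"] B X
    by (subst emeasure_distr) (auto simp: space_restrict_space emeasure_restrict_space Int_commute)
  have half: "emeasure lebesgue ({0<..<c} \<inter> g -` {x<..}) = emeasure lebesgue (X \<inter> {x<..})" for x
  proof -
    have "{0<..<c} \<inter> g -` {x<..} = {u x<..<c}"
      using g_le uc(2)[of x] by (auto simp: not_le[symmetric])
    moreover have "X = (X \<inter> {..x}) \<union> (X \<inter> {x<..})" by auto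
    then have "c = u x + measure lebesgue (X \<inter> {x<..})"
      unfolding u_def mX[symmetric] using split[OF fm fm, of "{..x}" "{x<..}"]
      by (simp add: disjoint_iff)
    ultimately show ?thesis
      using uc(1)[of x] emeasure_eq_measure2[OF fm[of "{x<..}"]] by simp
  qed
  have "P = Q"
  proof (rule measure_eqI_lessThan)
    fix x
    show "emeasure P {x<..} < \<infinity>"
      using eP[of "{x<..}"] half[of x] fmeasurableD2[OF fm, of "{x<..}"]
      by (simp add: top.not_eq_extremum)
    show "emeasure P {x<..} = emeasure Q {x<..}"
      using eP[of "{x<..}"] eQ[of "{x<..}"] half[of x] by simp
  qed (auto simp: P_def Q_def)
  then have eqg: "emeasure lebesgue ({0<..<c} \<inter> g -` B) = emeasure lebesgue (X \<inter> B)"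
    if "B \<in> sets borel" for B
    using eP[OF that] eQ[OF that] by simp
  have equ: "emeasure lebesgue (X \<inter> u -` B) = emeasure lebesgue ({0<..<c} \<inter> B)"
    if B: "B \<in> sets borel" for B
  proof -
    have "{0<..<c} \<inter> g -` u -` B = {0<..<c} \<inter> B"
      using ug by auto
    then show ?thesis
      using eqg[of "u -` B"] measurable_sets[OF ub B] by simp
  qed
  txt \<open>Outside \<open>X\<close>, preimages of null sets under \<open>u\<close> may fail to be measurable, hence the truncation.\<close>
  define f' where "f' = (\<lambda>t. if t \<in> {0<..<c} then g t else 0)"
  define g' where "g' = (\<lambda>x. if x \<in> X then u x else 0)"
  have I: "{0<..<c} \<in> sets lebesgue" by simp
  have "iso_on lebesgue X lebesgue {0<..<c} g' f'"
  proof (rule iso_onI[OF X I])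
    show "g' \<in> measurable lebesgue lebesgue"
      unfolding g'_def by (rule measurable_lebesgue_if[OF X I ub equ])
    show "f' \<in> measurable lebesgue lebesgue"
      unfolding f'_def by (rule measurable_lebesgue_if[OF I X gb eqg])
    fix B :: "real set" assume B: "B \<in> sets lebesgue"
    have "X \<inter> g' -` B = X \<inter> u -` B"
      by (auto simp: g'_def)
    then show "emeasure lebesgue (X \<inter> g' -` B) = emeasure lebesgue ({0<..<c} \<inter> B)"
      using emeasure_Int_vimage_lebesgue(2)[OF X I ub equ B] by simp
  next
    \<comment> \<open>\<open>u\<close> is constant across gaps of \<open>X\<close>, so injectivity
      can only hold off a null set. The points with \<open>g (u x) = x\<close> contain the whole
      range of \<open>g\<close> on the interval, because \<open>u (g t) = t\<close>; hence they have
      full measure in \<open>X\<close>.\<close>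
    define B where "B = {x. 0 < u x \<and> u x < c \<and> g (u x) = x}"
    have "{x \<in> space borel. g (u x) = x} \<in> sets borel" "{x \<in> space borel. 0 < u x} \<in> sets borel"
        "{x \<in> space borel. u x < c} \<in> sets borel"
      using ub gb by measurable
    then have "{x \<in> space borel. g (u x) = x} \<inter> {x \<in> space borel. 0 < u x} \<inter> {x \<in> space borel. u x < c} \<in> sets borel"
      by blast
    also have "{x \<in> space borel. g (u x) = x} \<inter> {x \<in> space borel. 0 < u x} \<inter> {x \<in> space borel. u x < c} = B"
      by (auto simp: B_def)
    finally have B: "B \<in> sets borel" .
    have "{0<..<c} \<inter> g -` B = {0<..<c}"
      using ug by (auto simp: B_def)
    then have "emeasure lebesgue (X \<inter> B) = ennreal c"
      using eqg[OF B] c0 by simp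
    then have "emeasure lebesgue (X - X \<inter> B) = 0"
      using c X fmeasurableD[OF fm[OF B]] fmeasurableD2[OF fm[OF B]]
      by (subst emeasure_Diff) auto
    then have "X - X \<inter> B \<in> null_sets lebesgue"
      using X fmeasurableD[OF fm[OF B]] by (intro null_setsI sets.Diff)
    from AE_not_in[OF this] show "AE x in lebesgue. x \<in> X \<longrightarrow> f' (g' x) = x"
      by eventually_elim (auto simp: B_def f'_def g'_def)
    have "emeasure lebesgue ({0<..<c} \<inter> f' -` (- X)) = 0"
    proof -
      have "{0<..<c} \<inter> f' -` (- X) = {0<..<c} \<inter> g -` (- X)"
        by (auto simp: f'_def)
      moreover have "- X \<in> sets lebesgue"
        using sets_lebesgue_Compl[OF X] .
      ultimately show ?thesis
        using emeasure_Int_vimage_lebesgue(2)[OF I X gb eqg, of "- X"] by simp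
    qed
    moreover have "{0<..<c} \<inter> f' -` (- X) \<in> sets lebesgue"
      unfolding f'_def
      by (intro Int_vimage_sets[OF measurable_lebesgue_if[OF I X gb eqg]] sets_lebesgue_Compl X I)
    ultimately have "{0<..<c} \<inter> f' -` (- X) \<in> null_sets lebesgue" by auto
    from AE_not_in[OF this] show "AE y in lebesgue. y \<in> {0<..<c} \<longrightarrow> f' y \<in> X \<and> g' (f' y) = y"
      by eventually_elim (auto simp: g'_def f'_def ug)
  qed
  from iso_on_sym[OF this] show ?thesis by blast
qed


text \<open>The measure of the part of \<open>X\<close> in a symmetric window is a 2-Lipschitz
  function of \<open>t\<close> that vanishes at 0 and eventually exceeds \<open>c\<close>, so the
  intermediate value theorem applies.\<close>

lemma lebesgue_symmetric_interval:
  fixes X :: "real set"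
  assumes X: "X \<in> sets lebesgue" and c: "0 \<le> c" "ennreal c < emeasure lebesgue X"
  shows "\<exists>t\<ge>0. emeasure lebesgue (X \<inter> {-t..t}) = ennreal c"
proof -
  define v where "v = (\<lambda>t. measure lebesgue (X \<inter> {-t..t}))"
  note fm = fmeasurable_Int_interval[OF X]
  have ev: "emeasure lebesgue (X \<inter> {-t..t}) = ennreal (v t)" for t
    unfolding v_def using emeasure_eq_measure2[OF fm] .
  have inc: "incseq (\<lambda>n. X \<inter> {- real n..real n})"
    by (auto simp: incseq_def)
  have "(\<Union>n. X \<inter> {- real n..real n}) = X"
  proof -
    have "x \<in> (\<Union>n. X \<inter> {- real n..real n})" if x: "x \<in> X" for x
    proof -
      obtain n where "\<bar>x\<bar> \<le> real n"
        using real_arch_simple[of "\<bar>x\<bar>"] ..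
      then have "x \<in> X \<inter> {- real n..real n}"
        using x by (auto simp: abs_le_iff)
      then show ?thesis by (rule UN_I[OF UNIV_I])
    qed
    then show ?thesis by blast
  qed
  then have "emeasure lebesgue X = (SUP n. emeasure lebesgue (X \<inter> {- real n..real n}))"
    using SUP_emeasure_incseq[OF image_subsetI[OF fmeasurableD[OF fm]] inc] by metis
  then obtain n where "ennreal c < emeasure lebesgue (X \<inter> {- real n..real n})"
    using c(2) by (auto simp: less_SUP_iff)
  then have n: "c < v (real n)"
    using c(1) by (simp add: ev ennreal_less_iff)
  have mono: "v x \<le> v y" if "x \<le> y" for x y
    unfolding v_def by (intro measure_mono_fmeasurable fmeasurableD[OF fm] fm) (use that in auto)
  have lip: "v y - v x \<le> 2 * (y - x)" if "0 \<le> x" "x \<le> y" for x y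
  proof -
    have "X \<inter> {-y..y} \<subseteq> (X \<inter> {-x..x}) \<union> (X \<inter> {-y..-x}) \<union> (X \<inter> {x..y})"
      using that by auto
    then have "v y \<le> measure lebesgue ((X \<inter> {-x..x}) \<union> (X \<inter> {-y..-x}) \<union> (X \<inter> {x..y}))"
      unfolding v_def by (intro measure_mono_fmeasurable fmeasurable.Un fmeasurableD[OF fm] fm)
    also have "\<dots> \<le> measure lebesgue ((X \<inter> {-x..x}) \<union> (X \<inter> {-y..-x})) + measure lebesgue (X \<inter> {x..y})"
      by (intro measure_Un_le fmeasurableD[OF fm] sets.Un)
    also have "\<dots> \<le> v x + measure lebesgue (X \<inter> {-y..-x}) + measure lebesgue (X \<inter> {x..y})"
      using measure_Un_le[OF fmeasurableD[OF fm] fmeasurableD[OF fm], of "-x" x "-y" "-x"]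
      unfolding v_def by simp
    also have "measure lebesgue (X \<inter> {-y..-x}) \<le> measure lebesgue {-y..-x}"
      using fmeasurable_Int_interval[of UNIV "-y" "-x"]
      by (intro measure_mono_fmeasurable fmeasurableD[OF fm]) auto
    also have "\<dots> = y - x"
      using that by simp
    also have "measure lebesgue (X \<inter> {x..y}) \<le> measure lebesgue {x..y}"
      using fmeasurable_Int_interval[of UNIV x y]
      by (intro measure_mono_fmeasurable fmeasurableD[OF fm]) auto
    also have "\<dots> = y - x"
      using that by simp
    finally show ?thesis by simp
  qed
  have "2-lipschitz_on {0..real n} v"
  proof (rule lipschitz_onI)
    fix x y :: real assume "x \<in> {0..real n}" "y \<in> {0..real n}"
    then show "dist (v x) (v y) \<le> 2 * dist x y"
      using mono[of x y] mono[of y x] lip[of x y] lip[of y x]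
      by (cases "x \<le> y") (auto simp: dist_real_def)
  qed simp
  then have cont: "continuous_on {0..real n} v"
    by (rule lipschitz_on_continuous_on)
  have v0: "v 0 \<le> c"
    using lip[of 0 0] c(1) negligible_sing[of 0]
    by (cases "0 \<in> X") (simp_all add: v_def)
  have "\<exists>t\<ge>0. t \<le> real n \<and> v t = c"
    using v0 n cont by (intro IVT') auto
  then show ?thesis
    using ev by auto
qed

text \<open>Symmetric windows cut off measure exactly \<open>k\<close> for each \<open>k\<close>,
  and the pieces are the differences of consecutive ones. They exhaust \<open>X\<close>, because
  windows that all miss a point \<open>x\<close> would have measure at most
  \<open>2 * \<bar>x\<bar>\<close>.\<close>

lemma lebesgue_unit_partition:
  fixes X :: "real set"
  assumes X: "X \<in> sets lebesgue" and inf: "emeasure lebesgue X = \<infinity>"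
  shows "\<exists>P :: nat \<Rightarrow> real set. disjoint_family P \<and> (\<Union>k. P k) = X \<and>
    (\<forall>k. P k \<in> sets lebesgue \<and> emeasure lebesgue (P k) = ennreal 1)"
proof -
  have "\<forall>k. \<exists>t\<ge>0. emeasure lebesgue (X \<inter> {-t..t}) = ennreal (real k)"
    by (intro allI lebesgue_symmetric_interval[OF X]) (simp_all add: inf)
  then obtain t where t: "\<And>k. t k \<ge> 0" "\<And>k. emeasure lebesgue (X \<inter> {-t k..t k}) = ennreal (real k)"
    by metis
  note fm = fmeasurable_Int_interval[OF X]
  define Q where "Q = (\<lambda>k. X \<inter> {-t k..t k})"
  have Qm: "Q k \<in> sets lebesgue" for k
    unfolding Q_def by (rule fmeasurableD[OF fm])
  have eQ: "emeasure lebesgue (Q k) = ennreal (real k)" for k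
    unfolding Q_def by (rule t(2))
  have tle: "t k \<le> t (Suc k)" for k
  proof (rule ccontr)
    assume "\<not> t k \<le> t (Suc k)"
    then have "Q (Suc k) \<subseteq> Q k"
      by (auto simp: Q_def)
    from emeasure_mono[OF this Qm] show False
      unfolding eQ by simp
  qed
  have mono: "mono (\<lambda>k. Q (Suc k))"
    unfolding mono_iff_le_Suc
  proof
    fix k
    show "Q (Suc k) \<subseteq> Q (Suc (Suc k))"
      using tle[of "Suc k"] by (auto simp: Q_def)
  qed
  have "x \<in> (\<Union>k. Q (Suc k))" if x: "x \<in> X" for x
  proof (rule ccontr)
    assume n: "x \<notin> (\<Union>k. Q (Suc k))"
    have lt: "t (Suc k) < \<bar>x\<bar>" for k
    proof (rule ccontr)
      assume "\<not> t (Suc k) < \<bar>x\<bar>"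
      then have "x \<in> Q (Suc k)"
        using x by (auto simp: Q_def abs_le_iff)
      with n show False by blast
    qed
    obtain k where k: "2 * \<bar>x\<bar> < real k"
      using reals_Archimedean2 ..
    have "Q (Suc k) \<subseteq> {-\<bar>x\<bar>..\<bar>x\<bar>}"
      using lt[of k] by (auto simp: Q_def)
    from emeasure_mono[OF this, of lebesgue] have "ennreal (real (Suc k)) \<le> ennreal (2 * \<bar>x\<bar>)"
      unfolding eQ by (simp del: of_nat_Suc)
    then have "real (Suc k) \<le> 2 * \<bar>x\<bar>"
      by (subst (asm) ennreal_le_iff) simp_all
    then show False
      using k by simp
  qed
  then have un: "(\<Union>k. Q (Suc k)) = X"
    unfolding Q_def by blast
  have e: "emeasure lebesgue (disjointed (\<lambda>k. Q (Suc k)) k) = ennreal 1" for k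
  proof (cases k)
    case 0
    then show ?thesis using eQ[of 1] by (simp add: disjointed_0)
  next
    case (Suc m)
    have sub: "Q (Suc m) \<subseteq> Q (Suc (Suc m))"
      using mono unfolding mono_iff_le_Suc by blast
    have "emeasure lebesgue (Q (Suc (Suc m)) - Q (Suc m)) =
        ennreal (real (Suc (Suc m))) - ennreal (real (Suc m))"
      using emeasure_Diff[OF _ Qm Qm sub] eQ[of "Suc m"] eQ[of "Suc (Suc m)"] by simp
    also have "\<dots> = ennreal 1"
      by (subst ennreal_minus) auto
    finally show ?thesis
      using disjointed_mono[OF mono, of m] Suc by simp
  qed
  have "range (disjointed (\<lambda>k. Q (Suc k))) \<subseteq> sets lebesgue"
    using Qm by (intro sets.range_disjointed_sets) auto
  then have "disjointed (\<lambda>k. Q (Suc k)) k \<in> sets lebesgue" for k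
    by blast
  then show ?thesis
    using disjoint_family_disjointed[of "\<lambda>k. Q (Suc k)"] UN_disjointed_eq[of "\<lambda>k. Q (Suc k)"] un e
    by (intro exI[of _ "disjointed (\<lambda>k. Q (Suc k))"]) simp
qed

lemma iso_on_lebesgue_finite:
  fixes X Y :: "real set"
  assumes "X \<in> sets lebesgue" "Y \<in> sets lebesgue" "0 \<le> c"
    and "emeasure lebesgue X = ennreal c" "emeasure lebesgue Y = ennreal c"
  shows "\<exists>f g. iso_on lebesgue X lebesgue Y f g"
proof -
  obtain f g where 1: "iso_on lebesgue {0<..<c} lebesgue X f g"
    using iso_on_lebesgue_interval[OF assms(1,4,3)] by blast
  obtain f' g' where 2: "iso_on lebesgue {0<..<c} lebesgue Y f' g'"
    using iso_on_lebesgue_interval[OF assms(2,5,3)] by blast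
  show ?thesis
    using iso_on_trans[OF iso_on_sym[OF 1] 2] by blast
qed

text \<open>The quantile function needs finite measure; sets of infinite measure are therefore
  matched unit piece by unit piece and glued.\<close>

lemma iso_on_lebesgue:
  fixes X Y :: "real set"
  assumes X: "X \<in> sets lebesgue" and Y: "Y \<in> sets lebesgue"
    and eq: "emeasure lebesgue X = emeasure lebesgue Y"
  shows "\<exists>f g. iso_on lebesgue X lebesgue Y f g"
proof (cases "emeasure lebesgue X")
  case (real c)
  then show ?thesis
    using iso_on_lebesgue_finite[OF X Y] eq by simp
next
  case top
  obtain P where P: "disjoint_family P" "(\<Union>k. P k) = X"
      "\<And>k::nat. P k \<in> sets lebesgue" "\<And>k. emeasure lebesgue (P k) = ennreal 1"
    using lebesgue_unit_partition[OF X] top infinity_ennreal_def by metis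
  obtain Q where Q: "disjoint_family Q" "(\<Union>k. Q k) = Y"
      "\<And>k::nat. Q k \<in> sets lebesgue" "\<And>k. emeasure lebesgue (Q k) = ennreal 1"
    using lebesgue_unit_partition[OF Y] top eq infinity_ennreal_def by metis
  have "\<forall>k. \<exists>f g. iso_on lebesgue (P k) lebesgue (Q k) f g"
    using iso_on_lebesgue_finite[OF P(3) Q(3) _ P(4) Q(4)] by simp
  then obtain f g where "\<And>k. iso_on lebesgue (P k) lebesgue (Q k) (f k) (g k)"
    by metis
  from iso_on_glue[OF this P(1) Q(1)] show ?thesis
    unfolding P(2) Q(2) by blast
qed

lemma iso_on_to_lebesgue:
  assumes "iso_mod0 M (lebesgue :: real measure) f g" "X \<in> sets M"
  shows "iso_on M X lebesgue (g -` X) f g"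
  using iso_on_restrict[OF assms(1)[unfolded iso_mod0_iff_iso_on] assms(2) sets.sets_into_space[OF assms(2)]]
  by simp

lemma iso_on_exists:
  assumes "iso_mod0 M (lebesgue :: real measure) f g" "iso_mod0 N (lebesgue :: real measure) f' g'"
    and "X \<in> sets M" "Y \<in> sets N" "emeasure M X = emeasure N Y"
  shows "\<exists>f g. iso_on M X N Y f g"
proof -
  note 1 = iso_on_to_lebesgue[OF assms(1,3)] and 2 = iso_on_to_lebesgue[OF assms(2,4)]
  obtain F G where 3: "iso_on lebesgue (g -` X) lebesgue (g' -` Y) F G"
    using iso_on_lebesgue[OF iso_onD(2)[OF 1] iso_onD(2)[OF 2]]
      iso_on_emeasure[OF 1] iso_on_emeasure[OF 2] assms(5) by auto
  show ?thesis
    using iso_on_trans[OF iso_on_trans[OF 1 3] iso_on_sym[OF 2]] by blast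
qed

text \<open>The space is nonatomic because the line is: the subset is the preimage of a symmetric
  window.\<close>

lemma exists_subset_emeasure:
  assumes "iso_mod0 N (lebesgue :: real measure) f g" "X \<in> sets N"
    and c: "0 \<le> c" "ennreal c < emeasure N X"
  shows "\<exists>X'\<in>sets N. X' \<subseteq> X \<and> emeasure N X' = ennreal c"
proof -
  note 1 = iso_on_to_lebesgue[OF assms(1,2)]
  obtain t where t: "emeasure lebesgue (g -` X \<inter> {-t..t}) = ennreal c"
    using lebesgue_symmetric_interval[OF iso_onD(2)[OF 1] c(1)] c(2) iso_on_emeasure[OF 1] by auto
  have m: "{-t..t} \<in> sets lebesgue" by simp
  show ?thesis
    using iso_onD(5)[OF 1 m] t Int_vimage_sets[OF iso_onD(3,1)[OF 1] m]
    by (intro bexI[of _ "X \<inter> f -` {-t..t}"]) auto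
qed


subsection \<open>Automorphisms and their bijective versions\<close>

lemma iso_mod0D:
  assumes "iso_mod0 M N f g"
  shows "f \<in> measurable M N" "g \<in> measurable N M"
    "AE x in M. g (f x) = x" "AE y in N. f (g y) = y"
  using assms by (auto simp: iso_mod0_def)

lemma iso_mod0_emeasure:
  assumes "iso_mod0 M N f g" "B \<in> sets N"
  shows "emeasure M (space M \<inter> f -` B) = emeasure N B"
  using iso_onD(5)[OF assms(1)[unfolded iso_mod0_iff_iso_on] assms(2)] assms(2)
  by (simp add: sets.Int_space_eq1)

lemma AE_iso_mod0:
  assumes "iso_mod0 M N f g" "AE y in N. P y"
  shows "AE x in M. P (f x)"
proof -
  have "AE y in N. y \<in> space N \<longrightarrow> P y"
    using assms(2) by eventually_elim simp
  from AE_iso_on[OF assms(1)[unfolded iso_mod0_iff_iso_on] this] show ?thesis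
    using AE_space by eventually_elim simp
qed

lemma iso_mod0_id: "iso_mod0 M M (\<lambda>x. x) (\<lambda>x. x)"
  by (simp add: iso_mod0_def distr_id2)

lemma iso_mod0_funpow:
  assumes "iso_mod0 M M T T'"
  shows "iso_mod0 M M (T ^^ n) (T' ^^ n)"
proof (induction n)
  case 0
  then show ?case using iso_mod0_id by (simp add: id_def)
next
  case (Suc n)
  have "T ^^ Suc n = (\<lambda>x. T ((T ^^ n) x))" "T' ^^ Suc n = (\<lambda>x. (T' ^^ n) (T' x))"
    by (simp_all add: fun_eq_iff funpow_swap1)
  then show ?case
    using iso_mod0_trans[OF Suc assms] by simp
qed

lemma automorphism_funpow: "automorphism M T \<Longrightarrow> automorphism M (T ^^ n)"
  unfolding automorphism_def using iso_mod0_funpow by blast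

lemma inverse_mod0:
  assumes "automorphism M T"
  shows "iso_mod0 M M T (inverse_mod0 M T)"
  using assms unfolding automorphism_def inverse_mod0_def by (rule someI_ex)

lemma image_mod0_sets:
  assumes "automorphism M T" "A \<in> sets M"
  shows "image_mod0 M T A \<in> sets M"
  using iso_mod0D(2)[OF inverse_mod0[OF assms(1)]] assms(2)
  unfolding image_mod0_def by (rule measurable_sets)

text \<open>Trades images, which involve the chosen inverse, for preimages under \<open>T\<close>
  itself; mixing and the overlaps in \<open>metric_dw\<close> are treated in this form.\<close>

lemma emeasure_image_mod0_Int:
  assumes "automorphism M T" "A \<in> sets M" "B \<in> sets M"
  shows "emeasure M (image_mod0 M T A \<inter> B) = emeasure M (A \<inter> T -` B)"
proof -
  note i = inverse_mod0[OF assms(1)]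
  have m: "image_mod0 M T A \<inter> B \<in> sets M"
    using image_mod0_sets assms by blast
  have "emeasure M (image_mod0 M T A \<inter> B) = emeasure M (space M \<inter> T -` (image_mod0 M T A \<inter> B))"
    using iso_mod0_emeasure[OF i m] by simp
  also have "\<dots> = emeasure M (A \<inter> T -` B)"
  proof (rule emeasure_eq_AE)
    show "AE x in M. (x \<in> space M \<inter> T -` (image_mod0 M T A \<inter> B)) = (x \<in> A \<inter> T -` B)"
      using iso_mod0D(3)[OF i] AE_space
      by eventually_elim (use measurable_space[OF iso_mod0D(1)[OF i]] in \<open>auto simp: image_mod0_def\<close>)
    show "space M \<inter> T -` (image_mod0 M T A \<inter> B) \<in> sets M"
      using Int_vimage_sets[OF iso_mod0D(1)[OF i] _ m] by simp
    show "A \<inter> T -` B \<in> sets M"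
      using Int_vimage_sets[OF iso_mod0D(1)[OF i] assms(2,3)] .
  qed
  finally show ?thesis .
qed

lemma measure_image_mod0_Int:
  assumes "automorphism M T" "A \<in> sets M" "B \<in> sets M"
  shows "measure M (image_mod0 M T A \<inter> B) = measure M (A \<inter> T -` B)"
  using emeasure_image_mod0_Int[OF assms] by (simp add: measure_def)

lemma mixing_iff:
  assumes "automorphism M T"
  shows "mixing M T \<longleftrightarrow> (\<forall>A\<in>fmeasurable M. \<forall>B\<in>fmeasurable M.
    (\<lambda>n. measure M (A \<inter> (T ^^ n) -` B)) \<longlonglongrightarrow> 0)"
proof -
  have "(\<lambda>n. measure M (image_mod0 M (T ^^ n) A \<inter> B)) = (\<lambda>n. measure M (A \<inter> (T ^^ n) -` B))"
    if "A \<in> sets M" "B \<in> sets M" for A B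
    using measure_image_mod0_Int[OF automorphism_funpow[OF assms] that] by (rule ext)
  then show ?thesis
    unfolding mixing_def fmeasurable_def infinity_ennreal_def by (auto split del: if_split)
qed

lemma measure_Int_vimage_cong:
  assumes "AE x in M. S x = T x" "A \<in> sets M" "B \<in> sets M" "S \<in> measurable M M" "T \<in> measurable M M"
  shows "measure M (A \<inter> S -` B) = measure M (A \<inter> T -` B)"
  by (rule measure_eq_AE) (use assms(1) Int_vimage_sets assms(2-5) in auto)

text \<open>With inverses at every point, and not only almost everywhere, powers cancel pointwise,
  and disjointness of translates and excursion steps becomes an identity of sets.\<close>

definition bij_automorphism :: "'a measure \<Rightarrow> ('a \<Rightarrow> 'a) \<Rightarrow> ('a \<Rightarrow> 'a) \<Rightarrow> bool" where
  "bij_automorphism M T T' \<longleftrightarrow>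
     iso_mod0 M M T T' \<and> (\<forall>x. T' (T x) = x) \<and> (\<forall>x. T (T' x) = x)"

lemma funpow_inverse:
  fixes f g :: "'a \<Rightarrow> 'a"
  assumes "\<And>x. g (f x) = x"
  shows "(g ^^ n) ((f ^^ n) x) = x"
proof (induction n arbitrary: x)
  case (Suc n)
  have "(g ^^ Suc n) ((f ^^ Suc n) x) = (g ^^ n) (g (f ((f ^^ n) x)))"
    by (simp add: funpow_swap1)
  then show ?case
    using Suc assms by simp
qed simp

text \<open>Restrict \<open>T\<close> to the set of points all of whose images under words in \<open>T\<close> and \<open>T'\<close> avoid a null set
  containing the points where the two maps are not mutually inverse.\<close>

lemma bij_automorphism_exists:
  assumes i: "iso_mod0 M M T T'"
  shows "\<exists>S S'. bij_automorphism M S S' \<and> (\<forall>n. AE x in M. (S ^^ n) x = (T ^^ n) x)"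
proof -
  have "AE x in M. T' (T x) = x \<and> T (T' x) = x"
    using iso_mod0D(3,4)[OF i] by eventually_elim simp
  then obtain N where N: "N \<in> null_sets M" "{x \<in> space M. \<not> (T' (T x) = x \<and> T (T' x) = x)} \<subseteq> N"
    unfolding eventually_ae_filter by blast
  \<comment> \<open>Words are finite lists of booleans, hence countably many, so almost every point
    has all its images outside the null set.\<close>
  define word where "word = (\<lambda>ws x. foldr (\<lambda>b y. if b then T y else T' y) ws x)"
  have wm: "word ws \<in> measurable M M" for ws
  proof (induction ws)
    case Nil
    then show ?case by (simp add: word_def)
  next
    case (Cons b ws)
    then have "(\<lambda>x. (if b then T else T') (word ws x)) \<in> measurable M M"
      using iso_mod0D(1,2)[OF i] by (cases b) (auto intro: measurable_compose)
    then show ?case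
      by (cases b) (simp_all add: word_def)
  qed
  have wN: "AE x in M. word ws x \<notin> N" for ws
  proof -
    have "\<exists>g. iso_mod0 M M (word ws) g"
    proof (induction ws)
      case Nil
      have "word [] = (\<lambda>x. x)" by (simp add: word_def fun_eq_iff)
      then show ?case using iso_mod0_id by metis
    next
      case (Cons b ws)
      then obtain g where g: "iso_mod0 M M (word ws) g" by blast
      have "iso_mod0 M M (if b then T else T') (if b then T' else T)"
        using i iso_mod0_sym[OF i] by simp
      from iso_mod0_trans[OF g this]
      have "\<exists>g. iso_mod0 M M (\<lambda>x. (if b then T else T') (word ws x)) g"
        by (rule exI[where x = "\<lambda>z. g ((if b then T' else T) z)"])
      moreover have "(\<lambda>x. (if b then T else T') (word ws x)) = word (b # ws)"
        by (cases b) (simp_all add: word_def fun_eq_iff)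
      ultimately show ?case by simp
    qed
    then show ?thesis
      using AE_iso_mod0[OF _ AE_not_in[OF N(1)]] by blast
  qed
  define Z where "Z = {x \<in> space M. \<forall>ws. word ws x \<notin> N}"
  have Z: "Z \<in> sets M"
    unfolding Z_def
  proof (rule sets.sets_Collect_countable_All)
    fix ws
    have "{x \<in> space M. word ws x \<notin> N} = word ws -` (space M - N) \<inter> space M"
      using measurable_space[OF wm] by auto
    also have "\<dots> \<in> sets M"
      using N(1) by (intro measurable_sets[OF wm]) auto
    finally show "{x \<in> space M. word ws x \<notin> N} \<in> sets M" .
  qed
  have aeZ: "AE x in M. x \<in> Z"
    using AE_all_countable[THEN iffD2, OF allI[OF wN]] AE_space
    by eventually_elim (simp add: Z_def)
  have TZ: "T x \<in> Z" "T' x \<in> Z" if "x \<in> Z" for x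
  proof -
    have "word ws (T x) = word (ws @ [True]) x" "word ws (T' x) = word (ws @ [False]) x" for ws
      by (simp_all add: word_def)
    then show "T x \<in> Z" "T' x \<in> Z"
      using that measurable_space[OF iso_mod0D(1)[OF i]] measurable_space[OF iso_mod0D(2)[OF i]]
      by (auto simp: Z_def)
  qed
  have inv: "T' (T x) = x" "T (T' x) = x" if "x \<in> Z" for x
  proof -
    have "word [] x \<notin> N" "x \<in> space M"
      using that unfolding Z_def by blast+
    then show "T' (T x) = x" "T (T' x) = x"
      using N(2) by (auto simp: word_def)
  qed
  \<comment> \<open>Both maps send \<open>Z\<close> into itself, so replacing them by the identity
    off \<open>Z\<close> makes them inverse everywhere and leaves whole orbits inside
    \<open>Z\<close> unchanged.\<close>
  define S where "S = (\<lambda>x. if x \<in> Z then T x else x)"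
  define S' where "S' = (\<lambda>x. if x \<in> Z then T' x else x)"
  have SZ: "(S ^^ n) x = (T ^^ n) x \<and> (T ^^ n) x \<in> Z" if "x \<in> Z" for n x
    using that TZ by (induction n) (auto simp: S_def)
  have Sm: "S \<in> measurable M M" "S' \<in> measurable M M"
    unfolding S_def S'_def using iso_mod0D(1,2)[OF i] Z
    by (auto intro!: measurable_If_set)
  have "iso_mod0 M M S S'"
    unfolding iso_mod0_iff_iso_on
  proof (rule iso_onI)
    show "AE x in M. x \<in> space M \<longrightarrow> S' (S x) = x"
      by (auto simp: S_def S'_def TZ inv)
    show "AE x in M. x \<in> space M \<longrightarrow> S' x \<in> space M \<and> S (S' x) = x"
      using measurable_space[OF Sm(2)] by (auto simp: S_def S'_def TZ inv)
    fix B assume B: "B \<in> sets M"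
    have "emeasure M (space M \<inter> S -` B) = emeasure M (space M \<inter> T -` B)"
      using Int_vimage_sets[OF Sm(1) _ B] Int_vimage_sets[OF iso_mod0D(1)[OF i] _ B] aeZ
      by (intro emeasure_eq_AE) (auto simp: S_def)
    also have "\<dots> = emeasure M (space M \<inter> B)"
      using iso_mod0_emeasure[OF i B] sets.Int_space_eq1[OF B] by simp
    finally show "emeasure M (space M \<inter> S -` B) = emeasure M (space M \<inter> B)" .
  qed (use Sm in auto)
  then have "bij_automorphism M S S'"
    by (auto simp: bij_automorphism_def S_def S'_def TZ inv)
  moreover have "AE x in M. (S ^^ n) x = (T ^^ n) x" for n
    using aeZ by eventually_elim (use SZ in blast)
  ultimately show ?thesis by blast
qed


subsection \<open>Sets with uniformly small returns\<close>

lemma iso_mod0_fmeasurable: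
  assumes "iso_mod0 M N f g" "B \<in> fmeasurable N"
  shows "space M \<inter> f -` B \<in> fmeasurable M" "measure M (space M \<inter> f -` B) = measure N B"
proof -
  have "space M \<inter> f -` B \<in> sets M"
    using Int_vimage_sets[OF iso_mod0D(1)[OF assms(1)] sets.top fmeasurableD[OF assms(2)]] .
  then show "space M \<inter> f -` B \<in> fmeasurable M"
    using iso_mod0_emeasure[OF assms(1) fmeasurableD[OF assms(2)]] assms(2)
    by (intro fmeasurableI) (auto simp: fmeasurable_def)
  show "measure M (space M \<inter> f -` B) = measure N B"
    using iso_mod0_emeasure[OF assms(1) fmeasurableD[OF assms(2)]] by (simp add: measure_def)
qed

lemma fmeasurable_Int_vimage:
  assumes "T \<in> measurable M N" "A \<in> fmeasurable M" "B \<in> sets N"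
  shows "A \<inter> T -` B \<in> fmeasurable M"
  using fmeasurableI2[OF assms(2) _ Int_vimage_sets[OF assms(1) fmeasurableD[OF assms(2)] assms(3)]]
  by blast

text \<open>Unions of translates of a set with small self-intersections: the translates are chosen so far
  apart that, for each time shift, at most one pair of them interacts strongly.\<close>

lemma exists_union_of_translates:
  fixes S :: "'a \<Rightarrow> 'a"
  assumes S: "bij_automorphism N S S'"
    and mix: "\<And>A B. A \<in> fmeasurable N \<Longrightarrow> B \<in> fmeasurable N \<Longrightarrow>
      (\<lambda>n. measure N (A \<inter> (S ^^ n) -` B)) \<longlonglongrightarrow> 0"
    and E: "E \<in> fmeasurable N" and \<delta>: "\<delta> > 0"
    and small: "\<And>m. m \<ge> 1 \<Longrightarrow> measure N (E \<inter> (S ^^ m) -` E) \<le> \<delta>"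
  shows "\<exists>G\<in>fmeasurable N. real Q * (measure N E - \<delta>) \<le> measure N G \<and>
    (\<forall>m\<ge>1. measure N (G \<inter> (S ^^ m) -` G) \<le> measure N E + 3 * real Q * \<delta>)"
proof (induction Q)
  case 0
  then show ?case by (intro bexI[of _ "{}"]) auto
next
  case (Suc Q)
  then obtain G where G: "G \<in> fmeasurable N" "real Q * (measure N E - \<delta>) \<le> measure N G"
      "\<And>m. m \<ge> 1 \<Longrightarrow> measure N (G \<inter> (S ^^ m) -` G) \<le> measure N E + 3 * real Q * \<delta>"
    by blast
  have i: "iso_mod0 N N (S ^^ n) (S' ^^ n)" for n
    using S by (auto simp: bij_automorphism_def intro: iso_mod0_funpow)
  note Sm = iso_mod0D(1)[OF i] and pre = iso_mod0_fmeasurable[OF i]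
  note fI = fmeasurable_Int_vimage[OF Sm _ fmeasurableD]
  have "\<forall>\<^sub>F n in sequentially. measure N (G \<inter> (S ^^ n) -` G) < \<delta> \<and>
      measure N (E \<inter> (S ^^ n) -` G) < \<delta> \<and> measure N (G \<inter> (S ^^ n) -` E) < \<delta>"
    using mix[OF G(1) G(1)] mix[OF E G(1)] mix[OF G(1) E] \<delta>
    by (intro eventually_conj order_tendstoD(2)) auto
  then obtain D where D: "\<And>n. n \<ge> D \<Longrightarrow> measure N (G \<inter> (S ^^ n) -` G) < \<delta>"
      "\<And>n. n \<ge> D \<Longrightarrow> measure N (E \<inter> (S ^^ n) -` G) < \<delta>"
      "\<And>n. n \<ge> D \<Longrightarrow> measure N (G \<inter> (S ^^ n) -` E) < \<delta>"
    unfolding eventually_sequentially by blast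
  \<comment> \<open>The shifts within distance \<open>D\<close> of \<open>a\<close> all exceed
    \<open>D\<close>. So a shift that can carry the new copy back onto \<open>G\<close> is long
    enough for \<open>G\<close> to hardly meet its own translate.\<close>
  define a where "a = 2 * D + 1"
  define F where "F = space N \<inter> (S ^^ a) -` E"
  have F: "F \<in> fmeasurable N" "measure N F = measure N E"
    unfolding F_def using pre[OF E] by auto
  have GF: "G \<union> F \<in> fmeasurable N"
    using G(1) F(1) by (rule fmeasurable.Un)
  have sub: "A \<subseteq> space N" if "A \<in> fmeasurable N" for A
    using sets.sets_into_space[OF fmeasurableD[OF that]] .
  have shift: "space N \<inter> (S ^^ k) -` (A \<inter> (S ^^ l) -` B) = (space N \<inter> (S ^^ k) -` A) \<inter> (S ^^ (l + k)) -` B"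
    for k l A B
    by (auto simp: funpow_add)
  have "G \<inter> F = G \<inter> (S ^^ a) -` E"
    using sub[OF G(1)] by (auto simp: F_def)
  then have "measure N (G \<union> F) = measure N G + measure N E - measure N (G \<inter> (S ^^ a) -` E)"
    using measure_Un3[OF G(1) F(1)] F(2) by simp
  also have "\<dots> \<ge> real Q * (measure N E - \<delta>) + measure N E - \<delta>"
    using D(3)[of a] G(2) by (simp add: a_def)
  finally have lower: "real (Suc Q) * (measure N E - \<delta>) \<le> measure N (G \<union> F)"
    by (simp add: algebra_simps)
  have upper: "measure N ((G \<union> F) \<inter> (S ^^ m) -` (G \<union> F)) \<le> measure N E + 3 * real (Suc Q) * \<delta>"
    if m: "m \<ge> 1" for m
  proof -
    have "measure N ((G \<union> F) \<inter> (S ^^ m) -` (G \<union> F)) \<le>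
      measure N (G \<inter> (S ^^ m) -` G) + measure N (G \<inter> (S ^^ m) -` F) +
      (measure N (F \<inter> (S ^^ m) -` G) + measure N (F \<inter> (S ^^ m) -` F))"
    proof -
      have "measure N ((G \<union> F) \<inter> (S ^^ m) -` (G \<union> F)) \<le>
        measure N (((G \<inter> (S ^^ m) -` G) \<union> (G \<inter> (S ^^ m) -` F)) \<union>
          ((F \<inter> (S ^^ m) -` G) \<union> (F \<inter> (S ^^ m) -` F)))"
        using fI[OF GF GF] fI[OF G(1) G(1)] fI[OF G(1) F(1)] fI[OF F(1) G(1)] fI[OF F(1) F(1)]
        by (intro measure_mono_fmeasurable fmeasurable.Un) (auto dest: fmeasurableD)
      also have "\<dots> \<le> measure N ((G \<inter> (S ^^ m) -` G) \<union> (G \<inter> (S ^^ m) -` F)) +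
          measure N ((F \<inter> (S ^^ m) -` G) \<union> (F \<inter> (S ^^ m) -` F))"
        using fmeasurableD[OF fI] G(1) F(1) by (intro measure_Un_le sets.Un) auto
      also have "\<dots> \<le> measure N (G \<inter> (S ^^ m) -` G) + measure N (G \<inter> (S ^^ m) -` F) +
          (measure N (F \<inter> (S ^^ m) -` G) + measure N (F \<inter> (S ^^ m) -` F))"
        using fmeasurableD[OF fI] G(1) F(1) by (intro add_mono measure_Un_le) auto
      finally show ?thesis .
    qed
    moreover have "measure N (G \<inter> (S ^^ m) -` F) < \<delta>"
    proof -
      have "G \<inter> (S ^^ m) -` F = G \<inter> (S ^^ (a + m)) -` E"
        using sub[OF G(1)] measurable_space[OF Sm] by (auto simp: F_def funpow_add)
      then show ?thesis
        using D(3)[of "a + m"] by (simp add: a_def)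
    qed
    moreover have "measure N (F \<inter> (S ^^ m) -` F) \<le> \<delta>"
    proof -
      have "F \<inter> (S ^^ m) -` F = space N \<inter> (S ^^ a) -` (E \<inter> (S ^^ m) -` E)"
        unfolding shift unfolding F_def using measurable_space[OF Sm]
        by (auto simp: add.commute[of m a]) (simp_all add: funpow_add add.commute)
      then show ?thesis
        using small[OF m] pre(2)[OF fI[OF E E]] by simp
    qed
    \<comment> \<open>The two terms are never large for the same \<open>m\<close>. Hence the summand
      \<open>measure N E\<close> occurs once in the bound and does not accumulate with
      \<open>Q\<close>.\<close>
    moreover have "measure N (G \<inter> (S ^^ m) -` G) + measure N (F \<inter> (S ^^ m) -` G)
        \<le> measure N E + 3 * real Q * \<delta> + \<delta>"
    proof (cases "a + D \<le> m \<or> m + D \<le> a")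
      case True
      then have "measure N (F \<inter> (S ^^ m) -` G) < \<delta>"
      proof
        assume le: "a + D \<le> m"
        have "F \<inter> (S ^^ m) -` G = space N \<inter> (S ^^ a) -` (E \<inter> (S ^^ (m - a)) -` G)"
          unfolding shift using le by (simp add: F_def)
        then show ?thesis
          using D(2)[of "m - a"] le pre(2)[OF fI[OF E G(1)]] by simp
      next
        assume le: "m + D \<le> a"
        have "F \<inter> (S ^^ m) -` G = space N \<inter> (S ^^ m) -` (G \<inter> (S ^^ (a - m)) -` E)"
          unfolding shift using le by (auto simp: F_def)
        then show ?thesis
          using D(3)[of "a - m"] le pre(2)[OF fI[OF G(1) E]] by simp
      qed
      then show ?thesis
        using G(3)[OF m] by simp
    next
      case False
      then have "measure N (G \<inter> (S ^^ m) -` G) < \<delta>"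
        by (intro D(1)) (simp add: a_def)
      moreover have "measure N (F \<inter> (S ^^ m) -` G) \<le> measure N F"
        using fmeasurableD[OF fI] F(1) G(1) by (intro measure_mono_fmeasurable) auto
      moreover have "0 \<le> real Q * \<delta>"
        using \<delta> by simp
      ultimately show ?thesis
        using F(2) by linarith
    qed
    ultimately show ?thesis
      by (simp add: algebra_simps)
  qed
  show ?case
    using GF lower upper by blast
qed

text \<open>Enough translates of one small base give a set of measure above \<open>c + 1\<close>
  with small returns. Removing the points that return within time \<open>n\<close> costs measure at
  most 1, and cutting down to measure exactly \<open>c\<close> only shrinks the returns.\<close>

lemma exists_set_small_returns:
  fixes S :: "'a \<Rightarrow> 'a"
  assumes N: "iso_mod0 N (lebesgue :: real measure) f g"
    and S: "bij_automorphism N S S'"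
    and mix: "\<And>A B. A \<in> fmeasurable N \<Longrightarrow> B \<in> fmeasurable N \<Longrightarrow>
      (\<lambda>n. measure N (A \<inter> (S ^^ n) -` B)) \<longlonglongrightarrow> 0"
    and small: "\<And>\<eta>. \<eta> > 0 \<Longrightarrow> \<exists>E\<in>fmeasurable N. 0 < measure N E \<and> measure N E < \<eta> \<and>
      (\<forall>m\<ge>1. measure N (E \<inter> (S ^^ m) -` E) \<le> \<eta> * measure N E)"
    and c: "c \<ge> 0" and \<eta>: "\<eta> > 0"
  shows "\<exists>G\<in>sets N. emeasure N G = ennreal c \<and>
    (\<forall>m\<ge>1. measure N (G \<inter> (S ^^ m) -` G) \<le> \<eta>) \<and>
    (\<forall>m. 1 \<le> m \<and> m \<le> n \<longrightarrow> G \<inter> (S ^^ m) -` G = {})"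
proof -
  \<comment> \<open>The second entry keeps the sum of the \<open>n\<close> early returns below
    1.\<close>
  define \<eta>1 where "\<eta>1 = min \<eta> (1 / (real n + 1))"
  have \<eta>1: "\<eta>1 > 0" "\<eta>1 \<le> \<eta>" "real n * \<eta>1 \<le> 1"
  proof -
    show "\<eta>1 > 0" "\<eta>1 \<le> \<eta>"
      using \<eta> by (auto simp: \<eta>1_def)
    have "real n * \<eta>1 \<le> real n * (1 / (real n + 1))"
      by (intro mult_left_mono) (auto simp: \<eta>1_def)
    also have "\<dots> \<le> 1"
      by (simp add: field_simps)
    finally show "real n * \<eta>1 \<le> 1" .
  qed
  \<comment> \<open>\<open>6 * c + 10\<close> is \<open>1 + 3 * (2 * c + 3)\<close>, where
    \<open>2 * c + 3\<close> bounds the total measure \<open>real Q * e\<close> of the copies. The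
    cap at 1/2 ensures that the copies lose at most half of that total to their overlaps.\<close>
  define \<eta>2 where "\<eta>2 = min (1/2) (\<eta>1 / (6 * c + 10))"
  have \<eta>2: "\<eta>2 > 0" "\<eta>2 \<le> 1/2" "\<eta>2 * (6 * c + 10) \<le> \<eta>1"
  proof -
    show "\<eta>2 > 0"
      using \<eta>1 c by (simp add: \<eta>2_def)
    show "\<eta>2 \<le> 1/2"
      unfolding \<eta>2_def by (rule min.cobounded1)
    have "\<eta>2 * (6 * c + 10) \<le> \<eta>1 / (6 * c + 10) * (6 * c + 10)"
      using c by (intro mult_right_mono) (auto simp: \<eta>2_def)
    also have "\<dots> = \<eta>1"
      using c by simp
    finally show "\<eta>2 * (6 * c + 10) \<le> \<eta>1" .
  qed
  obtain E where E: "E \<in> fmeasurable N" "0 < measure N E" "measure N E < \<eta>2"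
      "\<And>m. m \<ge> 1 \<Longrightarrow> measure N (E \<inter> (S ^^ m) -` E) \<le> \<eta>2 * measure N E"
    using small[OF \<eta>2(1)] by blast
  define e where "e = measure N E"
  \<comment> \<open>Puts \<open>real Q * e\<close> between \<open>2 * (c + 1)\<close> and
    \<open>2 * c + 3\<close>; the factor 2 compensates for the loss of up to one half.\<close>
  define Q where "Q = nat \<lfloor>2 * (c + 1) / e\<rfloor> + 1"
  have e: "0 < e" "e < \<eta>2" "e < 1"
    using E(2,3) \<eta>2(2) by (auto simp: e_def)
  have "0 \<le> 2 * (c + 1) / e"
    using c e by simp
  then have "2 * (c + 1) / e < real Q" "real Q \<le> 2 * (c + 1) / e + 1"
    unfolding Q_def by linarith+
  then have Q: "2 * (c + 1) < real Q * e" "real Q * e \<le> 2 * c + 3"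
    using e by (simp_all add: field_simps)
  have "\<eta>2 * e > 0"
    using \<eta>2 e by simp
  from exists_union_of_translates[OF S mix E(1) this, of Q] obtain G0 where
    G0: "G0 \<in> fmeasurable N" "real Q * (e - \<eta>2 * e) \<le> measure N G0"
      "\<And>m. m \<ge> 1 \<Longrightarrow> measure N (G0 \<inter> (S ^^ m) -` G0) \<le> e + 3 * real Q * (\<eta>2 * e)"
    using E(4) unfolding e_def by auto
  have "c + 1 < real Q * e * (1/2)"
    using Q by simp
  also have "\<dots> \<le> real Q * e * (1 - \<eta>2)"
    using \<eta>2 e by (intro mult_left_mono) auto
  also have "\<dots> \<le> measure N G0"
    using G0(2) by (simp add: algebra_simps)
  finally have big: "c + 1 < measure N G0" .
  have "e + 3 * real Q * (\<eta>2 * e) \<le> \<eta>2 + \<eta>2 * (3 * (real Q * e))"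
    using e by (simp add: algebra_simps)
  also have "\<dots> \<le> \<eta>2 + \<eta>2 * (3 * (2 * c + 3))"
    using Q \<eta>2 by (intro add_left_mono mult_left_mono) auto
  also have "\<dots> \<le> \<eta>1"
    using \<eta>2(3) by (simp add: algebra_simps)
  finally have overlap: "measure N (G0 \<inter> (S ^^ m) -` G0) \<le> \<eta>1" if "m \<ge> 1" for m
    using G0(3)[OF that] by linarith
  have Sm: "S ^^ m \<in> measurable N N" for m
    using S by (auto simp: bij_automorphism_def intro: iso_mod0D iso_mod0_funpow)
  define H where "H = (\<Union>m\<in>{1..n}. G0 \<inter> (S ^^ m) -` G0)"
  have If: "G0 \<inter> (S ^^ m) -` G0 \<in> fmeasurable N" for m
    using fmeasurable_Int_vimage[OF Sm G0(1) fmeasurableD[OF G0(1)]] .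
  have H: "H \<in> fmeasurable N"
    unfolding H_def using If by (intro fmeasurable.finite_UN) auto
  have "measure N H \<le> (\<Sum>m\<in>{1..n}. measure N (G0 \<inter> (S ^^ m) -` G0))"
    unfolding H_def using fmeasurableD[OF If] by (intro measure_UNION_le) auto
  also have "\<dots> \<le> (\<Sum>m\<in>{1..n}. \<eta>1)"
    using overlap by (intro sum_mono) auto
  also have "\<dots> \<le> 1"
    using \<eta>1(3) by simp
  finally have "measure N H \<le> 1" .
  moreover have "measure N (G0 - H) = measure N G0 - measure N H"
    using G0(1) H by (intro measurable_measure_Diff) (auto simp: H_def fmeasurableD)
  ultimately have "c < measure N (G0 - H)"
    using big by simp
  moreover have GH: "G0 - H \<in> fmeasurable N"
    using G0(1) H by (intro fmeasurable_Diff) (auto dest: fmeasurableD)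
  ultimately have "ennreal c < emeasure N (G0 - H)"
    using c by (simp add: emeasure_eq_measure2 ennreal_less_iff)
  from exists_subset_emeasure[OF N fmeasurableD[OF GH] c this] obtain G where
    G: "G \<in> sets N" "G \<subseteq> G0 - H" "emeasure N G = ennreal c"
    by blast
  have "measure N (G \<inter> (S ^^ m) -` G) \<le> \<eta>" if m: "m \<ge> 1" for m
  proof -
    have "measure N (G \<inter> (S ^^ m) -` G) \<le> measure N (G0 \<inter> (S ^^ m) -` G0)"
      using G If Int_vimage_sets[OF Sm G(1) G(1)] by (intro measure_mono_fmeasurable) auto
    then show ?thesis
      using overlap[OF m] \<eta>1(2) by linarith
  qed
  moreover have "G \<inter> (S ^^ m) -` G = {}" if "1 \<le> m \<and> m \<le> n" for m
  proof -
    have "G0 \<inter> (S ^^ m) -` G0 \<subseteq> H"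
      unfolding H_def using that by (intro UN_upper) auto
    then show ?thesis
      using G(2) by auto
  qed
  ultimately show ?thesis
    using G by blast
qed


subsection \<open>Conjugating along excursions\<close>

lemma measure_mono_AE:
  assumes "AE x in M. x \<in> A \<longrightarrow> x \<in> B" "A \<in> sets M" "B \<in> fmeasurable M"
  shows "measure M A \<le> measure M B"
proof -
  have "emeasure M A \<le> emeasure M B"
    using assms by (intro emeasure_mono_AE) (auto dest: fmeasurableD)
  then show ?thesis
    using fmeasurableD2[OF assms(3)] unfolding measure_def
    by (intro enn2real_mono) (auto simp: top.not_eq_extremum)
qed

lemma bij_automorphism_cancel:
  assumes "bij_automorphism N S S'"
  shows "(S' ^^ n) ((S ^^ n) x) = x" "(S ^^ n) ((S' ^^ n) x) = x"
    "(S ^^ n) x = (S ^^ n) y \<longleftrightarrow> x = y"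
    "k \<le> n \<Longrightarrow> (S' ^^ k) ((S ^^ n) x) = (S ^^ (n - k)) x"
    "k \<le> n \<Longrightarrow> (S' ^^ n) ((S ^^ k) x) = (S' ^^ (n - k)) x"
    "k \<le> n \<Longrightarrow> (S ^^ k) ((S' ^^ n) x) = (S' ^^ (n - k)) x"
proof -
  have 1: "(S' ^^ n) ((S ^^ n) x) = x" "(S ^^ n) ((S' ^^ n) x) = x" for n x
    using assms funpow_inverse unfolding bij_automorphism_def by metis+
  show "(S' ^^ n) ((S ^^ n) x) = x" "(S ^^ n) ((S' ^^ n) x) = x"
    by (rule 1)+
  show "(S ^^ n) x = (S ^^ n) y \<longleftrightarrow> x = y"
    using 1 by metis
  assume k: "k \<le> n"
  show "(S' ^^ k) ((S ^^ n) x) = (S ^^ (n - k)) x"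
    using 1(1)[of k "(S ^^ (n - k)) x"] k by (simp flip: funpow_add[THEN fun_cong, unfolded o_apply])
  show "(S' ^^ n) ((S ^^ k) x) = (S' ^^ (n - k)) x"
    using k 1(1)[of k x] funpow_add[of "n - k" k S'] by simp
  show "(S ^^ k) ((S' ^^ n) x) = (S' ^^ (n - k)) x"
    using 1(2)[of k "(S' ^^ (n - k)) x"] k by (simp flip: funpow_add[THEN fun_cong, unfolded o_apply])
qed

text \<open>Only the difference of the times matters: the set is a preimage, under a power of
  \<open>S'\<close>, of the return of \<open>G\<close> at time \<open>\<bar>m + k - l\<bar>\<close>,
  which is positive. The bound is thus uniform in \<open>k\<close>, \<open>l\<close> and
  \<open>m\<close>.\<close>

lemma overlap_shift:
  assumes S: "bij_automorphism N S S'" and G: "G \<in> fmeasurable N"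
    and small: "\<And>m. m \<ge> 1 \<Longrightarrow> measure N (G \<inter> (S ^^ m) -` G) \<le> \<eta>"
    and lk: "l \<noteq> m + k"
  shows "{z \<in> space N. (S' ^^ k) z \<in> G \<and> (S' ^^ l) ((S ^^ m) z) \<in> G} \<in> fmeasurable N"
    and "measure N {z \<in> space N. (S' ^^ k) z \<in> G \<and> (S' ^^ l) ((S ^^ m) z) \<in> G} \<le> \<eta>"
proof -
  note cancel = bij_automorphism_cancel[OF S]
  have i: "iso_mod0 N N (S ^^ n) (S' ^^ n)" for n
    using S by (auto simp: bij_automorphism_def intro: iso_mod0_funpow)
  have fI: "G \<inter> (S ^^ d) -` G \<in> fmeasurable N" for d
    using fmeasurable_Int_vimage[OF iso_mod0D(1)[OF i] G fmeasurableD[OF G]] .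
  note pre = iso_mod0_fmeasurable[OF iso_mod0_sym[OF i] fI]
  have "\<exists>p d. d \<ge> 1 \<and> {z \<in> space N. (S' ^^ k) z \<in> G \<and> (S' ^^ l) ((S ^^ m) z) \<in> G} =
    space N \<inter> (S' ^^ p) -` (G \<inter> (S ^^ d) -` G)"
  proof (cases "l < m + k")
    case True
    have "(S' ^^ l) ((S ^^ m) z) = (S ^^ (m + k - l)) ((S' ^^ k) z)" for z
    proof -
      have "(S ^^ m) z = (S ^^ (m + k)) ((S' ^^ k) z)"
        by (simp add: funpow_add cancel(2))
      then show ?thesis
        using cancel(4)[of l "m + k"] True by simp
    qed
    then show ?thesis
      using True by (intro exI[of _ k] exI[of _ "m + k - l"]) auto
  next
    case False
    then have l: "m \<le> l" "k < l - m"
      using lk by auto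
    have "(S' ^^ l) ((S ^^ m) z) = (S' ^^ (l - m)) z" for z
      using cancel(5)[OF l(1)] .
    moreover have "(S ^^ (l - m - k)) ((S' ^^ (l - m)) z) = (S' ^^ k) z" for z
      using cancel(6)[of "l - m - k" "l - m"] l by simp
    ultimately show ?thesis
      using l by (intro exI[of _ "l - m"] exI[of _ "l - m - k"]) auto
  qed
  then obtain p d where d: "d \<ge> 1" and
    eq: "{z \<in> space N. (S' ^^ k) z \<in> G \<and> (S' ^^ l) ((S ^^ m) z) \<in> G} =
      space N \<inter> (S' ^^ p) -` (G \<inter> (S ^^ d) -` G)"
    by blast
  show "{z \<in> space N. (S' ^^ k) z \<in> G \<and> (S' ^^ l) ((S ^^ m) z) \<in> G} \<in> fmeasurable N"
    unfolding eq by (rule pre)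
  show "measure N {z \<in> space N. (S' ^^ k) z \<in> G \<and> (S' ^^ l) ((S ^^ m) z) \<in> G} \<le> \<eta>"
    unfolding eq pre(2) by (rule small[OF d])
qed

lemma emeasure_space_lebesgue_iso:
  assumes "iso_mod0 M (lebesgue :: real measure) f g"
  shows "emeasure M (space M) = \<infinity>"
  using iso_on_emeasure[OF assms[unfolded iso_mod0_iff_iso_on]]
  by simp

text \<open>\<open>Y k\<close> is step \<open>k\<close> of the excursions. Since \<open>i\<close>
  starts at 1, a point of \<open>Y k\<close> with \<open>k > 0\<close> may itself lie outside
  \<open>W\<close>: an excursion includes the first point after leaving \<open>W\<close>.\<close>

lemma conjugation_on_excursions:
  fixes T :: "'a \<Rightarrow> 'a" and S :: "'b \<Rightarrow> 'b"
  assumes M: "iso_mod0 M (lebesgue :: real measure) f0 g0"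
    and N: "iso_mod0 N (lebesgue :: real measure) f1 g1"
    and T: "bij_automorphism M T T'" and S: "bij_automorphism N S S'"
    and W: "W \<in> fmeasurable M" and F: "F = W \<inter> T' -` (space M - W)"
    and Y: "\<And>k. Y k = {x \<in> space M. (T' ^^ k) x \<in> F \<and> (\<forall>i\<in>{1..k}. (T' ^^ i) x \<in> W)}"
    and G: "G \<in> fmeasurable N" "\<And>m. 1 \<le> m \<Longrightarrow> m \<le> n \<Longrightarrow> G \<inter> (S ^^ m) -` G = {}"
    and \<phi>: "iso_on M F N G \<phi> \<phi>'"
  shows "\<exists>R R'. iso_mod0 M N R R' \<and> (\<forall>k\<le>n. \<forall>x\<in>Y k. R x = (S ^^ k) (\<phi> ((T' ^^ k) x)))"
proof -
  note cancelS = bij_automorphism_cancel[OF S] and cancelT = bij_automorphism_cancel[OF T]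
  have iT: "iso_mod0 M M (T ^^ n) (T' ^^ n)" for n
    using T by (auto simp: bij_automorphism_def intro: iso_mod0_funpow)
  have iS: "iso_mod0 N N (S ^^ n) (S' ^^ n)" for n
    using S by (auto simp: bij_automorphism_def intro: iso_mod0_funpow)
  note Fm = iso_onD(1)[OF \<phi>]
  have Ym: "Y k \<in> fmeasurable M" for k
  proof -
    have "F \<in> fmeasurable M"
      using fmeasurableI2[OF W _ Fm] F by blast
    note pF = iso_mod0_fmeasurable(1)[OF iso_mod0_sym[OF iT] this, of k]
    have "space M \<inter> (T' ^^ i) -` (space M - W) \<in> sets M" for i
      using Int_vimage_sets[OF iso_mod0D(2)[OF iT] sets.top] W by (auto dest: fmeasurableD)
    then have "(\<Union>i\<in>{1..k}. space M \<inter> (T' ^^ i) -` (space M - W)) \<in> sets M"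
      by (intro sets.finite_UN) auto
    note fmeasurable_Diff[OF pF this]
    moreover have "Y k = space M \<inter> (T' ^^ k) -` F -
        (\<Union>i\<in>{1..k}. space M \<inter> (T' ^^ i) -` (space M - W))"
      using measurable_space[OF iso_mod0D(2)[OF iT]] unfolding Y by auto
    ultimately show ?thesis by simp
  qed
  \<comment> \<open>The step is read off the backward orbit: on \<open>Y k\<close> the first
    positive time at which it lies outside \<open>W\<close> is \<open>Suc k\<close>.\<close>
  have Yd: "Y k \<inter> Y l = {}" if "k < l" for k l
  proof -
    have "(T' ^^ Suc k) x \<notin> W" if "x \<in> Y k" for x
      using that by (auto simp: Y F)
    moreover have "(T' ^^ Suc k) x \<in> W" if "x \<in> Y l" for x
      using that \<open>k < l\<close> by (auto simp: Y simp del: funpow.simps)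
    ultimately show ?thesis by blast
  qed
  define F' where "F' k = space M \<inter> (T ^^ k) -` Y k" for k
  define Z where "Z k = space N \<inter> (S' ^^ k) -` (G \<inter> \<phi>' -` F' k)" for k
  have iso: "iso_on M (Y k) N (Z k) (\<lambda>x. (S ^^ k) (\<phi> ((T' ^^ k) x)))
      (\<lambda>z. (T ^^ k) (\<phi>' ((S' ^^ k) z)))" for k
  proof -
    have 1: "iso_on M (Y k) M (F' k) (T' ^^ k) (T ^^ k)"
      unfolding F'_def
      using iso_mod0_sym[OF iT] Ym unfolding iso_mod0_iff_iso_on
      by (intro iso_on_restrict[where X = "space M"]) (auto dest: fmeasurableD simp: Y)
    have "F' k \<subseteq> F"
      by (auto simp: F'_def Y cancelT)
    then have 2: "iso_on M (F' k) N (G \<inter> \<phi>' -` F' k) \<phi> \<phi>'"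
      by (intro iso_on_restrict[OF \<phi>] iso_onD(2)[OF 1])
    have 3: "iso_on N (G \<inter> \<phi>' -` F' k) N (Z k) (S ^^ k) (S' ^^ k)"
      unfolding Z_def using iS iso_onD(2)[OF 2] sets.sets_into_space[OF iso_onD(2)[OF 2]]
      unfolding iso_mod0_iff_iso_on by (intro iso_on_restrict[where X = "space N"]) auto
    show ?thesis
      using iso_on_trans[OF iso_on_trans[OF 1 2] 3] .
  qed
  have Zd: "Z k \<inter> Z l = {}" if "k < l" "l \<le> n" for k l
  proof (rule ccontr)
    assume "Z k \<inter> Z l \<noteq> {}"
    then obtain z where z: "(S' ^^ k) z \<in> G" "(S' ^^ l) z \<in> G"
      by (auto simp: Z_def)
    have "(S ^^ (l - k)) ((S' ^^ l) z) = (S' ^^ k) z"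
      using cancelS(6)[of "l - k" l z] that by simp
    with z have "(S' ^^ l) z \<in> G \<inter> (S ^^ (l - k)) -` G"
      by simp
    moreover have "G \<inter> (S ^^ (l - k)) -` G = {}"
      using that by (intro G(2)) auto
    ultimately show False by blast
  qed
  have Zm: "Z k \<in> fmeasurable N" for k
    using iso_onD(2)[OF iso] iso_on_emeasure[OF iso] fmeasurableD2[OF Ym]
    by (intro fmeasurableI) (auto simp: top.not_eq_extremum)
  define Yr where "Yr = space M - (\<Union>k\<le>n. Y k)"
  define Zr where "Zr = space N - (\<Union>k\<le>n. Z k)"
  have "(\<Union>k\<le>n. Y k) \<in> fmeasurable M" "(\<Union>k\<le>n. Z k) \<in> fmeasurable N"
    using Ym Zm by (auto intro!: fmeasurable.finite_UN)
  then have r: "Yr \<in> sets M" "emeasure M Yr = \<infinity>" "Zr \<in> sets N" "emeasure N Zr = \<infinity>"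
    unfolding Yr_def Zr_def using emeasure_space_lebesgue_iso[OF M] emeasure_space_lebesgue_iso[OF N]
    by (auto simp: emeasure_Diff fmeasurableD fmeasurableD2 sets.sets_into_space ennreal_top_minus)
  \<comment> \<open>Index \<open>Suc n\<close> carries the complements, of infinite measure because
    finitely many pieces of finite measure were removed. Later indices are empty, to obtain the
    sequences that \<open>iso_on_glue\<close> expects.\<close>
  define X where "X k = (if k \<le> n then Y k else if k = Suc n then Yr else {})" for k
  define V where "V k = (if k \<le> n then Z k else if k = Suc n then Zr else {})" for k
  have dX: "disjoint_family X"
    unfolding disjoint_family_on_def
  proof (intro ballI impI)
    fix k l :: nat assume "k \<noteq> l"
    then show "X k \<inter> X l = {}"
      using Yd[of k l] Yd[of l k] by (cases "k < l") (auto simp: X_def Yr_def)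
  qed
  have dV: "disjoint_family V"
    unfolding disjoint_family_on_def
  proof (intro ballI impI)
    fix k l :: nat assume "k \<noteq> l"
    then show "V k \<inter> V l = {}"
      using Zd[of k l] Zd[of l k] by (cases "k < l") (auto simp: V_def Zr_def)
  qed
  have "\<exists>f g. iso_on M (X k) N (V k) f g \<and> (k \<le> n \<longrightarrow> f = (\<lambda>x. (S ^^ k) (\<phi> ((T' ^^ k) x))))" for k
  proof (cases "k \<le> n")
    case True
    then show ?thesis
      using iso[of k] by (auto simp: X_def V_def)
  next
    case False
    then show ?thesis
      using iso_on_exists[OF M N, of "X k" "V k"] r by (auto simp: X_def V_def)
  qed
  then obtain f g where fg: "\<And>k. iso_on M (X k) N (V k) (f k) (g k)"
      "\<And>k. k \<le> n \<Longrightarrow> f k = (\<lambda>x. (S ^^ k) (\<phi> ((T' ^^ k) x)))"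
    by metis
  obtain R R' where R: "iso_on M (\<Union>k. X k) N (\<Union>k. V k) R R'" "\<And>k x. x \<in> X k \<Longrightarrow> R x = f k x"
    using iso_on_glue[OF fg(1) dX dV] by blast
  have "(\<Union>k. X k) = space M"
  proof
    show "(\<Union>k. X k) \<subseteq> space M"
      using sets.sets_into_space[OF fmeasurableD[OF Ym]] by (auto simp: X_def Yr_def split: if_splits)
    show "space M \<subseteq> (\<Union>k. X k)"
    proof
      fix x assume x: "x \<in> space M"
      have "(\<exists>k\<le>n. x \<in> X k) \<or> x \<in> X (Suc n)"
        using x by (auto simp: X_def Yr_def)
      then show "x \<in> (\<Union>k. X k)" by blast
    qed
  qed
  moreover have "(\<Union>k. V k) = space N"
  proof
    show "(\<Union>k. V k) \<subseteq> space N"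
      by (auto simp: V_def Zr_def Z_def split: if_splits)
    show "space N \<subseteq> (\<Union>k. V k)"
    proof
      fix x assume x: "x \<in> space N"
      have "(\<exists>k\<le>n. x \<in> V k) \<or> x \<in> V (Suc n)"
        using x by (auto simp: V_def Zr_def)
      then show "x \<in> (\<Union>k. V k)" by blast
    qed
  qed
  ultimately have "iso_mod0 M N R R'"
    using R(1) by (simp add: iso_mod0_iff_iso_on)
  moreover have "R x = (S ^^ k) (\<phi> ((T' ^^ k) x))" if "k \<le> n" "x \<in> Y k" for k x
    using R(2)[of x k] fg(2)[of k] that by (simp add: X_def)
  ultimately show ?thesis by blast
qed

text \<open>The two conclusions serve different powers. Agreement with \<open>T\<close> off
  \<open>H\<close> loses a bit of measure at each step and so handles finitely many powers; the last
  bound holds for all \<open>m\<close> at once. It is one-sided because it is meant for powers where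
  both overlaps are small.\<close>

lemma approximate_conjugacy:
  fixes T :: "'a \<Rightarrow> 'a" and S :: "'b \<Rightarrow> 'b"
  assumes M: "iso_mod0 M (lebesgue :: real measure) f0 g0"
    and N: "iso_mod0 N (lebesgue :: real measure) f1 g1"
    and T: "bij_automorphism M T T'" and S: "bij_automorphism N S S'"
    and mixT: "\<And>A B. A \<in> fmeasurable M \<Longrightarrow> B \<in> fmeasurable M \<Longrightarrow>
      (\<lambda>n. measure M (A \<inter> (T ^^ n) -` B)) \<longlonglongrightarrow> 0"
    and mixS: "\<And>A B. A \<in> fmeasurable N \<Longrightarrow> B \<in> fmeasurable N \<Longrightarrow>
      (\<lambda>n. measure N (A \<inter> (S ^^ n) -` B)) \<longlonglongrightarrow> 0"
    and small: "\<And>\<eta>. \<eta> > 0 \<Longrightarrow> \<exists>E\<in>fmeasurable N. 0 < measure N E \<and> measure N E < \<eta> \<and>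
      (\<forall>m\<ge>1. measure N (E \<inter> (S ^^ m) -` E) \<le> \<eta> * measure N E)"
    and W: "W \<in> fmeasurable M" and \<eta>: "\<eta> > 0"
  shows "\<exists>R R' H. iso_mod0 M N R R' \<and> H \<in> fmeasurable M \<and> measure M H \<le> \<eta> \<and>
    (AE x in M. x \<in> W - H \<longrightarrow> R' (S (R x)) = T x) \<and>
    (\<forall>m\<ge>1. \<forall>B\<in>fmeasurable M. B \<subseteq> W \<longrightarrow>
      measure M (B \<inter> (\<lambda>x. R' ((S ^^ m) (R x))) -` B) \<le> measure M (B \<inter> (T ^^ m) -` B) + \<eta>)"
proof -
  note cancelS = bij_automorphism_cancel[OF S] and cancelT = bij_automorphism_cancel[OF T]
  have iT: "iso_mod0 M M (T ^^ n) (T' ^^ n)" for n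
    using T by (auto simp: bij_automorphism_def intro: iso_mod0_funpow)
  have iS: "iso_mod0 N N (S ^^ n) (S' ^^ n)" for n
    using S by (auto simp: bij_automorphism_def intro: iso_mod0_funpow)
  have T1: "iso_mod0 M M T T'" "\<And>x. T' (T x) = x"
    using T by (auto simp: bij_automorphism_def)
  have "\<forall>\<^sub>F n in sequentially. measure M (W \<inter> (T ^^ n) -` W) < \<eta> / 4"
    using \<eta> by (intro order_tendstoD(2)[OF mixT[OF W W]]) simp
  then obtain n where n: "measure M (W \<inter> (T ^^ n) -` W) < \<eta> / 4"
    unfolding eventually_sequentially by blast
  \<comment> \<open>The points of \<open>W\<close> that are in \<open>W\<close> again
    \<open>n\<close> steps back: few by mixing, and every other point of \<open>W\<close> lies on a
    step below \<open>n\<close>.\<close>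
  define H where "H = W \<inter> (T' ^^ n) -` W"
  have H: "H \<in> fmeasurable M"
    unfolding H_def by (rule fmeasurable_Int_vimage[OF iso_mod0D(2)[OF iT] W fmeasurableD[OF W]])
  have "space M \<inter> (T ^^ n) -` H = W \<inter> (T ^^ n) -` W"
    using sets.sets_into_space[OF fmeasurableD[OF W]] by (auto simp: H_def cancelT)
  then have Hn: "measure M H < \<eta> / 4"
    using n iso_mod0_fmeasurable(2)[OF iT H, of n] by simp
  define F where "F = W \<inter> T' -` (space M - W)"
  define Y where "Y k = {x \<in> space M. (T' ^^ k) x \<in> F \<and> (\<forall>i\<in>{1..k}. (T' ^^ i) x \<in> W)}" for k
  have F: "F \<in> fmeasurable M"
    unfolding F_def using W by (intro fmeasurable_Int_vimage[OF iso_mod0D(2)[OF T1(1)]]) auto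
  have cover: "\<exists>k<n. x \<in> Y k" if x: "x \<in> W" "x \<notin> H" for x
  proof -
    have xs: "x \<in> space M"
      using x(1) sets.sets_into_space[OF fmeasurableD[OF W]] by auto
    define i where "i = (LEAST i. (T' ^^ i) x \<notin> W)"
    have ex: "(T' ^^ n) x \<notin> W"
      using x by (simp add: H_def)
    have i: "(T' ^^ i) x \<notin> W" "i \<le> n"
      unfolding i_def using ex by (rule LeastI, rule Least_le)
    have lt: "(T' ^^ j) x \<in> W" if "j < i" for j
      using not_less_Least[OF that[unfolded i_def]] by blast
    obtain k where k: "i = Suc k"
      using i(1) x(1) by (cases i) auto
    have "(T' ^^ k) x \<in> F"
      using i(1) lt[of k] measurable_space[OF iso_mod0D(2)[OF iT] xs, of "Suc k"]
      by (simp add: F_def k)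
    moreover have "\<forall>j\<in>{1..k}. (T' ^^ j) x \<in> W"
      using lt k by auto
    ultimately show ?thesis
      using xs i(2) k by (intro exI[of _ k]) (auto simp: Y_def)
  qed
  \<comment> \<open>This includes the case that \<open>T x\<close> has left \<open>W\<close>. As
    \<open>cover\<close> yields \<open>k < n\<close>, the step \<open>Suc k\<close> is still in the
    range where \<open>R\<close> is prescribed.\<close>
  have step: "T x \<in> Y (Suc k)" if "x \<in> W" "x \<in> Y k" for x k
  proof -
    have p: "(T' ^^ Suc j) (T x) = (T' ^^ j) x" for j
      by (simp add: funpow_Suc_right T1(2) del: funpow.simps)
    have "(T' ^^ j) (T x) \<in> W" if "j \<in> {1..Suc k}" for j
    proof (cases j)
      case (Suc l)
      have "(T' ^^ l) x \<in> W"
        using \<open>x \<in> W\<close> \<open>x \<in> Y k\<close> that Suc by (cases "l = 0") (auto simp: Y_def)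
      then show ?thesis
        using p[of l] Suc by simp
    qed (use that in auto)
    then show ?thesis
      using \<open>x \<in> Y k\<close> p[of k] measurable_space[OF iso_mod0D(1)[OF T1(1)]] by (auto simp: Y_def)
  qed
  \<comment> \<open>Half of \<open>\<eta>\<close> is shared by the at most \<open>n\<^sup>2\<close>
    pairs of steps; the other half goes to \<open>H\<close> and its preimage under \<open>V\<close>,
    each below \<open>\<eta> / 4\<close>.\<close>
  define \<eta>' where "\<eta>' = \<eta> / (2 * (real n + 1)\<^sup>2)"
  have \<eta>': "\<eta>' > 0" "(real n)\<^sup>2 * \<eta>' \<le> \<eta> / 2"
  proof -
    show "\<eta>' > 0" using \<eta> by (simp add: \<eta>'_def)
    have "(real n)\<^sup>2 * \<eta>' \<le> (real n + 1)\<^sup>2 * \<eta>'"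
      using \<open>\<eta>' > 0\<close> by (intro mult_right_mono power_mono) auto
    also have "\<dots> = \<eta> / 2"
      by (simp add: \<eta>'_def)
    finally show "(real n)\<^sup>2 * \<eta>' \<le> \<eta> / 2" .
  qed
  obtain G where G: "G \<in> sets N" "emeasure N G = ennreal (measure M F)"
      "\<And>m. m \<ge> 1 \<Longrightarrow> measure N (G \<inter> (S ^^ m) -` G) \<le> \<eta>'"
      "\<And>m. 1 \<le> m \<Longrightarrow> m \<le> n \<Longrightarrow> G \<inter> (S ^^ m) -` G = {}"
    using exists_set_small_returns[OF N S mixS small measure_nonneg \<eta>'(1), of M F n] by blast
  have Gf: "G \<in> fmeasurable N"
    using G(1,2) by (intro fmeasurableI) auto
  have "emeasure M F = emeasure N G"
    using G(2) emeasure_eq_measure2[OF F] by simp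
  then obtain \<phi> \<phi>' where \<phi>: "iso_on M F N G \<phi> \<phi>'"
    using iso_on_exists[OF M N fmeasurableD[OF F] G(1)] by blast
  obtain R R' where R0: "iso_mod0 M N R R'"
      and R1: "\<forall>k\<le>n. \<forall>x\<in>Y k. R x = (S ^^ k) (\<phi> ((T' ^^ k) x))"
    using conjugation_on_excursions[OF M N T S W F_def Y_def Gf G(4) \<phi>] by blast
  have R: "iso_mod0 M N R R'"
      "\<And>k x. k \<le> n \<Longrightarrow> x \<in> Y k \<Longrightarrow> R x = (S ^^ k) (\<phi> ((T' ^^ k) x))"
    using R0 R1 by simp_all
  have "AE x in M. x \<in> W - H \<longrightarrow> R' (S (R x)) = T x"
    using AE_iso_mod0[OF T1(1) iso_mod0D(3)[OF R(1)]]
  proof eventually_elim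
    case (elim x)
    show ?case
    proof
      assume x: "x \<in> W - H"
      then obtain k where k: "k < n" "x \<in> Y k"
        using cover by blast
      have "R (T x) = (S ^^ Suc k) (\<phi> ((T' ^^ Suc k) (T x)))"
        using R(2)[OF _ step] k x by auto
      also have "(T' ^^ Suc k) (T x) = (T' ^^ k) x"
        by (simp add: funpow_Suc_right T1(2) del: funpow.simps)
      also have "(S ^^ Suc k) (\<phi> ((T' ^^ k) x)) = S (R x)"
        using R(2)[of k x] k by simp
      finally show "R' (S (R x)) = T x"
        using elim by simp
    qed
  qed
  moreover have "measure M (B \<inter> (\<lambda>x. R' ((S ^^ m) (R x))) -` B) \<le> measure M (B \<inter> (T ^^ m) -` B) + \<eta>"
    if m: "m \<ge> 1" and B: "B \<in> fmeasurable M" "B \<subseteq> W" for m B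
  proof -
    define V where "V = (\<lambda>x. R' ((S ^^ m) (R x)))"
    have RS: "iso_mod0 M N (\<lambda>x. (S ^^ m) (R x)) (\<lambda>z. R' ((S' ^^ m) z))"
      using iso_mod0_trans[OF R(1) iS] .
    obtain V' where V: "iso_mod0 M M V V'"
      using iso_mod0_trans[OF RS iso_mod0_sym[OF R(1)]] unfolding V_def by blast
    \<comment> \<open>\<open>C (k, l)\<close> consists of the points of the \<open>k\<close>-th
      image of \<open>G\<close> that the \<open>m\<close>-th power moves into the
      \<open>l\<close>-th image. \<open>K\<close> omits the pairs with \<open>l = m + k\<close>,
      where this happens for every point.\<close>
    define C where "C = (\<lambda>(k, l). {z \<in> space N. (S' ^^ k) z \<in> G \<and> (S' ^^ l) ((S ^^ m) z) \<in> G})"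
    define K where "K = {(k, l). k < n \<and> l < n \<and> l \<noteq> m + k}"
    have Ksub: "K \<subseteq> {..<n} \<times> {..<n}"
      by (auto simp: K_def)
    then have K: "finite K" "card K \<le> n\<^sup>2"
      using finite_subset card_mono[OF _ Ksub] by (auto simp: power2_eq_square)
    have C: "space M \<inter> R -` C p \<in> fmeasurable M" "measure M (space M \<inter> R -` C p) \<le> \<eta>'" if pK: "p \<in> K" for p
    proof -
      obtain k l where p: "p = (k, l)" "l \<noteq> m + k"
        using pK by (auto simp: K_def)
      note o = overlap_shift[OF S Gf G(3) p(2)]
      show "space M \<inter> R -` C p \<in> fmeasurable M"
        using iso_mod0_fmeasurable(1)[OF R(1) o(1)] by (simp only: C_def p prod.case)
      show "measure M (space M \<inter> R -` C p) \<le> \<eta>'"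
        using iso_mod0_fmeasurable(2)[OF R(1) o(1)] o(2) by (simp only: C_def p prod.case)
    qed
    define U where "U = (\<Union>p\<in>K. space M \<inter> R -` C p)"
    have U: "U \<in> fmeasurable M"
      unfolding U_def using K C(1) by (intro fmeasurable.finite_UN)
    have "measure M U \<le> (\<Sum>p\<in>K. measure M (space M \<inter> R -` C p))"
      unfolding U_def using K(1) fmeasurableD[OF C(1)] by (intro measure_UNION_le)
    also have "\<dots> \<le> (\<Sum>p\<in>K. \<eta>')"
      using C(2) by (intro sum_mono)
    also have "\<dots> \<le> (real n)\<^sup>2 * \<eta>'"
      using K(2) \<eta>'(1) by (simp flip: of_nat_power)
    finally have mU: "measure M U \<le> \<eta> / 2"
      using \<eta>'(2) by linarith
    have VB: "B \<inter> V -` B \<in> fmeasurable M" and TB: "B \<inter> (T ^^ m) -` B \<in> fmeasurable M"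
      using fmeasurable_Int_vimage[OF _ B(1) fmeasurableD[OF B(1)]] iso_mod0D(1)[OF V]
        iso_mod0D(1)[OF iT] by auto
    note VH = iso_mod0_fmeasurable[OF V H]
    \<comment> \<open>\<open>\<phi>\<close> and \<open>\<phi>'\<close> are inverse only almost
      everywhere; for a good point no backward iterate in \<open>F\<close> is an exception.\<close>
    define good where "good x \<longleftrightarrow> (\<forall>k. (T' ^^ k) x \<in> F \<longrightarrow>
      \<phi> ((T' ^^ k) x) \<in> G \<and> \<phi>' (\<phi> ((T' ^^ k) x)) = (T' ^^ k) x)" for x
    have good: "AE x in M. good x"
      unfolding good_def AE_all_countable
      using AE_iso_mod0[OF iso_mod0_sym[OF iT] iso_onD(6)[OF \<phi>]] by blast
    have "AE x in M. x \<in> B \<inter> V -` B \<longrightarrow> x \<in> B \<inter> (T ^^ m) -` B \<union> (H \<union> (space M \<inter> V -` H) \<union> U)"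
      using good AE_iso_mod0[OF V good] AE_iso_mod0[OF RS iso_mod0D(4)[OF R(1)]] AE_space
    proof eventually_elim
      case (elim x)
      show ?case
      proof (intro impI, rule ccontr)
        assume x: "x \<in> B \<inter> V -` B"
          and "x \<notin> B \<inter> (T ^^ m) -` B \<union> (H \<union> (space M \<inter> V -` H) \<union> U)"
        then have nT: "V x \<noteq> (T ^^ m) x" and nH: "x \<notin> H" "V x \<notin> H" and nU: "x \<notin> U"
          using elim(4) by auto
        obtain k l where k: "k < n" "x \<in> Y k" and l: "l < n" "V x \<in> Y l"
          using cover[OF _ nH(1)] cover[OF _ nH(2)] x B(2) by blast
        have RV: "R (V x) = (S ^^ m) (R x)"
          using elim(3) by (simp add: V_def)
        have Rx: "R x = (S ^^ k) (\<phi> ((T' ^^ k) x))"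
          using R(2)[of k x] k by simp
        have RVx: "R (V x) = (S ^^ l) (\<phi> ((T' ^^ l) (V x)))"
          using R(2)[of l "V x"] l by simp
        have g: "\<phi> ((T' ^^ k) x) \<in> G" "\<phi>' (\<phi> ((T' ^^ k) x)) = (T' ^^ k) x"
          using elim(1) k(2) unfolding good_def Y_def by blast+
        have g': "\<phi> ((T' ^^ l) (V x)) \<in> G" "\<phi>' (\<phi> ((T' ^^ l) (V x))) = (T' ^^ l) (V x)"
          using elim(2) l(2) unfolding good_def Y_def by blast+
        \<comment> \<open>Equal times: cancelling the \<open>l\<close>-th power and
          \<open>\<phi>\<close> shows that \<open>x\<close> and \<open>V x\<close> start their
          excursions at the same point, so \<open>V x\<close> is the image of \<open>x\<close> under
          the \<open>m\<close>-th power of \<open>T\<close>. Unequal times: \<open>R x\<close> lies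
          in one of the sets \<open>C (k, l)\<close>.\<close>
        show False
        proof (cases "l = m + k")
          case True
          have "(S ^^ l) (\<phi> ((T' ^^ l) (V x))) = (S ^^ l) (\<phi> ((T' ^^ k) x))"
            using RV Rx RVx by (simp add: True funpow_add)
          then have "\<phi> ((T' ^^ l) (V x)) = \<phi> ((T' ^^ k) x)"
            by (simp add: cancelS(3))
          then have "(T' ^^ l) (V x) = (T' ^^ k) x"
            using g(2) g'(2) by simp
          then have "V x = (T ^^ l) ((T' ^^ k) x)"
            using cancelT(2) by metis
          also have "\<dots> = (T ^^ m) x"
            by (simp add: True funpow_add cancelT(2))
          finally show False
            using nT by blast
        next
          case False
          have "R x \<in> C (k, l)"
            using g(1) g'(1) measurable_space[OF iso_mod0D(1)[OF R(1)] elim(4)]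
            by (simp add: C_def Rx cancelS(1) flip: RV[unfolded Rx])
              (simp add: RVx cancelS(1))
          then have "x \<in> U"
            using k l False elim(4) unfolding U_def K_def by blast
          then show False
            using nU by blast
        qed
      qed
    qed
    then have "measure M (B \<inter> V -` B) \<le> measure M (B \<inter> (T ^^ m) -` B \<union> (H \<union> (space M \<inter> V -` H) \<union> U))"
      using VB TB H VH U by (intro measure_mono_AE fmeasurable.Un) (auto dest: fmeasurableD)
    also have "\<dots> \<le> measure M (B \<inter> (T ^^ m) -` B) + measure M (H \<union> (space M \<inter> V -` H) \<union> U)"
      using TB H VH U by (intro measure_Un_le sets.Un) (auto dest: fmeasurableD)
    also have "measure M (H \<union> (space M \<inter> V -` H) \<union> U) \<le> measure M (H \<union> (space M \<inter> V -` H)) + measure M U"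
      using H VH U by (intro measure_Un_le sets.Un) (auto dest: fmeasurableD)
    also have "measure M (H \<union> (space M \<inter> V -` H)) \<le> measure M H + measure M (space M \<inter> V -` H)"
      using H VH by (intro measure_Un_le) (auto dest: fmeasurableD)
    finally show ?thesis
      using Hn mU VH(2) unfolding V_def by linarith
  qed
  ultimately show ?thesis
    using R(1) H Hn \<eta> by (intro exI[of _ R] exI[of _ R'] exI[of _ H]) auto
qed


subsection \<open>Bases of a Sidon construction\<close>

lemma measure_UN_fmeasurable:
  assumes "finite I" "disjoint_family_on A I" "\<And>i. i \<in> I \<Longrightarrow> A i \<in> fmeasurable M"
  shows "measure M (\<Union>i\<in>I. A i) = (\<Sum>i\<in>I. measure M (A i))"
  using assms by (intro measure_finite_Union) (auto simp: fmeasurableD fmeasurableD2)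

lemma half_interval_lmeasurable:
  assumes "half_interval I"
  shows "I \<in> fmeasurable lebesgue" "measure lebesgue I > 0" "emeasure lebesgue I = ennreal (measure lebesgue I)"
proof -
  obtain a b where ab: "a < b" "I = {a..<b}"
    using assms by (auto simp: half_interval_def)
  show I: "I \<in> fmeasurable lebesgue"
    unfolding ab(2) using ab(1) by (intro fmeasurableI) simp_all
  show "measure lebesgue I > 0"
    using ab by simp
  show "emeasure lebesgue I = ennreal (measure lebesgue I)"
    using I by (rule emeasure_eq_measure2)
qed

context rank_one_construction
begin

lemma height_pos: "j \<ge> 1 \<Longrightarrow> h j > 0"
proof (induction j rule: dec_induct)
  case base
  then show ?case using h_first by simp
next
  case (step j)
  then have "h j * r j > 0"
    using r_pos by simp
  then show ?case
    using h_step[of j] step by simp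
qed

lemma level_translate:
  assumes "j \<ge> 1" "k < h j"
  shows "\<exists>c. \<forall>x\<in>E j. (S ^^ k) x = c + x"
  using assms(2)
proof (induction k)
  case 0
  then show ?case by (intro exI[of _ 0]) simp
next
  case (Suc k)
  then obtain c where c: "\<forall>x\<in>E j. (S ^^ k) x = c + x"
    by auto
  obtain d where "\<forall>x\<in>(S ^^ k) ` E j. S x = x + d"
    using level_translation[of j k] assms(1) Suc.prems by auto
  with c show ?case
    by (intro exI[of _ "c + d"]) auto
qed

lemma level_measure:
  assumes "j \<ge> 1" "k < h j" "A \<subseteq> E j" "A \<in> fmeasurable lebesgue"
  shows "(S ^^ k) ` A \<in> fmeasurable lebesgue"
    "measure lebesgue ((S ^^ k) ` A) = measure lebesgue A"
proof -
  obtain c where "\<forall>x\<in>E j. (S ^^ k) x = c + x"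
    using level_translate[OF assms(1,2)] by blast
  then have eq: "(S ^^ k) ` A = (\<lambda>x. c + x) ` A"
    using assms(3) by (intro image_cong) auto
  show "(S ^^ k) ` A \<in> fmeasurable lebesgue"
    unfolding eq using assms(4) by (rule measurable_translation)
  show "measure lebesgue ((S ^^ k) ` A) = measure lebesgue A"
    unfolding eq by (rule measure_translation)
qed

lemma piece_subset: "j \<ge> 1 \<Longrightarrow> i \<in> {1..r j} \<Longrightarrow> D j i \<subseteq> E j"
  using piece_union by blast

lemma base_fmeasurable: "j \<ge> 1 \<Longrightarrow> E j \<in> fmeasurable lebesgue"
  and piece_fmeasurable: "j \<ge> 1 \<Longrightarrow> i \<in> {1..r j} \<Longrightarrow> D j i \<in> fmeasurable lebesgue"
  using half_interval_lmeasurable(1) base piece by blast+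

lemma piece_measure:
  assumes "j \<ge> 1" "i \<in> {1..r j}"
  shows "measure lebesgue (D j i) = measure lebesgue (E j) / r j"
proof -
  have "measure lebesgue (E j) = (\<Sum>i'\<in>{1..r j}. measure lebesgue (D j i'))"
    unfolding piece_union[OF assms(1), symmetric]
    by (rule measure_UN_fmeasurable[OF _ piece_disjoint[OF assms(1)] piece_fmeasurable[OF assms(1)]]) simp
  also have "\<dots> = (\<Sum>i'\<in>{1..r j}. measure lebesgue (D j i))"
    using piece_length[OF assms(1) _ assms(2)] by (intro sum.cong) auto
  also have "\<dots> = r j * measure lebesgue (D j i)"
    by simp
  finally show ?thesis
    using r_pos[OF assms(1)] by simp
qed

text \<open>\<open>t\<close> is the total height of the columns before the \<open>i\<close>-th,
  spacers included. The slack \<open>h j\<close> records that the column above the piece also fits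
  below the top of the next tower.\<close>

lemma piece_level:
  assumes j: "j \<ge> 1" and i: "i \<in> {1..r j}"
  shows "\<exists>t. t + h j \<le> h (j + 1) \<and> D j i = (S ^^ t) ` E (j + 1)"
proof -
  define \<tau> where "\<tau> i = (\<Sum>i'=1..<i. h j + s j i')" for i
  have eq: "D j i = (S ^^ \<tau> i) ` E (j + 1)" if "1 \<le> i" "i \<le> r j" for i
    using that
  proof (induction i rule: dec_induct)
    case base
    then show ?case
      using next_base[OF j] by (simp add: \<tau>_def)
  next
    case (step n)
    then have "D j (n + 1) = (S ^^ (h j + s j n)) ` D j n"
      using next_column[OF j, of n] by simp
    also have "\<dots> = (S ^^ (h j + s j n)) ` (S ^^ \<tau> n) ` E (j + 1)"
      using step by simp
    also have "\<dots> = (S ^^ (h j + s j n + \<tau> n)) ` E (j + 1)"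
      unfolding funpow_add by (simp only: image_comp)
    also have "h j + s j n + \<tau> n = \<tau> (Suc n)"
      using step by (simp add: \<tau>_def)
    finally show ?case by simp
  qed
  have "\<tau> i + h j \<le> (\<Sum>i'=1..<Suc i. h j + s j i')"
    using i by (simp add: \<tau>_def)
  also have "\<dots> \<le> (\<Sum>i'=1..r j. h j + s j i')"
    using i by (intro sum_mono2) auto
  also have "\<dots> = h (j + 1)"
    unfolding h_step[OF j] by (simp add: sum.distrib)
  finally show ?thesis
    using eq[of i] i by auto
qed

text \<open>Iterated cutting. Keeping the slack \<open>h j\<close> makes every level of tower
  \<open>j\<close>, and not only its base, a union of levels of tower \<open>l\<close>.\<close>

lemma base_levels:
  assumes "1 \<le> j" "j \<le> l"
  shows "\<exists>I. (\<forall>t\<in>I. t + h j \<le> h l) \<and> E j = (\<Union>t\<in>I. (S ^^ t) ` E l)"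
  using assms(2)
proof (induction l rule: dec_induct)
  case base
  show ?case by (intro exI[of _ "{0}"]) simp
next
  case (step l)
  then obtain I where I: "\<And>t. t \<in> I \<Longrightarrow> t + h j \<le> h l" "E j = (\<Union>t\<in>I. (S ^^ t) ` E l)"
    by blast
  have l: "l \<ge> 1"
    using assms step by simp
  have "\<forall>i\<in>{1..r l}. \<exists>t. t + h l \<le> h (l + 1) \<and> D l i = (S ^^ t) ` E (l + 1)"
    using piece_level[OF l] by blast
  then obtain \<tau> where \<tau>: "\<And>i. i \<in> {1..r l} \<Longrightarrow> \<tau> i + h l \<le> h (l + 1)"
      "\<And>i. i \<in> {1..r l} \<Longrightarrow> D l i = (S ^^ \<tau> i) ` E (l + 1)"
    by metis
  have "E l = (\<Union>i\<in>{1..r l}. (S ^^ \<tau> i) ` E (l + 1))"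
    using piece_union[OF l] \<tau>(2) by auto
  then have "E j = (\<Union>t\<in>I. \<Union>i\<in>{1..r l}. (S ^^ (t + \<tau> i)) ` E (l + 1))"
    unfolding I(2) by (simp add: image_UN funpow_add image_comp)
  also have "\<dots> = (\<Union>u\<in>(\<lambda>(t, i). t + \<tau> i) ` (I \<times> {1..r l}). (S ^^ u) ` E (l + 1))"
    by auto
  finally have "E j = (\<Union>u\<in>(\<lambda>(t, i). t + \<tau> i) ` (I \<times> {1..r l}). (S ^^ u) ` E (l + 1))" .
  moreover have "u + h j \<le> h (l + 1)" if "u \<in> (\<lambda>(t, i). t + \<tau> i) ` (I \<times> {1..r l})" for u
    using that I(1) \<tau>(1) by fastforce
  ultimately show ?case
    by (intro exI[of _ "(\<lambda>(t, i). t + \<tau> i) ` (I \<times> {1..r l})"]) auto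
qed

text \<open>A level of tower \<open>l\<close> meets a column in the image of one piece, a fraction
  \<open>1 / r l\<close> of the level. The fraction is the same for unions of such levels, in
  particular for a level of an earlier tower.\<close>

lemma level_Int_column:
  assumes j: "1 \<le> j" "j \<le> l" and k: "k < h j" and i: "i \<in> {1..r l}"
  shows "(S ^^ k) ` E j \<subseteq> tower h E S l"
    and "(S ^^ k) ` E j \<inter> column h D S l i \<in> fmeasurable lebesgue"
    and "measure lebesgue ((S ^^ k) ` E j \<inter> column h D S l i) \<le> measure lebesgue (E j) / r l"
proof -
  obtain I where I: "\<And>t. t \<in> I \<Longrightarrow> t + h j \<le> h l" "E j = (\<Union>t\<in>I. (S ^^ t) ` E l)"
    using base_levels[OF j] by blast
  define J where "J = (\<lambda>t. k + t) ` I"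
  have J: "u < h l" if "u \<in> J" for u
    using that I(1) k by (fastforce simp: J_def)
  have fJ: "finite J"
    using J by (intro finite_subset[of J "{..<h l}"]) auto
  have l: "l \<ge> 1"
    using j by simp
  have L: "(S ^^ k) ` E j = (\<Union>u\<in>J. (S ^^ u) ` E l)"
    unfolding I(2) J_def by (simp add: image_UN funpow_add image_comp)
  then show "(S ^^ k) ` E j \<subseteq> tower h E S l"
    using J unfolding tower_def by (simp only: L) blast
  have Em: "(S ^^ u) ` E l \<in> fmeasurable lebesgue" "measure lebesgue ((S ^^ u) ` E l) = measure lebesgue (E l)"
    if "u < h l" for u
    using level_measure[OF l that order_refl base_fmeasurable[OF l]] by auto
  have Dm: "(S ^^ u) ` D l i \<in> fmeasurable lebesgue"
    "measure lebesgue ((S ^^ u) ` D l i) = measure lebesgue (E l) / r l" if "u < h l" for u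
    using level_measure[OF l that piece_subset[OF l i] piece_fmeasurable[OF l i]]
      piece_measure[OF l i] by auto
  have colm: "column h D S l i \<in> fmeasurable lebesgue"
    unfolding column_def using Dm(1) by (intro fmeasurable.finite_UN) auto
  have disj: "(S ^^ u) ` E l \<inter> (S ^^ v) ` E l = {}" if "u < h l" "v < h l" "u \<noteq> v" for u v
    using level_disjoint[OF l] that by (auto simp: disjoint_family_on_def)
  show m: "(S ^^ k) ` E j \<inter> column h D S l i \<in> fmeasurable lebesgue"
    using level_measure(1)[OF j(1) k order_refl base_fmeasurable[OF j(1)]] colm
    by (intro fmeasurable.Int)
  have "(S ^^ k) ` E j \<inter> column h D S l i \<subseteq> (\<Union>u\<in>J. (S ^^ u) ` D l i)"
  proof
    fix x assume "x \<in> (S ^^ k) ` E j \<inter> column h D S l i"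
    then obtain u v where u: "u \<in> J" "x \<in> (S ^^ u) ` E l" and v: "v < h l" "x \<in> (S ^^ v) ` D l i"
      unfolding L column_def by blast
    have "x \<in> (S ^^ v) ` E l"
      using v(2) piece_subset[OF l i] by blast
    then have "u = v"
      using disj[OF J[OF u(1)] v(1)] u(2) by blast
    then show "x \<in> (\<Union>u\<in>J. (S ^^ u) ` D l i)"
      using u v by blast
  qed
  then have "measure lebesgue ((S ^^ k) ` E j \<inter> column h D S l i) \<le> measure lebesgue (\<Union>u\<in>J. (S ^^ u) ` D l i)"
    using m Dm(1) J fJ by (intro measure_mono_fmeasurable fmeasurable.finite_UN) (auto dest: fmeasurableD)
  also have "\<dots> \<le> (\<Sum>u\<in>J. measure lebesgue ((S ^^ u) ` D l i))"
    using fJ Dm(1) J by (intro measure_UNION_le) (auto dest: fmeasurableD)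
  also have "\<dots> = card J * measure lebesgue (E l) / r l"
    using Dm(2) J by simp
  also have "card J * measure lebesgue (E l) = (\<Sum>u\<in>J. measure lebesgue ((S ^^ u) ` E l))"
    using Em(2) J by simp
  also have "\<dots> = measure lebesgue (\<Union>u\<in>J. (S ^^ u) ` E l)"
  proof (rule measure_UN_fmeasurable[symmetric, OF fJ])
    show "disjoint_family_on (\<lambda>u. (S ^^ u) ` E l) J"
      using disj J by (auto simp: disjoint_family_on_def)
    show "(S ^^ u) ` E l \<in> fmeasurable lebesgue" if "u \<in> J" for u
      by (rule Em(1)[OF J[OF that]])
  qed
  also have "\<dots> = measure lebesgue (E j)"
    unfolding L[symmetric] by (rule level_measure(2)[OF j(1) k order_refl base_fmeasurable[OF j(1)]])
  finally show "measure lebesgue ((S ^^ k) ` E j \<inter> column h D S l i) \<le> measure lebesgue (E j) / r l" .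
qed

lemma height_Suc_ge:
  assumes "1 \<le> j"
  shows "r j * h j \<le> h (Suc j)"
  using h_step[OF assms] by (simp add: mult.commute)

lemma exists_stage_cuts_ge: "\<exists>j0\<ge>1. \<forall>j\<ge>j0. r j \<ge> C"
proof -
  have "\<forall>\<^sub>F j in sequentially. r j \<ge> C \<and> j \<ge> 1"
    using r_at_top unfolding filterlim_at_top by (intro eventually_conj eventually_ge_at_top) auto
  then obtain j0 where "\<forall>j\<ge>j0. r j \<ge> C \<and> j \<ge> 1"
    unfolding eventually_sequentially by blast
  then show ?thesis
    by (intro exI[of _ j0]) auto
qed

lemma height_ge_power:
  assumes j0: "j0 \<ge> 1" "\<forall>j\<ge>j0. r j \<ge> 2"
  shows "2 ^ n \<le> h (j0 + n)"
proof (induction n)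
  case 0
  then show ?case using height_pos[OF j0(1)] by simp
next
  case (Suc n)
  have "2 * 2 ^ n \<le> r (j0 + n) * h (j0 + n)"
    using Suc j0(2) by (intro mult_mono) auto
  also have "\<dots> \<le> h (j0 + Suc n)"
    using height_Suc_ge[of "j0 + n"] j0(1) by simp
  finally show ?case by simp
qed

lemma base_measure_le_power:
  assumes j0: "j0 \<ge> 1" "\<forall>j\<ge>j0. r j \<ge> 2"
  shows "measure lebesgue (E (j0 + n)) \<le> measure lebesgue (E j0) * (1/2) ^ n"
proof (induction n)
  case 0
  then show ?case by simp
next
  case (Suc n)
  have j: "j0 + n \<ge> 1" "r (j0 + n) \<ge> 2"
    using j0 by auto
  have "measure lebesgue (E (j0 + Suc n)) = measure lebesgue (E (j0 + n)) / r (j0 + n)"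
    using next_base[OF j(1)] piece_measure[OF j(1), of 1] j(2) by simp
  also have "\<dots> \<le> measure lebesgue (E (j0 + n)) / 2"
    using j(2) by (intro divide_left_mono) auto
  finally show ?case
    using Suc by simp
qed

lemma sets_tower: "j \<ge> 1 \<Longrightarrow> tower h E S j \<in> sets lebesgue"
  unfolding tower_def
  using level_measure(1)[OF _ _ order_refl base_fmeasurable] by (auto dest: fmeasurableD)

lemma space_construction: "space (construction_space h E S) = (\<Union>j\<in>{1..}. tower h E S j)"
  by (simp add: construction_space_def space_restrict_space)

lemma space_construction_sets: "(\<Union>j\<in>{1..}. tower h E S j) \<inter> space lebesgue \<in> sets lebesgue"
  using sets_tower by (intro sets.Int sets.countable_UN') auto

lemma construction_space_measure:
  assumes "A \<in> fmeasurable lebesgue" "A \<subseteq> tower h E S j" "j \<ge> 1"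
  shows "A \<in> fmeasurable (construction_space h E S)"
    "measure (construction_space h E S) A = measure lebesgue A"
proof -
  have sub: "A \<subseteq> (\<Union>j\<in>{1..}. tower h E S j)"
    using assms(2,3) by blast
  show "measure (construction_space h E S) A = measure lebesgue A"
    unfolding construction_space_def by (rule measure_restrict_space[OF space_construction_sets sub])
  show "A \<in> fmeasurable (construction_space h E S)"
  proof (rule fmeasurableI)
    show "A \<in> sets (construction_space h E S)"
      unfolding construction_space_def sets_restrict_space_iff[OF space_construction_sets]
      using sub fmeasurableD[OF assms(1)] by blast
    show "emeasure (construction_space h E S) A < \<infinity>"
      unfolding construction_space_def emeasure_restrict_space[OF space_construction_sets sub]
        infinity_ennreal_def top.not_eq_extremum[symmetric]
      by (rule fmeasurableD2[OF assms(1)])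
  qed
qed

end

text \<open>The set is the base of a late stage \<open>j\<close>. Before time \<open>h j\<close> it
  cannot return, by disjointness of levels. For \<open>m\<close> above \<open>h l\<close> and up to
  \<open>h (l + 1)\<close>, the returning points land in a single column of tower \<open>l\<close>,
  hence in a fraction \<open>1 / r l\<close> of the base.\<close>

lemma sidon_small_returns:
  assumes sidon: "sidon_construction h r s E D S"
    and aut: "iso_mod0 (construction_space h E S) (construction_space h E S) S S'"
    and \<eta>: "\<eta> > 0"
  shows "\<exists>X\<in>fmeasurable (construction_space h E S).
    0 < measure (construction_space h E S) X \<and> measure (construction_space h E S) X < \<eta> \<and>
    (\<forall>m\<ge>1. measure (construction_space h E S) (X \<inter> (S ^^ m) -` X) \<le>
      \<eta> * measure (construction_space h E S) X)"
proof -
  interpret rank_one_construction h r s E D S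
    using sidon by (simp add: sidon_construction_def)
  define N where "N = construction_space h E S"
  have iS: "iso_mod0 N N (S ^^ m) (S' ^^ m)" for m
    unfolding N_def by (rule iso_mod0_funpow[OF aut])
  note Sm = iso_mod0D(1)[OF iS]
  have aeN: "AE x in N. P x" if "AE x in lebesgue. P x" for P
    unfolding N_def construction_space_def AE_restrict_space_iff[OF space_construction_sets]
    using that by eventually_elim simp
  \<comment> \<open>The 2 makes heights grow and bases shrink geometrically; the other entry yields
    \<open>1 / r l \<le> \<eta>\<close>.\<close>
  obtain j0 where j0: "j0 \<ge> 1" "\<And>j. j \<ge> j0 \<Longrightarrow> r j \<ge> max 2 (nat \<lceil>1 / \<eta>\<rceil>)"
    using exists_stage_cuts_ge by blast
  have r2: "\<forall>j\<ge>j0. r j \<ge> 2"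
    using j0(2) by auto
  have "(\<lambda>n. measure lebesgue (E j0) * (1/2) ^ n) \<longlonglongrightarrow> measure lebesgue (E j0) * 0"
    by (intro tendsto_intros) auto
  then have "\<forall>\<^sub>F n in sequentially. measure lebesgue (E j0) * (1/2) ^ n < \<eta>"
    using \<eta> by (intro order_tendstoD(2)) auto
  then obtain n where n: "measure lebesgue (E j0) * (1/2) ^ n < \<eta>" "n \<ge> 1"
    using eventually_conj[OF _ eventually_ge_at_top[of 1]] eventually_happens[of _ sequentially] by force
  define j where "j = j0 + n"
  have j: "j \<ge> 1" "j \<ge> j0"
    using j0 by (auto simp: j_def)
  \<comment> \<open>Guarantees that level 1 of the tower exists, for use at the shift
    \<open>m = h j\<close>.\<close>
  have h2: "h j \<ge> 2"
    using height_ge_power[OF j0(1) r2, of n] self_le_power[of "2::nat" n] n(2) by (simp add: j_def)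
  have rl: "1 / r l \<le> \<eta>" if "l \<ge> j" for l
  proof -
    have "1 / \<eta> \<le> r l"
      using j0(2)[of l] that j by linarith
    moreover have "r l > 0"
      using r_pos[of l] that j by simp
    ultimately show ?thesis
      using \<eta> by (simp add: field_simps)
  qed
  have sub: "(S ^^ k) ` E j \<subseteq> tower h E S j" "(S ^^ k) ` E j \<in> fmeasurable lebesgue" if "k < h j" for k
    using level_Int_column(1)[OF j(1) order_refl that, of 1] r_pos[OF j(1)]
      level_measure(1)[OF j(1) that order_refl base_fmeasurable[OF j(1)]] by auto
  have E0: "E j = (S ^^ 0) ` E j" by simp
  have Esub: "E j \<subseteq> tower h E S j" "E j \<in> fmeasurable lebesgue"
    using sub[of 0] h2 by auto
  note EN = construction_space_measure[OF Esub(2,1) j(1), folded N_def]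
  \<comment> \<open>Used with \<open>k = 0\<close> for \<open>m > h j\<close>, and with
    \<open>k = 1\<close> at time \<open>h j + 1\<close> to cover the shift
    \<open>h j\<close>.\<close>
  have small: "measure N (E j \<inter> (S ^^ m) -` ((S ^^ k) ` E j)) \<le> \<eta> * measure N (E j)"
    if l: "l \<ge> j" and m: "h l < m" "m \<le> h (l + 1)" and k: "k < h j" for l m k
  proof -
    have l1: "l \<ge> 1" using l j by simp
    obtain i where i: "i \<in> {1..r l}"
      and ae: "AE x in lebesgue. x \<in> tower h E S l \<inter> (S ^^ m) ` tower h E S l \<longrightarrow> x \<in> column h D S l i"
      using sidon l1 m unfolding sidon_construction_def by blast
    define Z where "Z = (S ^^ k) ` E j \<inter> column h D S l i"
    have t: "(S ^^ k) ` E j \<subseteq> tower h E S l" "E j \<subseteq> tower h E S l"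
      using level_Int_column(1)[OF j(1) l k i] level_Int_column(1)[OF j(1) l _ i, of 0] h2 by auto
    have Z: "Z \<in> fmeasurable lebesgue" "measure lebesgue Z \<le> measure lebesgue (E j) / r l" "Z \<subseteq> tower h E S l"
      using level_Int_column(2,3)[OF j(1) l k i] t unfolding Z_def by auto
    note ZN = construction_space_measure[OF Z(1,3) l1, folded N_def]
    note pZ = iso_mod0_fmeasurable[OF iS ZN(1), of m]
    have kN: "(S ^^ k) ` E j \<in> fmeasurable N"
      using construction_space_measure(1)[OF sub(2,1)[OF k] j(1)] by (simp add: N_def)
    have "measure N (E j \<inter> (S ^^ m) -` ((S ^^ k) ` E j)) \<le> measure N (space N \<inter> (S ^^ m) -` Z)"
    proof (rule measure_mono_AE)
      \<comment> \<open>The Sidon condition speaks of the point of arrival, so it is transported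
        along the measure-preserving \<open>m\<close>-th power to the point of departure.\<close>
      show "AE x in N. x \<in> E j \<inter> (S ^^ m) -` ((S ^^ k) ` E j) \<longrightarrow> x \<in> space N \<inter> (S ^^ m) -` Z"
        using AE_iso_mod0[OF iS aeN[OF ae], of m] AE_space
        by eventually_elim (use t in \<open>auto simp: Z_def\<close>)
      show "E j \<inter> (S ^^ m) -` ((S ^^ k) ` E j) \<in> sets N"
        using Int_vimage_sets[OF Sm fmeasurableD[OF EN(1)] fmeasurableD[OF kN]] .
    qed (rule pZ)
    also have "\<dots> \<le> measure lebesgue (E j) / r l"
      using pZ(2) ZN(2) Z(2) by simp
    also have "\<dots> = 1 / r l * measure N (E j)"
      using EN(2) by simp
    also have "\<dots> \<le> \<eta> * measure N (E j)"
      using rl[OF l] by (intro mult_right_mono) auto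
    finally show ?thesis .
  qed
  have "measure N (E j \<inter> (S ^^ m) -` E j) \<le> \<eta> * measure N (E j)" if m: "m \<ge> 1" for m
  proof -
    consider "m < h j" | "m = h j" | "m > h j" by linarith
    then show ?thesis
    proof cases
      case 1
      have "(S ^^ 0) ` E j \<inter> (S ^^ m) ` E j = {}"
        using disjoint_family_onD[OF level_disjoint[OF j(1)], of 0 m] 1 m by simp
      then have "E j \<inter> (S ^^ m) -` E j = {}"
        by auto
      then show ?thesis
        using \<eta> by simp
    next
      case 2
      txt \<open>The Sidon condition starts at \<open>h j + 1\<close>, so pass to the next level of the tower.\<close>
      have s1: "E j \<inter> (S ^^ m) -` E j \<subseteq> E j \<inter> (S ^^ (h j + 1)) -` ((S ^^ 1) ` E j)"
        using 2 by auto
      have s2: "(S ^^ 1) ` E j \<in> fmeasurable N"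
        using construction_space_measure(1)[OF sub(2,1) j(1), of 1] h2 by (simp add: N_def)
      have "measure N (E j \<inter> (S ^^ m) -` E j) \<le>
          measure N (E j \<inter> (S ^^ (h j + 1)) -` ((S ^^ 1) ` E j))"
        using s1 Int_vimage_sets[OF Sm fmeasurableD[OF EN(1)] fmeasurableD[OF EN(1)]]
          fmeasurable_Int_vimage[OF Sm EN(1) fmeasurableD[OF s2]]
        by (rule measure_mono_fmeasurable)
      also have "\<dots> \<le> \<eta> * measure N (E j)"
      proof (rule small[OF order_refl])
        have "2 * h j \<le> r j * h j"
          using r2 j by (intro mult_right_mono) auto
        also have "\<dots> \<le> h (j + 1)"
          using height_Suc_ge[OF j(1)] by simp
        finally show "h j + 1 \<le> h (j + 1)"
          using h2 by linarith
      qed (use h2 in auto)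
      finally show ?thesis .
    next
      case 3
      \<comment> \<open>The first stage after \<open>j\<close> whose height reaches
        \<open>m\<close>; the stage before it is the \<open>l\<close> with \<open>h l < m\<close>
        and \<open>m \<le> h (l + 1)\<close>.\<close>
      define p where "p = (LEAST p. m \<le> h (j + p))"
      have "m \<le> h (j0 + m)"
        using height_ge_power[OF j0(1) r2, of m] less_exp[of m] by linarith
      moreover have "2 ^ m \<le> h (j + m)"
        using height_ge_power[of j m] j r2 by simp
      ultimately have ex: "m \<le> h (j + m)"
        using less_exp[of m] by linarith
      have p: "m \<le> h (j + p)"
        unfolding p_def using ex by (rule LeastI)
      then obtain q where q: "p = Suc q"
        using 3 by (cases p) auto
      have "\<not> m \<le> h (j + q)"
        using not_less_Least[of q "\<lambda>p. m \<le> h (j + p)"] q unfolding p_def by simp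
      then show ?thesis
        using small[of "j + q" m 0] p q h2 by simp
    qed
  qed
  moreover have "measure N (E j) < \<eta>"
    using base_measure_le_power[OF j0(1) r2, of n] n(1) EN(2) by (simp add: j_def)
  moreover have "measure N (E j) > 0"
    using half_interval_lmeasurable(2)[OF base[OF j(1)]] EN(2) by simp
  ultimately show ?thesis
    using EN(1) unfolding N_def by blast
qed

text \<open>Infinite measure comes from mixing: were the measure finite, the overlap of the whole
  space with its preimages would be constant and tend to 0, although \<open>E 1\<close> has positive
  measure. The space is then matched with the line as a Lebesgue set of infinite measure.\<close>

lemma construction_space_iso_lebesgue:
  assumes R: "rank_one_construction h r s E D S" and mix: "S \<in> Mix (construction_space h E S)"
  shows "\<exists>f g. iso_mod0 (construction_space h E S) (lebesgue :: real measure) f g"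
proof -
  interpret rank_one_construction h r s E D S by fact
  define N where "N = construction_space h E S"
  define \<Omega> where "\<Omega> = (\<Union>j\<in>{1..}. tower h E S j)"
  have aut: "automorphism N S" and mixing: "mixing N S"
    using mix by (auto simp: Mix_def N_def)
  have \<Omega>: "\<Omega> \<in> sets lebesgue"
    using space_construction_sets by (simp add: \<Omega>_def)
  have sp: "space N = \<Omega>"
    unfolding N_def \<Omega>_def by (rule space_construction)
  have emeasure: "emeasure N A = emeasure lebesgue A" if "A \<subseteq> \<Omega>" for A
    using that unfolding N_def construction_space_def \<Omega>_def
    by (rule emeasure_restrict_space[OF space_construction_sets])
  have E1: "E 1 \<subseteq> tower h E S 1"
    using level_Int_column(1)[of 1 1 0 1] height_pos[of 1] r_pos[of 1] by auto
  note E1N = construction_space_measure[OF base_fmeasurable E1, folded N_def]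
  have "emeasure N (space N) = \<infinity>"
  proof (rule ccontr)
    assume "emeasure N (space N) \<noteq> \<infinity>"
    then have fin: "space N \<in> fmeasurable N"
      by (intro fmeasurableI) (auto simp: top.not_eq_extremum)
    have "(\<lambda>n. measure N (space N \<inter> (S ^^ n) -` space N)) \<longlonglongrightarrow> 0"
      using mixing fin mixing_iff[OF aut] by blast
    moreover have "space N \<inter> (S ^^ n) -` space N = space N" for n
      using measurable_space[OF iso_mod0D(1)[OF inverse_mod0[OF automorphism_funpow[OF aut]]]] by auto
    ultimately have "measure N (space N) = 0"
      using LIMSEQ_unique tendsto_const by fastforce
    moreover have "measure N (E 1) \<le> measure N (space N)"
      using E1N(1) fin sets.sets_into_space[OF fmeasurableD] by (intro measure_mono_fmeasurable) auto
    ultimately show False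
      using half_interval_lmeasurable(2)[OF base[of 1]] E1N(2) by simp
  qed
  then have inf: "emeasure lebesgue \<Omega> = emeasure lebesgue UNIV"
    using emeasure[of \<Omega>] sp by simp
  obtain f g where fg: "iso_on lebesgue \<Omega> (lebesgue :: real measure) UNIV f g"
    using iso_on_lebesgue[OF \<Omega> _ inf] by auto
  note i = iso_onD[OF fg]
  obtain \<omega> where \<omega>: "\<omega> \<in> \<Omega>"
    using \<open>emeasure N (space N) = \<infinity>\<close> sp by fastforce
  \<comment> \<open>\<open>g\<close> may leave the subspace on a null set; a measurable map into
    \<open>N\<close> must take all its values in \<open>space N\<close>, hence the default value
    \<open>\<omega>\<close>.\<close>
  define g' where "g' = (\<lambda>y. if g y \<in> \<Omega> then g y else \<omega>)"
  have Nsets: "A \<in> sets N \<longleftrightarrow> A \<subseteq> \<Omega> \<and> A \<in> sets lebesgue" for A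
    unfolding N_def construction_space_def \<Omega>_def
    using sets_restrict_space_iff[OF space_construction_sets] by auto
  have aeN: "AE x in N. P x" if "AE x in lebesgue. x \<in> \<Omega> \<longrightarrow> P x" for P
    unfolding N_def construction_space_def AE_restrict_space_iff[OF space_construction_sets]
    using that unfolding \<Omega>_def .
  have "iso_on N \<Omega> lebesgue UNIV f g'"
  proof (rule iso_onI)
    show "\<Omega> \<in> sets N" using \<Omega> by (simp add: Nsets)
    show "f \<in> measurable N lebesgue"
      unfolding N_def construction_space_def by (intro measurable_restrict_space1 i(3))
    show "g' \<in> measurable lebesgue N"
    proof (rule measurableI)
      show "g' y \<in> space N" for y
        using \<omega> by (simp add: g'_def sp)
      fix A assume A: "A \<in> sets N"
      have "g' -` A \<inter> space lebesgue = (g -` A) \<union> (if \<omega> \<in> A then - (g -` \<Omega>) else {})"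
        using A by (auto simp: g'_def Nsets split: if_splits)
      moreover have "g -` B \<in> sets lebesgue" if "B \<in> sets lebesgue" for B
        using measurable_sets[OF i(4) that] by simp
      ultimately show "g' -` A \<inter> space lebesgue \<in> sets lebesgue"
        using A \<Omega> sets_lebesgue_Compl by (auto simp: Nsets)
    qed
    show "AE x in N. x \<in> \<Omega> \<longrightarrow> g' (f x) = x"
      by (rule aeN) (use i(6) in \<open>eventually_elim, auto simp: g'_def\<close>)
    show "AE y in lebesgue. y \<in> UNIV \<longrightarrow> g' y \<in> \<Omega> \<and> f (g' y) = y"
      using i(7) by eventually_elim (auto simp: g'_def)
    show "emeasure N (\<Omega> \<inter> f -` B) = emeasure lebesgue (UNIV \<inter> B)" if "B \<in> sets lebesgue" for B
      using i(5)[OF that] emeasure[of "\<Omega> \<inter> f -` B"] by simp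
  qed simp
  then show ?thesis
    using sp iso_mod0_iff_iso_on[of N lebesgue f g'] unfolding N_def by auto
qed


subsection \<open>Estimates for the metric\<close>

lemma has_sum_Times_nonneg:
  fixes f :: "'a \<Rightarrow> real" and g :: "'b \<Rightarrow> real"
  assumes f: "(f has_sum a) A" "\<And>x. x \<in> A \<Longrightarrow> 0 \<le> f x"
    and g: "(g has_sum b) B" "\<And>y. y \<in> B \<Longrightarrow> 0 \<le> g y"
  shows "((\<lambda>(x, y). f x * g y) has_sum (a * b)) (A \<times> B)"
proof (rule has_sum_SigmaI)
  show inner: "((\<lambda>y. case (x, y) of (x, y) \<Rightarrow> f x * g y) has_sum (f x * b)) B" for x
    using has_sum_cmult_right[OF g(1), of "f x"] by simp
  show outer: "((\<lambda>x. f x * b) has_sum (a * b)) A"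
    by (rule has_sum_cmult_left[OF f(1)])
  show "(\<lambda>(x, y). f x * g y) summable_on A \<times> B"
    by (rule summable_on_SigmaI[OF inner has_sum_imp_summable[OF outer]]) (use f g in auto)
qed

lemma infsum_le_has_sum:
  fixes f g :: "'a \<Rightarrow> real"
  assumes "(g has_sum b) A" "\<And>x. x \<in> A \<Longrightarrow> 0 \<le> f x" "\<And>x. x \<in> A \<Longrightarrow> f x \<le> g x"
  shows "infsum f A \<le> b"
proof -
  have "f summable_on A"
    by (rule summable_on_comparison_test[OF has_sum_imp_summable[OF assms(1)]]) (use assms in auto)
  then show ?thesis
    using has_sum_mono[OF has_sum_infsum assms(1)] assms(3) by blast
qed

lemma measure_sym_diff:
  assumes "A \<in> fmeasurable M" "B \<in> fmeasurable M"
  shows "measure M (sym_diff A B) = measure M A + measure M B - 2 * measure M (A \<inter> B)"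
proof -
  have d: "measure M (X - Y) = measure M X - measure M (X \<inter> Y)"
    if "X \<in> fmeasurable M" "Y \<in> fmeasurable M" for X Y
  proof -
    have "measure M (X - X \<inter> Y) = measure M X - measure M (X \<inter> Y)"
      using that by (intro measurable_measure_Diff) (auto dest: fmeasurableD)
    moreover have "X - X \<inter> Y = X - Y" by blast
    ultimately show ?thesis by simp
  qed
  have "measure M (sym_diff A B) = measure M (A - B) + measure M (B - A) - measure M ((A - B) \<inter> (B - A))"
    using assms by (intro measure_Un3 fmeasurable.Diff)
  also have "(A - B) \<inter> (B - A) = {}" by blast
  finally show ?thesis
    using d[OF assms] d[OF assms(2,1)] by (simp add: Int_commute)
qed

text \<open>Both series are cut at \<open>K\<close>; the weights of the leading terms sum to at most
  1. In the tail of \<open>metric_rho\<close> each of two symmetric differences is at most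
  \<open>2 * measure M (A i)\<close>, which gives \<open>4 * \<tau>\<close>. In
  \<open>metric_dw\<close> each overlap is at most the measure of either set, which gives
  \<open>\<tau>\<close> for each of the two indices.\<close>

lemma metric_r_le:
  assumes dense: "dense_sequence M A" and U: "automorphism M U" and T: "automorphism M T"
    and tail: "((\<lambda>i. if i > K then (1/2) ^ i * measure M (A i) else 0) has_sum \<tau>) {1..}"
    and im: "\<And>i. i \<ge> 1 \<Longrightarrow> i \<le> K \<Longrightarrow>
      measure M (sym_diff (image_mod0 M U (A i)) (image_mod0 M T (A i))) \<le> \<beta>"
    and pre: "\<And>i. i \<ge> 1 \<Longrightarrow> i \<le> K \<Longrightarrow>
      measure M (sym_diff (U -` A i \<inter> space M) (T -` A i \<inter> space M)) \<le> \<beta>"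
    and powers: "\<And>n i j. n \<ge> 1 \<Longrightarrow> i \<ge> 1 \<Longrightarrow> i \<le> K \<Longrightarrow> j \<ge> 1 \<Longrightarrow> j \<le> K \<Longrightarrow>
      \<bar>measure M (A i \<inter> (U ^^ n) -` A j) - measure M (A i \<inter> (T ^^ n) -` A j)\<bar> \<le> \<gamma>"
    and nonneg: "\<beta> \<ge> 0" "\<gamma> \<ge> 0"
  shows "metric_r M A U T \<le> 2 * \<beta> + \<gamma> + 6 * \<tau>"
proof -
  have Af: "A i \<in> fmeasurable M" if "i \<ge> 1" for i
    using dense that by (auto simp: dense_sequence_def intro!: fmeasurableI)
  have geo: "((\<lambda>i. (1/2::real) ^ i) has_sum 1) {1..}"
    using has_sum_geometric_from_1[of "1/2::real"] by simp
  define a' where "a' i = (if i > K then (1/2) ^ i * measure M (A i) else 0)" for i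
  have a': "(a' has_sum \<tau>) {1..}" "\<And>i. a' i \<ge> 0"
    using tail by (auto simp: a'_def[abs_def])
  have sd: "measure M (sym_diff X Y) \<le> 2 * c"
    if "X \<in> fmeasurable M" "Y \<in> fmeasurable M" "measure M X = c" "measure M Y = c" for X Y c
    using measure_sym_diff[OF that(1,2)] that by simp
  have fim: "image_mod0 M V (A i) \<in> fmeasurable M" "measure M (image_mod0 M V (A i)) = measure M (A i)"
    "V -` A i \<inter> space M \<in> fmeasurable M" "measure M (V -` A i \<inter> space M) = measure M (A i)"
    if V: "automorphism M V" and i: "i \<ge> 1" for V i
  proof -
    note iV = inverse_mod0[OF V]
    show "image_mod0 M V (A i) \<in> fmeasurable M" "measure M (image_mod0 M V (A i)) = measure M (A i)"
      using iso_mod0_fmeasurable[OF iso_mod0_sym[OF iV] Af[OF i]]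
      by (simp_all add: image_mod0_def Int_commute)
    show "V -` A i \<inter> space M \<in> fmeasurable M" "measure M (V -` A i \<inter> space M) = measure M (A i)"
      using iso_mod0_fmeasurable[OF iV Af[OF i]] by (simp_all add: Int_commute)
  qed
  have "metric_rho M A U T \<le> 2 * \<beta> + 4 * \<tau>"
    unfolding metric_rho_def
  proof (rule infsum_le_has_sum)
    have "((\<lambda>i. (2 * \<beta>) * (1/2) ^ i + 4 * a' i) has_sum ((2 * \<beta>) * 1 + 4 * \<tau>)) {1..}"
      by (intro has_sum_add has_sum_cmult_right geo a')
    then show "((\<lambda>i. (2 * \<beta>) * (1/2) ^ i + 4 * a' i) has_sum (2 * \<beta> + 4 * \<tau>)) {1..}"
      by simp
    fix i :: nat assume "i \<in> {1..}"
    then have i: "i \<ge> 1" by simp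
    show "0 \<le> (1 / 2) ^ i * (measure M (sym_diff (image_mod0 M U (A i)) (image_mod0 M T (A i))) +
        measure M (sym_diff (U -` A i \<inter> space M) (T -` A i \<inter> space M)))"
      by simp
    have "measure M (sym_diff (image_mod0 M U (A i)) (image_mod0 M T (A i))) +
        measure M (sym_diff (U -` A i \<inter> space M) (T -` A i \<inter> space M)) \<le>
        2 * \<beta> + (if i > K then 4 * measure M (A i) else 0)"
      using im[OF i] pre[OF i] nonneg sd[OF fim(1)[OF U i] fim(1)[OF T i] fim(2)[OF U i] fim(2)[OF T i]]
        sd[OF fim(3)[OF U i] fim(3)[OF T i] fim(4)[OF U i] fim(4)[OF T i]]
      by (cases "i > K") auto
    then have "(1 / 2) ^ i * (measure M (sym_diff (image_mod0 M U (A i)) (image_mod0 M T (A i))) +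
        measure M (sym_diff (U -` A i \<inter> space M) (T -` A i \<inter> space M))) \<le>
        (1 / 2) ^ i * (2 * \<beta> + (if i > K then 4 * measure M (A i) else 0))"
      by (intro mult_left_mono) auto
    also have "\<dots> = (2 * \<beta>) * (1/2) ^ i + 4 * a' i"
      by (simp add: a'_def algebra_simps)
    finally show "(1 / 2) ^ i * (measure M (sym_diff (image_mod0 M U (A i)) (image_mod0 M T (A i))) +
        measure M (sym_diff (U -` A i \<inter> space M) (T -` A i \<inter> space M))) \<le>
        (2 * \<beta>) * (1/2) ^ i + 4 * a' i" .
  qed
  moreover have "metric_dw M A (U ^^ n) (T ^^ n) \<le> \<gamma> + 2 * \<tau>" if n: "n \<ge> 1" for n
    unfolding metric_dw_def
  proof (rule infsum_le_has_sum)
    have "((\<lambda>p. \<gamma> * (case p of (i, j) \<Rightarrow> (1/2) ^ i * (1/2) ^ j) +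
        ((case p of (i, j) \<Rightarrow> a' i * (1/2) ^ j) + (case p of (i, j) \<Rightarrow> (1/2) ^ i * a' j)))
        has_sum (\<gamma> * (1 * 1) + (\<tau> * 1 + 1 * \<tau>))) ({1..} \<times> {1..})"
      using a'(2) by (intro has_sum_add has_sum_cmult_right has_sum_Times_nonneg geo a'(1)) auto
    moreover have "\<gamma> * (1 * 1) + (\<tau> * 1 + 1 * \<tau>) = \<gamma> + 2 * \<tau>"
      by simp
    ultimately show "((\<lambda>p. \<gamma> * (case p of (i, j) \<Rightarrow> (1/2) ^ i * (1/2) ^ j) +
        ((case p of (i, j) \<Rightarrow> a' i * (1/2) ^ j) + (case p of (i, j) \<Rightarrow> (1/2) ^ i * a' j)))
        has_sum (\<gamma> + 2 * \<tau>)) ({1..} \<times> {1..})"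
      by (simp only:)
    fix p :: "nat \<times> nat" assume "p \<in> {1..} \<times> {1..}"
    then obtain i j where p: "p = (i, j)" "i \<ge> 1" "j \<ge> 1" by auto
    define d where "d = \<bar>measure M (image_mod0 M (U ^^ n) (A i) \<inter> A j) -
      measure M (image_mod0 M (T ^^ n) (A i) \<inter> A j)\<bar>"
    show "0 \<le> (case p of (i, j) \<Rightarrow> (1 / 2) ^ (i + j) *
      \<bar>measure M (image_mod0 M (U ^^ n) (A i) \<inter> A j) - measure M (image_mod0 M (T ^^ n) (A i) \<inter> A j)\<bar>)"
      by (simp add: p)
    have le: "measure M (image_mod0 M (V ^^ n) (A i) \<inter> A j) \<le> measure M (A i)"
      "measure M (image_mod0 M (V ^^ n) (A i) \<inter> A j) \<le> measure M (A j)" if V: "automorphism M V" for V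
    proof -
      note f = fim[OF automorphism_funpow[OF V] p(2), of n]
      have m: "image_mod0 M (V ^^ n) (A i) \<inter> A j \<in> sets M"
        using f(1) Af[OF p(3)] by (auto dest: fmeasurableD)
      show "measure M (image_mod0 M (V ^^ n) (A i) \<inter> A j) \<le> measure M (A i)"
        using measure_mono_fmeasurable[OF _ m f(1)] f(2) by simp
      show "measure M (image_mod0 M (V ^^ n) (A i) \<inter> A j) \<le> measure M (A j)"
        using measure_mono_fmeasurable[OF _ m Af[OF p(3)]] by simp
    qed
    have "d \<le> measure M (A i)" "d \<le> measure M (A j)"
      using le[OF U] le[OF T] unfolding d_def by (auto simp: abs_le_iff intro: order_trans[OF diff_left_mono[of 0]])
    moreover have "d \<le> \<gamma>" if "i \<le> K" "j \<le> K"
      using powers[OF n p(2) that(1) p(3) that(2)] fmeasurableD[OF Af] p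
      unfolding d_def by (simp add: measure_image_mod0_Int automorphism_funpow U T)
    ultimately have "d \<le> \<gamma> + (if i > K then measure M (A i) else 0) + (if j > K then measure M (A j) else 0)"
      using nonneg(2) measure_nonneg[of M "A i"] measure_nonneg[of M "A j"]
      by (cases "i > K"; cases "j > K") (simp_all del: measure_nonneg)
    then have "(1/2) ^ (i + j) * d \<le> (1/2) ^ (i + j) *
      (\<gamma> + (if i > K then measure M (A i) else 0) + (if j > K then measure M (A j) else 0))"
      by (intro mult_left_mono) auto
    also have "\<dots> = \<gamma> * ((1/2) ^ i * (1/2) ^ j) + (a' i * (1/2) ^ j + (1/2) ^ i * a' j)"
      by (cases "i > K"; cases "j > K") (simp_all add: a'_def power_add distrib_left distrib_right mult_ac)
    finally show "(case p of (i, j) \<Rightarrow> (1 / 2) ^ (i + j) *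
      \<bar>measure M (image_mod0 M (U ^^ n) (A i) \<inter> A j) - measure M (image_mod0 M (T ^^ n) (A i) \<inter> A j)\<bar>)
      \<le> \<gamma> * (case p of (i, j) \<Rightarrow> (1/2) ^ i * (1/2) ^ j) +
        ((case p of (i, j) \<Rightarrow> a' i * (1/2) ^ j) + (case p of (i, j) \<Rightarrow> (1/2) ^ i * a' j))"
      unfolding p prod.case d_def .
  qed
  then have "(SUP n\<in>{0<..}. metric_dw M A (U ^^ n) (T ^^ n)) \<le> \<gamma> + 2 * \<tau>"
    by (intro cSUP_least) auto
  ultimately show ?thesis
    unfolding metric_r_def by linarith
qed

text \<open>Both images have the measure of \<open>A\<close>, so it is enough that their
  intersection loses at most \<open>measure M H\<close>, and \<open>U\<close> sends points of
  \<open>A\<close> off \<open>H\<close> into the image under \<open>T\<close>. Each image loses this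
  once, hence the factor 2.\<close>

lemma sym_diff_image_mod0_le:
  assumes U: "automorphism M U" and T: "automorphism M T" and A: "A \<in> fmeasurable M" and H: "H \<in> fmeasurable M"
    and eq: "AE x in M. x \<in> A \<longrightarrow> x \<notin> H \<longrightarrow> U x = T x"
  shows "measure M (sym_diff (image_mod0 M U A) (image_mod0 M T A)) \<le> 2 * measure M H"
proof -
  note iU = inverse_mod0[OF U] and iT = inverse_mod0[OF T]
  note fU = iso_mod0_fmeasurable[OF iso_mod0_sym[OF iU] A]
    and fT = iso_mod0_fmeasurable[OF iso_mod0_sym[OF iT] A]
  have im: "image_mod0 M V A = space M \<inter> inverse_mod0 M V -` A" for V
    by (auto simp: image_mod0_def)
  have m: "A \<inter> U -` image_mod0 M T A \<in> fmeasurable M"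
    by (rule fmeasurable_Int_vimage[OF iso_mod0D(1)[OF iU] A image_mod0_sets[OF T fmeasurableD[OF A]]])
  have "measure M A \<le> measure M ((A \<inter> U -` image_mod0 M T A) \<union> H)"
  proof (rule measure_mono_AE)
    show "AE x in M. x \<in> A \<longrightarrow> x \<in> (A \<inter> U -` image_mod0 M T A) \<union> H"
      using eq iso_mod0D(3)[OF iT] AE_space
      by eventually_elim (use measurable_space[OF iso_mod0D(1)[OF iU]] in \<open>auto simp: im\<close>)
  qed (use A m H in \<open>auto dest: fmeasurableD\<close>)
  also have "\<dots> \<le> measure M (A \<inter> U -` image_mod0 M T A) + measure M H"
    using m H by (intro measure_Un_le) (auto dest: fmeasurableD)
  also have "measure M (A \<inter> U -` image_mod0 M T A) = measure M (image_mod0 M U A \<inter> image_mod0 M T A)"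
    using measure_image_mod0_Int[OF U fmeasurableD[OF A] image_mod0_sets[OF T fmeasurableD[OF A]]] by simp
  finally show ?thesis
    using measure_sym_diff[OF fU(1) fT(1)] fU(2) fT(2) by (simp add: im)
qed

text \<open>The same count, except that agreement is needed at the points which \<open>T\<close>
  sends into \<open>A\<close> rather than at the points of \<open>A\<close>.\<close>

lemma sym_diff_vimage_le:
  assumes U: "automorphism M U" and T: "automorphism M T" and A: "A \<in> fmeasurable M" and H: "H \<in> fmeasurable M"
    and eq: "AE x in M. T x \<in> A \<longrightarrow> x \<notin> H \<longrightarrow> U x = T x"
  shows "measure M (sym_diff (U -` A \<inter> space M) (T -` A \<inter> space M)) \<le> 2 * measure M H"
proof -
  note fU = iso_mod0_fmeasurable[OF inverse_mod0[OF U] A, unfolded Int_commute[of "space M"]]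
    and fT = iso_mod0_fmeasurable[OF inverse_mod0[OF T] A, unfolded Int_commute[of "space M"]]
  have m: "(U -` A \<inter> space M) \<inter> (T -` A \<inter> space M) \<in> fmeasurable M"
    using fU(1) fT(1) by (rule fmeasurable.Int)
  have "measure M (T -` A \<inter> space M) \<le> measure M (((U -` A \<inter> space M) \<inter> (T -` A \<inter> space M)) \<union> H)"
  proof (rule measure_mono_AE)
    show "AE x in M. x \<in> T -` A \<inter> space M \<longrightarrow> x \<in> ((U -` A \<inter> space M) \<inter> (T -` A \<inter> space M)) \<union> H"
      using eq by eventually_elim auto
  qed (use fT m H in \<open>auto dest: fmeasurableD\<close>)
  also have "\<dots> \<le> measure M ((U -` A \<inter> space M) \<inter> (T -` A \<inter> space M)) + measure M H"
    using m H by (intro measure_Un_le) (auto dest: fmeasurableD)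
  finally show ?thesis
    using measure_sym_diff[OF fU(1) fT(1)] fU(2) fT(2) by linarith
qed

text \<open>The factors \<open>R\<close> and \<open>R'\<close> inside a power cancel only almost
  everywhere. Mixing is inherited because \<open>R\<close> carries the overlaps over to those of the
  corresponding sets in \<open>N\<close>.\<close>

lemma conjugate_Mix:
  assumes R: "iso_mod0 M N R R'" and S: "S \<in> Mix N"
  shows "R' \<circ> S \<circ> R \<in> Mix M"
    and "AE x in M. ((R' \<circ> S \<circ> R) ^^ n) x = R' ((S ^^ n) (R x))"
proof -
  have aut: "automorphism N S" and mix: "mixing N S"
    using S by (auto simp: Mix_def)
  have iS: "iso_mod0 N N (S ^^ n) (inverse_mod0 N S ^^ n)" for n
    using iso_mod0_funpow[OF inverse_mod0[OF aut]] .
  note RS = iso_mod0_trans[OF R iS]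
  note RSR = iso_mod0_trans[OF RS iso_mod0_sym[OF R]]
  have U: "automorphism M (R' \<circ> S \<circ> R)"
    using RSR[of 1] unfolding automorphism_def by (auto simp: o_def)
  show pow: "AE x in M. ((R' \<circ> S \<circ> R) ^^ n) x = R' ((S ^^ n) (R x))" for n
  proof (induction n)
    case 0
    then show ?case
      using iso_mod0D(3)[OF R] by eventually_elim simp
  next
    case (Suc n)
    then show ?case
      using AE_iso_mod0[OF RS iso_mod0D(4)[OF R], of n] by eventually_elim simp
  qed
  have Um: "(R' \<circ> S \<circ> R) ^^ n \<in> measurable M M" for n
    using iso_mod0D(1)[OF inverse_mod0[OF automorphism_funpow[OF U]]] .
  have "(\<lambda>n. measure M (A \<inter> ((R' \<circ> S \<circ> R) ^^ n) -` B)) \<longlonglongrightarrow> 0"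
    if A: "A \<in> fmeasurable M" and B: "B \<in> fmeasurable M" for A B
  proof -
    define A' where "A' = space N \<inter> R' -` A"
    define B' where "B' = space N \<inter> R' -` B"
    have fm: "A' \<in> fmeasurable N" "B' \<in> fmeasurable N"
      unfolding A'_def B'_def using iso_mod0_fmeasurable[OF iso_mod0_sym[OF R]] A B by auto
    have "measure M (A \<inter> ((R' \<circ> S \<circ> R) ^^ n) -` B) = measure N (A' \<inter> (S ^^ n) -` B')" for n
    proof -
      have f: "A' \<inter> (S ^^ n) -` B' \<in> fmeasurable N"
        using fmeasurable_Int_vimage[OF iso_mod0D(1)[OF iS] fm(1) fmeasurableD[OF fm(2)]] .
      have "measure M (A \<inter> ((R' \<circ> S \<circ> R) ^^ n) -` B) = measure M (space M \<inter> R -` (A' \<inter> (S ^^ n) -` B'))"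
      proof (rule measure_eq_AE)
        show "AE x in M. (x \<in> A \<inter> ((R' \<circ> S \<circ> R) ^^ n) -` B) = (x \<in> space M \<inter> R -` (A' \<inter> (S ^^ n) -` B'))"
          using pow[of n] iso_mod0D(3)[OF R] AE_space
        proof eventually_elim
          case (elim x)
          have "R x \<in> space N" "(S ^^ n) (R x) \<in> space N"
            using measurable_space[OF iso_mod0D(1)[OF R]] measurable_space[OF iso_mod0D(1)[OF iS]] elim(3)
            by blast+
          then show ?case
            using elim by (simp add: A'_def B'_def)
        qed
        show "A \<inter> ((R' \<circ> S \<circ> R) ^^ n) -` B \<in> sets M"
          using Int_vimage_sets[OF Um fmeasurableD[OF A] fmeasurableD[OF B]] .
        show "space M \<inter> R -` (A' \<inter> (S ^^ n) -` B') \<in> sets M"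
          using iso_mod0_fmeasurable(1)[OF R f] by (rule fmeasurableD)
      qed
      then show ?thesis
        using iso_mod0_fmeasurable(2)[OF R f] by simp
    qed
    then show ?thesis
      using mix fm unfolding mixing_iff[OF aut] by simp
  qed
  then show "R' \<circ> S \<circ> R \<in> Mix M"
    using U by (simp add: Mix_def mixing_iff[OF U])
qed

subsection \<open>Density of the conjugacy class\<close>

theorem theorem1:
  fixes M :: "'a measure" and A :: "nat \<Rightarrow> 'a set" and T :: "'a \<Rightarrow> 'a"
    and h r :: "nat \<Rightarrow> nat" and s :: "nat \<Rightarrow> nat \<Rightarrow> nat"
    and E :: "nat \<Rightarrow> real set" and D :: "nat \<Rightarrow> nat \<Rightarrow> real set" and S :: "real \<Rightarrow> real"
    and \<epsilon> :: real
  assumes "\<exists>f g. iso_mod0 M (lebesgue :: real measure) f g"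
    and "dense_sequence M A"
    and "T \<in> Mix M"
    and "sidon_construction h r s E D S"
    and "S \<in> Mix (construction_space h E S)"
    and "\<epsilon> > 0"
  shows "\<exists>R R'. iso_mod0 M (construction_space h E S) R R' \<and>
           R' \<circ> S \<circ> R \<in> Mix M \<and> metric_r M A (R' \<circ> S \<circ> R) T < \<epsilon>"
proof -

  \<comment> \<open>Passage to bijective versions of the two transformations\<close>
  define N where "N = construction_space h E S"
  obtain f0 g0 where M: "iso_mod0 M (lebesgue :: real measure) f0 g0"
    using assms(1) by blast
  obtain f1 g1 where N: "iso_mod0 N (lebesgue :: real measure) f1 g1"
    using construction_space_iso_lebesgue[OF _ assms(5)] assms(4)
    unfolding sidon_construction_def N_def by blast
  have autT: "automorphism M T" and mixT: "mixing M T"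
    using assms(3) by (auto simp: Mix_def)
  have SN: "S \<in> Mix N"
    using assms(5) by (simp add: N_def)
  then have autS: "automorphism N S" and mixS: "mixing N S"
    by (auto simp: Mix_def)
  have Tm: "T ^^ n \<in> measurable M M" for n
    using iso_mod0D(1)[OF inverse_mod0[OF automorphism_funpow[OF autT]]] .
  have Sm: "S ^^ n \<in> measurable N N" for n
    using iso_mod0D(1)[OF inverse_mod0[OF automorphism_funpow[OF autS]]] .
  obtain T1 T1' where T1: "bij_automorphism M T1 T1'" "\<And>n. AE x in M. (T1 ^^ n) x = (T ^^ n) x"
    using bij_automorphism_exists[OF inverse_mod0[OF autT]] by blast
  obtain S1 S1' where S1: "bij_automorphism N S1 S1'" "\<And>n. AE x in N. (S1 ^^ n) x = (S ^^ n) x"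
    using bij_automorphism_exists[OF inverse_mod0[OF autS]] by blast
  have iT1: "iso_mod0 M M (T1 ^^ n) (T1' ^^ n)" for n
    using T1(1) by (auto simp: bij_automorphism_def intro: iso_mod0_funpow)
  have iS1: "iso_mod0 N N (S1 ^^ n) (S1' ^^ n)" for n
    using S1(1) by (auto simp: bij_automorphism_def intro: iso_mod0_funpow)
  have T1eq: "measure M (X \<inter> (T1 ^^ n) -` Y) = measure M (X \<inter> (T ^^ n) -` Y)"
    if "X \<in> fmeasurable M" "Y \<in> fmeasurable M" for X Y n
    using measure_Int_vimage_cong[OF T1(2) fmeasurableD[OF that(1)] fmeasurableD[OF that(2)]
      iso_mod0D(1)[OF iT1] Tm] .
  have S1eq: "measure N (X \<inter> (S1 ^^ n) -` Y) = measure N (X \<inter> (S ^^ n) -` Y)"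
    if "X \<in> fmeasurable N" "Y \<in> fmeasurable N" for X Y n
    using measure_Int_vimage_cong[OF S1(2) fmeasurableD[OF that(1)] fmeasurableD[OF that(2)]
      iso_mod0D(1)[OF iS1] Sm] .
  have mixT1: "(\<lambda>n. measure M (X \<inter> (T1 ^^ n) -` Y)) \<longlonglongrightarrow> 0"
    if "X \<in> fmeasurable M" "Y \<in> fmeasurable M" for X Y
    using mixT that unfolding mixing_iff[OF autT] T1eq[OF that] by blast
  have mixS1: "(\<lambda>n. measure N (X \<inter> (S1 ^^ n) -` Y)) \<longlonglongrightarrow> 0"
    if "X \<in> fmeasurable N" "Y \<in> fmeasurable N" for X Y
    using mixS that unfolding mixing_iff[OF autS] S1eq[OF that] by blast
  have small: "\<exists>X\<in>fmeasurable N. 0 < measure N X \<and> measure N X < \<eta> \<and>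
      (\<forall>m\<ge>1. measure N (X \<inter> (S1 ^^ m) -` X) \<le> \<eta> * measure N X)" if "\<eta> > 0" for \<eta>
    using sidon_small_returns[OF assms(4) inverse_mod0[OF autS, unfolded N_def] that] S1eq
    unfolding N_def by metis
  have Af: "A i \<in> fmeasurable M" if "i \<ge> 1" for i
    using assms(2) that by (auto simp: dense_sequence_def intro!: fmeasurableI)

  \<comment> \<open>Truncation of the series and choice of sets and constants\<close>
  define \<delta> where "\<delta> = \<epsilon> / 16"
  have \<delta>: "\<delta> > 0" using assms(6) by (simp add: \<delta>_def)
  define a where "a i = (1/2) ^ i * measure M (A i)" for i
  have a0: "a i \<ge> 0" for i by (simp add: a_def)
  have asum: "a summable_on {1..}"
    using assms(2) by (simp add: dense_sequence_def a_def[abs_def])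
  obtain F where F: "finite F" "F \<subseteq> {1..}" "dist (sum a F) (infsum a {1..}) \<le> \<delta>"
    using infsum_finite_approximation[OF asum \<delta>] by blast
  \<comment> \<open>The inserted 1 keeps \<open>Max\<close> meaningful for empty \<open>F\<close>.
    Enlarging \<open>F\<close> to an initial segment only improves the approximation, as the terms
    are nonnegative.\<close>
  define K where "K = Max (insert 1 F)"
  have FK: "F \<subseteq> {1..K}"
    using F(1,2) by (auto simp: K_def)
  define \<tau> where "\<tau> = infsum a {1..} - sum a {1..K}"
  have "((\<lambda>i. if i > K then a i else 0) has_sum \<tau>) {1..}"
  proof -
    have "(a has_sum \<tau>) ({1..} - {1..K})"
      unfolding \<tau>_def by (intro has_sum_Diff has_sum_infsum asum has_sum_finite) auto
    then show ?thesis
      by (subst has_sum_cong_neutral[where T = "{1..} - {1..K}" and g = a]) auto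
  qed
  then have tail: "((\<lambda>i. if i > K then (1/2) ^ i * measure M (A i) else 0) has_sum \<tau>) {1..}"
    unfolding a_def .
  have \<tau>: "\<tau> \<le> \<delta>"
    using sum_mono2[OF _ FK, of a] a0 F(3) unfolding \<tau>_def dist_real_def by (simp add: abs_le_iff)

  define B where "B = (\<Union>i\<in>{1..K}. A i)"
  have B: "B \<in> fmeasurable M"
    unfolding B_def using Af by (intro fmeasurable.finite_UN) auto
  have "\<forall>\<^sub>F n in sequentially. measure M (B \<inter> (T1 ^^ n) -` B) < \<delta>"
    by (rule order_tendstoD(2)[OF mixT1[OF B B] \<delta>])
  then obtain L where L: "\<And>n. n \<ge> L \<Longrightarrow> measure M (B \<inter> (T1 ^^ n) -` B) < \<delta>"
    unfolding eventually_sequentially by blast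
  \<comment> \<open>The forward images of \<open>B\<close> up to time \<open>L\<close> allow orbits
    starting in \<open>B\<close> to be followed that long. The preimage of \<open>B\<close> is there
    for the part of \<open>metric_rho\<close> that compares preimages.\<close>
  define W where "W = (space M \<inter> (T1 ^^ 1) -` B) \<union> (\<Union>t\<in>{..L}. space M \<inter> (T1' ^^ t) -` B)"
  have W: "W \<in> fmeasurable M"
    unfolding W_def using iso_mod0_fmeasurable(1)[OF iT1 B] iso_mod0_fmeasurable(1)[OF iso_mod0_sym[OF iT1] B]
    by (intro fmeasurable.Un fmeasurable.finite_UN) (simp_all del: funpow.simps One_nat_def)
  have BW: "B \<subseteq> W"
    using sets.sets_into_space[OF fmeasurableD[OF B]] unfolding W_def by fastforce
  \<comment> \<open>An orbit followed for \<open>L\<close> steps has \<open>L\<close> chances to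
    meet \<open>H\<close>, each of measure at most \<open>\<delta>'\<close>.\<close>
  define \<delta>' where "\<delta>' = \<delta> / (real L + 1)"
  have \<delta>': "\<delta>' > 0" "\<delta>' \<le> \<delta>" "real L * \<delta>' \<le> \<delta>"
    using \<delta> by (auto simp: \<delta>'_def field_simps)
  obtain R R' H where R: "iso_mod0 M N R R'" and H: "H \<in> fmeasurable M" "measure M H \<le> \<delta>'"
    and conj: "AE x in M. x \<in> W - H \<longrightarrow> R' (S1 (R x)) = T1 x"
    and far: "\<forall>m\<ge>1. \<forall>B\<in>fmeasurable M. B \<subseteq> W \<longrightarrow>
      measure M (B \<inter> (\<lambda>x. R' ((S1 ^^ m) (R x))) -` B) \<le> measure M (B \<inter> (T1 ^^ m) -` B) + \<delta>'"
    using approximate_conjugacy[OF M N T1(1) S1(1) mixT1 mixS1 small W \<delta>'(1)] by blast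
  define U where "U = R' \<circ> S \<circ> R"
  define V where "V n x = R' ((S1 ^^ n) (R x))" for n x
  have UM: "U \<in> Mix M"
    unfolding U_def by (rule conjugate_Mix(1)[OF R SN])
  then have autU: "automorphism M U" by (simp add: Mix_def)
  have Upow: "AE x in M. (U ^^ n) x = V n x" for n
    using conjugate_Mix(2)[OF R SN, of n] AE_iso_mod0[OF R S1(2), of n]
    unfolding U_def V_def by eventually_elim simp
  have Vm: "V n \<in> measurable M M" for n
    using iso_mod0D(1)[OF iso_mod0_trans[OF iso_mod0_trans[OF R iS1] iso_mod0_sym[OF R]], of n]
    unfolding V_def .
  have Ueq: "measure M (X \<inter> (U ^^ n) -` Y) = measure M (X \<inter> V n -` Y)"
    if "X \<in> fmeasurable M" "Y \<in> fmeasurable M" for X Y n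
    using measure_Int_vimage_cong[OF Upow fmeasurableD[OF that(1)] fmeasurableD[OF that(2)]
      iso_mod0D(1)[OF inverse_mod0[OF automorphism_funpow[OF autU]]] Vm] .
  have UT: "AE x in M. x \<in> W - H \<longrightarrow> U x = T x"
    using conj Upow[of 1] T1(2)[of 1] by eventually_elim (simp add: V_def)

  \<comment> \<open>Agreement of the powers up to time \<open>L\<close>\<close>
  define X where "X n = (\<Union>t\<in>{..<n}. space M \<inter> (T1 ^^ t) -` H)" for n
  have X: "X n \<in> fmeasurable M" for n
    unfolding X_def using iso_mod0_fmeasurable(1)[OF iT1 H(1)] by (intro fmeasurable.finite_UN) auto
  have mX: "measure M (X n) \<le> \<delta>" if "n \<le> L" for n
  proof -
    have "measure M (X n) \<le> (\<Sum>t\<in>{..<n}. measure M (space M \<inter> (T1 ^^ t) -` H))"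
      unfolding X_def using fmeasurableD[OF iso_mod0_fmeasurable(1)[OF iT1 H(1)]]
      by (intro measure_UNION_le) auto
    also have "\<dots> = real n * measure M H"
      using iso_mod0_fmeasurable(2)[OF iT1 H(1)] by simp
    also have "\<dots> \<le> real L * \<delta>'"
      using H(2) that by (intro mult_mono) auto
    finally show ?thesis using \<delta>'(3) by linarith
  qed
  \<comment> \<open>Off \<open>X n\<close> the orbit avoids \<open>H\<close> before time
    \<open>n\<close>, and it stays in \<open>W\<close> up to time \<open>L\<close> because it starts
    in \<open>B\<close>; so \<open>conj\<close> can be applied once per step.\<close>
  have near: "AE x in M. x \<in> B \<longrightarrow> x \<notin> X n \<longrightarrow> V n x = (T1 ^^ n) x" if "n \<le> L" for n
    using that
  proof (induction n)
    case 0
    then show ?case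
      using iso_mod0D(3)[OF R] by (auto simp: V_def)
  next
    case (Suc n)
    then have IH: "AE x in M. x \<in> B \<longrightarrow> x \<notin> X n \<longrightarrow> V n x = (T1 ^^ n) x" by simp
    show ?case
      using IH AE_iso_mod0[OF iT1 conj, of n] AE_iso_mod0[OF iso_mod0_trans[OF R iS1] iso_mod0D(4)[OF R], of n]
        AE_space
    proof eventually_elim
      case (elim x)
      show ?case
      proof (intro impI)
        assume x: "x \<in> B" "x \<notin> X (Suc n)"
        then have n1: "x \<notin> X n" "(T1 ^^ n) x \<notin> H"
          using elim(4) by (auto simp: X_def)
        have "(T1' ^^ n) ((T1 ^^ n) x) \<in> B"
          using x(1) by (simp add: bij_automorphism_cancel[OF T1(1)])
        then have "(T1 ^^ n) x \<in> W"
          using Suc.prems measurable_space[OF iso_mod0D(1)[OF iT1] elim(4), of n] unfolding W_def by auto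
        then have "R' (S1 (R ((T1 ^^ n) x))) = T1 ((T1 ^^ n) x)"
          using elim(2) n1(2) by blast
        moreover have "(T1 ^^ n) x = V n x"
          using elim(1) x(1) n1(1) by simp
        moreover have "R (V n x) = (S1 ^^ n) (R x)"
          using elim(3) by (simp add: V_def)
        ultimately show "V (Suc n) x = (T1 ^^ Suc n) x"
          by (simp add: V_def)
      qed
    qed
  qed

  \<comment> \<open>Estimate of the metric\<close>
  have "metric_r M A U T \<le> 2 * (2 * \<delta>) + 2 * \<delta> + 6 * \<tau>"
  proof (rule metric_r_le[OF assms(2) autU autT tail])
    fix i assume i: "i \<ge> 1" "i \<le> K"
    have AB: "A i \<subseteq> B"
      using i by (auto simp: B_def)
    have H2: "2 * measure M H \<le> 2 * \<delta>"
      using H(2) \<delta>'(2) by simp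
    have "AE x in M. x \<in> A i \<longrightarrow> x \<notin> H \<longrightarrow> U x = T x"
      using UT by eventually_elim (use AB BW in blast)
    from sym_diff_image_mod0_le[OF autU autT Af[OF i(1)] H(1) this] H2
    show "measure M (sym_diff (image_mod0 M U (A i)) (image_mod0 M T (A i))) \<le> 2 * \<delta>"
      by (rule order_trans)
    have "AE x in M. T x \<in> A i \<longrightarrow> x \<notin> H \<longrightarrow> U x = T x"
      using UT T1(2)[of 1] AE_space by eventually_elim (use AB in \<open>auto simp: W_def\<close>)
    from sym_diff_vimage_le[OF autU autT Af[OF i(1)] H(1) this] H2
    show "measure M (sym_diff (U -` A i \<inter> space M) (T -` A i \<inter> space M)) \<le> 2 * \<delta>"
      by (rule order_trans)
  next
    fix n i j :: nat assume n: "n \<ge> 1" and i: "i \<ge> 1" "i \<le> K" and j: "j \<ge> 1" "j \<le> K"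
    have AB: "A i \<subseteq> B" "A j \<subseteq> B"
      using i j by (auto simp: B_def)
    have fV: "Y \<inter> V n -` Z \<in> fmeasurable M" and fT: "Y \<inter> (T1 ^^ n) -` Z \<in> fmeasurable M"
      if "Y \<in> fmeasurable M" "Z \<in> fmeasurable M" for Y Z
      using fmeasurable_Int_vimage[OF Vm that(1) fmeasurableD[OF that(2)]]
        fmeasurable_Int_vimage[OF iso_mod0D(1)[OF iT1] that(1) fmeasurableD[OF that(2)]] by auto
    note fi = fV[OF Af[OF i(1)] Af[OF j(1)]] fT[OF Af[OF i(1)] Af[OF j(1)]]
    \<comment> \<open>Up to \<open>L\<close> the powers agree on \<open>B\<close> off
      \<open>X n\<close>. Beyond \<open>L\<close> no agreement is claimed: both overlaps lie between
      0 and \<open>2 * \<delta>\<close>.\<close>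
    have "\<bar>measure M (A i \<inter> V n -` A j) - measure M (A i \<inter> (T1 ^^ n) -` A j)\<bar> \<le> 2 * \<delta>"
    proof (cases "n \<le> L")
      case True
      have le: "measure M P \<le> measure M Q + \<delta>"
        if "AE x in M. x \<in> P \<longrightarrow> x \<in> Q \<union> X n" "P \<in> fmeasurable M" "Q \<in> fmeasurable M" for P Q
      proof -
        have "measure M P \<le> measure M (Q \<union> X n)"
          using that X by (intro measure_mono_AE fmeasurable.Un) (auto dest: fmeasurableD)
        also have "\<dots> \<le> measure M Q + measure M (X n)"
          using that X by (intro measure_Un_le) (auto dest: fmeasurableD)
        finally show ?thesis using mX[OF True] by linarith
      qed
      have "measure M (A i \<inter> V n -` A j) \<le> measure M (A i \<inter> (T1 ^^ n) -` A j) + \<delta>"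
      proof (rule le[OF _ fi])
        show "AE x in M. x \<in> A i \<inter> V n -` A j \<longrightarrow> x \<in> A i \<inter> (T1 ^^ n) -` A j \<union> X n"
          using near[OF True] by eventually_elim (use AB in auto)
      qed
      moreover have "measure M (A i \<inter> (T1 ^^ n) -` A j) \<le> measure M (A i \<inter> V n -` A j) + \<delta>"
      proof (rule le[OF _ fi(2,1)])
        show "AE x in M. x \<in> A i \<inter> (T1 ^^ n) -` A j \<longrightarrow> x \<in> A i \<inter> V n -` A j \<union> X n"
          using near[OF True] by eventually_elim (use AB in auto)
      qed
      ultimately show ?thesis
        using \<delta> by (simp add: abs_le_iff)
    next
      case False
      have "measure M (A i \<inter> V n -` A j) \<le> measure M (B \<inter> V n -` B)"
        using fi fV[OF B B] AB by (intro measure_mono_fmeasurable) (auto dest: fmeasurableD)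
      also have "\<dots> \<le> measure M (B \<inter> (T1 ^^ n) -` B) + \<delta>'"
        using far n B BW by (simp add: V_def[abs_def])
      finally have 1: "measure M (A i \<inter> V n -` A j) \<le> 2 * \<delta>"
        using L[of n] False \<delta>'(2) by simp
      have "measure M (A i \<inter> (T1 ^^ n) -` A j) \<le> measure M (B \<inter> (T1 ^^ n) -` B)"
        using fi fT[OF B B] AB by (intro measure_mono_fmeasurable) (auto dest: fmeasurableD)
      then have 2: "measure M (A i \<inter> (T1 ^^ n) -` A j) \<le> 2 * \<delta>"
        using L[of n] False \<delta> by simp
      show ?thesis
        using 1 2 measure_nonneg[of M "A i \<inter> V n -` A j"] measure_nonneg[of M "A i \<inter> (T1 ^^ n) -` A j"]
        by linarith
    qed
    then show "\<bar>measure M (A i \<inter> (U ^^ n) -` A j) - measure M (A i \<inter> (T ^^ n) -` A j)\<bar> \<le> 2 * \<delta>"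
      using Ueq[OF Af[OF i(1)] Af[OF j(1)]] T1eq[OF Af[OF i(1)] Af[OF j(1)]] by simp
  qed (use \<delta> in auto)
  \<comment> \<open>By \<open>\<tau> \<le> \<delta>\<close> the bound is at most
    \<open>12 * \<delta>\<close>, and \<open>\<delta>\<close> is
    \<open>\<epsilon> / 16\<close>.\<close>
  also have "\<dots> < \<epsilon>"
    using \<tau> \<delta> unfolding \<delta>_def by linarith
  finally have "metric_r M A U T < \<epsilon>" .
  then show ?thesis
    using R UM unfolding U_def N_def by blast
qed

end
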